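(* Let $A:\mathbb{R}^d\to\mathbb{R}^d$ be an expansive dilation and let $V\subseteq L^2(\mathbb{R}^d)$ be an $A$-refinable shift-invariant subspace with spectral function $\sigma_V$. Then the following conditions are equivalent: (1) $\overline{\bigcup_{j\in\mathbb{Z}}\mathcal{D}_A^{j}V}=L^2(\mathbb{R}^{d})$; (2) if $\mathcal{G}\subseteq V$ generates $V$, in the sense that the linear span of the shifts $\{\phi(\cdot-k):\phi\in\mathcal{G},k\in\mathbb{Z}^d\}$ is dense in $V$, then $\bigcup_{\phi\in\mathcal{G}}\bigcup_{j\in\mathbb{Z}}A^{*j}(\mathrm{Supp}(\widehat{\phi}))=\mathbb{R}^d$ (up to a null set); (3) for any bounded measurable set $E\subseteq\mathbb{R}^d$ of positive measure, $$\lim_{j\to\infty}\frac{1}{|A^{*-j}E|}\int_{A^{*-j}E}\sigma_V(\xi)\,d\xi=1;$$ (4) the set $\mathrm{Supp}(\sigma_V)$ is $A^{*-1}$-absorbing in $\mathbb{R}^d$; (5) $\lim_{j\to\infty}\sigma_V(A^{*-j}\xi)>0$ for almost every $\xi\in\mathbb{R}^d$; (6) $\lim_{j\to\infty}\sigma_V(A^{*-j}\xi)=1$ for almost every $\xi\in\mathbb{R}^d$; (7) $\sigma_V$ is $A^*$-locally nonzero at the origin; (8) the origin is a point of $A^*$-approximate continuity of $\sigma_V$ if we put $\sigma_V(0)=1$.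
   Context: Conventions: $\widehat f(\xi)=\int_{\mathbb{R}^d}f(x)e^{-2\pi i x\cdot\xi}dx$ for $f\in L^1\cap L^2$, extended to $L^2(\mathbb{R}^d)$; $|E|$ is Lebesgue measure; $\mathrm{Supp}(f)=\{x: f(x)\neq0\}$; $B_r$ is the open ball of radius $r$ centred at the origin. Equalities and inclusions of sets that depend on $L^2$ functions are understood up to null sets; a union of supports over an uncountable family is understood as the essential union (the smallest measurable set, up to null sets, containing each member up to a null set). A linear map $A:\mathbb{R}^d\to\mathbb{R}^d$ is an expansive dilation if $A(\mathbb{Z}^d)\subseteq\mathbb{Z}^d$ and all (complex) eigenvalues of $A$ have modulus strictly greater than $1$; $d_A=|\det A|$; $A^*$ is the adjoint; $\mathcal{D}_Af(x)=d_A^{1/2}f(Ax)$ on $L^2(\mathbb{R}^d)$. A closed subspace $V\subseteq L^2(\mathbb{R}^d)$ is shift-invariant if $f(\cdot-k)\in V$ for all $f\in V$, $k\in\mathbb{Z}^d$. It is $A$-refinable if $V\subseteq\mathcal{D}_AV$. A tight frame generator of $V$ is a (countable) family $\{\phi^\alpha\}_{\alpha\in I}\subseteq V$ with $\sum_{\alpha\in I}\sum_{k\in\mathbb{Z}^d}|\langle f,\phi^\alpha(\cdot-k)\rangle|^2=\|f\|^2$ for all $f\in V$; every shift-invariant subspace has one. The spectral function of $V$ is $\sigma_V(\xi)=\sum_{\alpha\in I}|\widehat{\phi^\alpha}(\xi)|^2$; up to null sets it does not depend on the chosen tight frame generator. A measurable set $E$ is $A^{*-1}$-absorbing in $\mathbb{R}^d$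 if for almost every $\xi\in\mathbb{R}^d$ there is a positive integer $j_0$ (possibly depending on $\xi$) with $A^{*-j}\xi\in E$ for all $j\ge j_0$. The origin is a point of $A^*$-density for a measurable set $E\subseteq\mathbb{R}^d$ of positive measure if $\lim_{j\to\infty}|E\cap A^{*-j}B_r|/|A^{*-j}B_r|=1$ for all $r>0$. For a measurable $f:\mathbb{R}^d\to\mathbb{C}$, the origin is a point of $A^*$-approximate continuity of $f$ if there is a measurable $E\subseteq\mathbb{R}^d$ of positive measure such that the origin is a point of $A^*$-density for $E$ and $\lim_{x\to0,\,x\in E}f(x)=f(0)$. The function $f$ is $A^*$-locally nonzero at the origin if $\lim_{j\to\infty}|\{x\in A^{*-j}B_1: f(x)=0\}|/|A^{*-j}B_1|=0$. *)

theory Defs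
  imports "HOL-Analysis.Analysis"
begin

text \<open>
  Elements of \<open>L\<^sup>2(\<real>\<^sup>d)\<close> are represented by functions, with no quotient by almost-everywhere
  equality.  Closed subsets in the sense below are automatically saturated: with a function they
  contain all functions almost everywhere equal to it.
\<close>

definition L1 :: "(real ^ 'n \<Rightarrow> complex) set" where
  "L1 = {f. integrable lebesgue f}"

definition L2 :: "(real ^ 'n \<Rightarrow> complex) set" where
  "L2 = {f \<in> borel_measurable lebesgue. integrable lebesgue (\<lambda>x. (cmod (f x))\<^sup>2)}"

definition L2_inner :: "(real ^ 'n \<Rightarrow> complex) \<Rightarrow> (real ^ 'n \<Rightarrow> complex) \<Rightarrow> complex" where
  "L2_inner f g = (LINT x|lebesgue. f x * cnj (g x))"

definition L2_norm :: "(real ^ 'n \<Rightarrow> complex) \<Rightarrow> real" where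
  "L2_norm f = sqrt (LINT x|lebesgue. (cmod (f x))\<^sup>2)"

definition L2_closure :: "(real ^ 'n \<Rightarrow> complex) set \<Rightarrow> (real ^ 'n \<Rightarrow> complex) set" where
  "L2_closure S = {f \<in> L2. \<forall>\<epsilon>>0. \<exists>g \<in> S \<inter> L2. L2_norm (\<lambda>x. f x - g x) < \<epsilon>}"

text \<open>Membership in \<open>L\<^sup>2\<close> is part of the notion of convergence because \<^const>\<open>L2_norm\<close> is \<open>0\<close> on
  functions that are not square-integrable.\<close>

definition L2_tendsto :: "(nat \<Rightarrow> real ^ 'n \<Rightarrow> complex) \<Rightarrow> (real ^ 'n \<Rightarrow> complex) \<Rightarrow> bool" where
  "L2_tendsto F f \<longleftrightarrow> (\<forall>n. F n \<in> L2) \<and> f \<in> L2 \<and> (\<lambda>n. L2_norm (\<lambda>x. F n x - f x)) \<longlonglongrightarrow> 0"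

definition closed_subspace :: "(real ^ 'n \<Rightarrow> complex) set \<Rightarrow> bool" where
  "closed_subspace V \<longleftrightarrow>
     V \<subseteq> L2 \<and> (\<lambda>x. 0) \<in> V \<and>
     (\<forall>f\<in>V. \<forall>g\<in>V. (\<lambda>x. f x + g x) \<in> V) \<and>
     (\<forall>c. \<forall>f\<in>V. (\<lambda>x. c * f x) \<in> V) \<and>
     L2_closure V \<subseteq> V"

definition lin_span :: "(real ^ 'n \<Rightarrow> complex) set \<Rightarrow> (real ^ 'n \<Rightarrow> complex) set" where
  "lin_span S = {\<lambda>x. \<Sum>g\<in>T. c g * g x | T c. finite T \<and> T \<subseteq> S}"

definition fourier_L1 :: "(real ^ 'n \<Rightarrow> complex) \<Rightarrow> real ^ 'n \<Rightarrow> complex" where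
  "fourier_L1 f \<xi> = (LINT x|lebesgue. f x * exp (- 2 * of_real pi * \<i> * of_real (x \<bullet> \<xi>)))"

text \<open>Extension by continuity from \<open>L\<^sup>1 \<inter> L\<^sup>2\<close>.  The value is unique up to a null set only, and
  \<open>SOME\<close> picks a representative.\<close>

definition fourier :: "(real ^ 'n \<Rightarrow> complex) \<Rightarrow> real ^ 'n \<Rightarrow> complex" where
  "fourier f = (SOME g. \<exists>F. (\<forall>n. F n \<in> L1 \<inter> L2) \<and>
     L2_tendsto F f \<and> L2_tendsto (\<lambda>n. fourier_L1 (F n)) g)"

definition supp :: "('a \<Rightarrow> 'b::zero) \<Rightarrow> 'a set" where
  "supp f = {x. f x \<noteq> 0}"

definition int_lattice :: "(real ^ 'n) set" where
  "int_lattice = {k. \<forall>i. k $ i \<in> \<int>}"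

definition translate :: "real ^ 'n \<Rightarrow> (real ^ 'n \<Rightarrow> complex) \<Rightarrow> real ^ 'n \<Rightarrow> complex" where
  "translate k f = (\<lambda>x. f (x - k))"

text \<open>Integer iterates of a bijection.\<close>

definition int_iter :: "('a \<Rightarrow> 'a) \<Rightarrow> int \<Rightarrow> 'a \<Rightarrow> 'a" where
  "int_iter f j = (if j \<ge> 0 then f ^^ nat j else inv f ^^ nat (- j))"

text \<open>The complex eigenvalues of \<open>A\<close> are those of its matrix, regarded as a complex matrix.\<close>

definition complex_eigenvalue :: "(real ^ 'n \<Rightarrow> real ^ 'n) \<Rightarrow> complex \<Rightarrow> bool" where
  "complex_eigenvalue A c \<longleftrightarrow>
     (\<exists>v :: complex ^ 'n. v \<noteq> 0 \<and> map_matrix complex_of_real (matrix A) *v v = c *s v)"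

definition expansive_dilation :: "(real ^ 'n \<Rightarrow> real ^ 'n) \<Rightarrow> bool" where
  "expansive_dilation A \<longleftrightarrow>
     linear A \<and> A ` int_lattice \<subseteq> int_lattice \<and> (\<forall>c. complex_eigenvalue A c \<longrightarrow> cmod c > 1)"

definition dilation_op ::
    "(real ^ 'n \<Rightarrow> real ^ 'n) \<Rightarrow> (real ^ 'n \<Rightarrow> complex) \<Rightarrow> real ^ 'n \<Rightarrow> complex" where
  "dilation_op A f = (\<lambda>x. of_real (sqrt \<bar>det (matrix A)\<bar>) * f (A x))"

definition shift_invariant :: "(real ^ 'n \<Rightarrow> complex) set \<Rightarrow> bool" where
  "shift_invariant V \<longleftrightarrow>
     closed_subspace V \<and> (\<forall>f\<in>V. \<forall>k\<in>int_lattice. translate k f \<in> V)"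

definition refinable ::
    "(real ^ 'n \<Rightarrow> real ^ 'n) \<Rightarrow> (real ^ 'n \<Rightarrow> complex) set \<Rightarrow> bool" where
  "refinable A V \<longleftrightarrow> V \<subseteq> dilation_op A ` V"

definition generates ::
    "(real ^ 'n \<Rightarrow> complex) set \<Rightarrow> (real ^ 'n \<Rightarrow> complex) set \<Rightarrow> bool" where
  "generates G V \<longleftrightarrow> V \<subseteq> L2_closure (lin_span {translate k \<phi> | \<phi> k. \<phi> \<in> G \<and> k \<in> int_lattice})"

text \<open>Countable families are indexed by arbitrary (finite or infinite) sets of natural numbers.\<close>

definition tight_frame_generator ::
    "nat set \<Rightarrow> (nat \<Rightarrow> real ^ 'n \<Rightarrow> complex) \<Rightarrow> (real ^ 'n \<Rightarrow> complex) set \<Rightarrow> bool" where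
  "tight_frame_generator I \<phi> V \<longleftrightarrow>
     (\<forall>\<alpha>\<in>I. \<phi> \<alpha> \<in> V) \<and>
     (\<forall>f\<in>V. ((\<lambda>(\<alpha>, k). (cmod (L2_inner f (translate k (\<phi> \<alpha>))))\<^sup>2) has_sum (L2_norm f)\<^sup>2)
        (I \<times> int_lattice))"

text \<open>The spectral function is determined by \<open>V\<close> up to null sets only; the predicate says
  that \<open>\<sigma>\<close> is one of its versions.\<close>

definition is_spectral_function ::
    "(real ^ 'n \<Rightarrow> complex) set \<Rightarrow> (real ^ 'n \<Rightarrow> real) \<Rightarrow> bool" where
  "is_spectral_function V \<sigma> \<longleftrightarrow>
     \<sigma> \<in> borel_measurable lebesgue \<and>
     (\<exists>I \<phi>. tight_frame_generator I \<phi> V \<and>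
        (AE \<xi> in lebesgue. ((\<lambda>\<alpha>. (cmod (fourier (\<phi> \<alpha>) \<xi>))\<^sup>2) has_sum \<sigma> \<xi>) I))"

text \<open>\<open>U\<close> is a version of the essential union of the family \<open>\<S>\<close>: the smallest measurable set,
  up to null sets, that contains every member up to a null set.\<close>

definition is_essential_union :: "(real ^ 'n) set set \<Rightarrow> (real ^ 'n) set \<Rightarrow> bool" where
  "is_essential_union \<S> U \<longleftrightarrow>
     U \<in> sets lebesgue \<and> (\<forall>S\<in>\<S>. S - U \<in> null_sets lebesgue) \<and>
     (\<forall>W \<in> sets lebesgue. (\<forall>S\<in>\<S>. S - W \<in> null_sets lebesgue) \<longrightarrow> U - W \<in> null_sets lebesgue)"

text \<open>In the remaining notions \<open>B\<close> is a linear bijection; they are used with \<open>B = A\<^sup>*\<close>.\<close>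

definition inv_absorbing :: "(real ^ 'n \<Rightarrow> real ^ 'n) \<Rightarrow> (real ^ 'n) set \<Rightarrow> bool" where
  "inv_absorbing B E \<longleftrightarrow> E \<in> sets lebesgue \<and>
     (AE \<xi> in lebesgue. \<exists>j0>0. \<forall>j\<ge>j0. int_iter B (- int j) \<xi> \<in> E)"

definition density_at_origin :: "(real ^ 'n \<Rightarrow> real ^ 'n) \<Rightarrow> (real ^ 'n) set \<Rightarrow> bool" where
  "density_at_origin B E \<longleftrightarrow> E \<in> sets lebesgue \<and> emeasure lebesgue E > 0 \<and>
     (\<forall>r>0. (\<lambda>j. measure lebesgue (E \<inter> int_iter B (- int j) ` ball 0 r) /
                measure lebesgue (int_iter B (- int j) ` ball 0 r)) \<longlonglongrightarrow> 1)"

definition approx_continuous_at_origin ::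
    "(real ^ 'n \<Rightarrow> real ^ 'n) \<Rightarrow> (real ^ 'n \<Rightarrow> 'b::real_normed_vector) \<Rightarrow> bool" where
  "approx_continuous_at_origin B f \<longleftrightarrow> f \<in> borel_measurable lebesgue \<and>
     (\<exists>E. density_at_origin B E \<and> (f \<longlongrightarrow> f 0) (at 0 within E))"

definition locally_nonzero_at_origin ::
    "(real ^ 'n \<Rightarrow> real ^ 'n) \<Rightarrow> (real ^ 'n \<Rightarrow> 'b::real_normed_vector) \<Rightarrow> bool" where
  "locally_nonzero_at_origin B f \<longleftrightarrow> f \<in> borel_measurable lebesgue \<and>
     (\<lambda>j. measure lebesgue {x \<in> int_iter B (- int j) ` ball 0 1. f x = 0} /
          measure lebesgue (int_iter B (- int j) ` ball 0 1)) \<longlonglongrightarrow> 0"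

definition all_equivalent :: "bool list \<Rightarrow> bool" where
  "all_equivalent Ps \<longleftrightarrow> (\<forall>P \<in> set Ps. \<forall>Q \<in> set Ps. P \<longleftrightarrow> Q)"

end

theory Submission
  imports Defs "HOL-Computational_Algebra.Fundamental_Theorem_Algebra"
begin

text \<open>
  Write \<open>B = A\<^sup>*\<close>.  If the Fourier transform \<open>h\<close> of \<open>f\<close> is bounded and \<open>B\<^sup>-\<^sup>j\<close> maps its support into a
  unit cube, Parseval's identity on that cube gives
  \<open>\<Sum> \<bar>\<langle>f, D\<^sup>j T\<^sub>k \<phi>\<^sub>\<alpha>\<rangle>\<bar>\<^sup>2 = \<integral> \<bar>h\<bar>\<^sup>2 (\<sigma> \<circ> B\<^sup>-\<^sup>j)\<close>; the left-hand side is the squared norm of the projection of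
  \<open>f\<close> to \<open>D\<^sup>j V\<close>.  Testing with indicator functions of small sets, Bessel's inequality and
  \<open>V \<subseteq> D V\<close> yield \<open>\<sigma> \<le> 1\<close> and \<open>\<sigma> \<le> \<sigma> \<circ> B\<^sup>-\<^sup>1\<close>, so \<open>\<sigma> \<circ> B\<^sup>-\<^sup>j\<close> increases to a \<open>B\<close>-invariant limit \<open>s\<close>.
  For \<open>f \<in> V\<close> all these projections fix \<open>f\<close>, and since \<open>B\<^sup>-\<^sup>j\<close> contracts every bounded set into a
  cube, \<open>\<integral> \<bar>f^\<bar>\<^sup>2 s = \<integral> \<bar>f^\<bar>\<^sup>2\<close>; hence \<open>s = 1\<close> wherever \<open>f^\<close>, and therefore \<open>\<sigma>\<close>, is nonzero.
  This dichotomy makes each of the eight conditions equivalent to \<open>s = 1\<close> almost everywhere.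
\<close>

section \<open>The space of square-integrable functions\<close>

text \<open>The restriction to one cube is forced. Coefficients against integer shifts only see the
  periodization of \<open>h\<close> times the conjugate transform of a generator; if the support of
  \<open>h\<close> meets several lattice translates of the cube, the energy contains cross terms
  that \<sigma> does not determine. So at a fixed scale only functions concentrated near one point
  can be tested, which suffices for pointwise inequalities, while a whole \<open>f\<close> in
  \<open>V\<close> is reached only for large \<open>j\<close> and after truncating its transform.

  The projection onto the dilated space is never built. A Parseval frame of a subspace satisfies
  Bessel's inequality on all of L2, so its energy makes sense for every \<open>f\<close>;
  \<open>dist_le_energy\<close> and \<open>inner_le_energy\<close> supply the facts about the
  projection norm that are used.

  \<open>fourier\<close> chooses a representative, so its identities hold almost everywhere only.
  They are proved by integrating against functions of bounded support, for which the transform is an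
  honest integral. Bounded support gives L1 and, after contraction, support in a cube.\<close>

lemma L2_measurable [measurable_dest]: "f \<in> L2 \<Longrightarrow> f \<in> borel_measurable lebesgue"
  by (simp add: L2_def)

lemma L2_integrable: "f \<in> L2 \<Longrightarrow> integrable lebesgue (\<lambda>x. (cmod (f x))\<^sup>2)"
  by (simp add: L2_def)

lemma L2_bound:
  assumes "g \<in> L2" "f \<in> borel_measurable lebesgue" "AE x in lebesgue. cmod (f x) \<le> c * cmod (g x)"
  shows "f \<in> L2"
proof -
  have "integrable lebesgue (\<lambda>x. c\<^sup>2 * (cmod (g x))\<^sup>2)"
    using L2_integrable[OF assms(1)] by simp
  then have "integrable lebesgue (\<lambda>x. (cmod (f x))\<^sup>2)"
  proof (rule Bochner_Integration.integrable_bound)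
    show "(\<lambda>x. (cmod (f x))\<^sup>2) \<in> borel_measurable lebesgue"
      using assms(2) by measurable
    show "AE x in lebesgue. norm ((cmod (f x))\<^sup>2) \<le> norm (c\<^sup>2 * (cmod (g x))\<^sup>2)"
      using assms(3)
    proof eventually_elim
      case (elim x)
      then have "(cmod (f x))\<^sup>2 \<le> (c * cmod (g x))\<^sup>2"
        by (rule power_mono) simp
      then show ?case by (simp add: power_mult_distrib)
    qed
  qed
  with assms(2) show ?thesis by (simp add: L2_def)
qed

lemma L2_dominated:
  assumes "g \<in> L2" "f \<in> borel_measurable lebesgue" "AE x in lebesgue. cmod (f x) \<le> cmod (g x)"
  shows "f \<in> L2"
  by (rule L2_bound[where c=1, OF assms(1,2)]) (use assms(3) in simp)

lemma L2_zero [simp]: "(\<lambda>x. 0) \<in> L2"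
  by (simp add: L2_def)

lemma L2_scale: "f \<in> L2 \<Longrightarrow> (\<lambda>x. c * f x) \<in> L2"
  by (auto simp: L2_def norm_mult power_mult_distrib)

lemma L2_cnj: "f \<in> L2 \<Longrightarrow> (\<lambda>x. cnj (f x)) \<in> L2"
  by (rule L2_bound[where c=1 and g=f])
     (auto intro!: borel_measurable_continuous_onI[of cnj, THEN measurable_compose[rotated]] continuous_intros)

lemma L2_add:
  assumes "f \<in> L2" "g \<in> L2" shows "(\<lambda>x. f x + g x) \<in> L2"
proof -
  have m: "(\<lambda>x. f x + g x) \<in> borel_measurable lebesgue"
    using assms by measurable
  have "integrable lebesgue (\<lambda>x. 2 * (cmod (f x))\<^sup>2 + 2 * (cmod (g x))\<^sup>2)"
    using assms[THEN L2_integrable] by simp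
  then have "integrable lebesgue (\<lambda>x. (cmod (f x + g x))\<^sup>2)"
  proof (rule Bochner_Integration.integrable_bound)
    show "(\<lambda>x. (cmod (f x + g x))\<^sup>2) \<in> borel_measurable lebesgue"
      using m by measurable
    have "(cmod (f x + g x))\<^sup>2 \<le> 2 * (cmod (f x))\<^sup>2 + 2 * (cmod (g x))\<^sup>2" for x
    proof -
      have "(cmod (f x + g x))\<^sup>2 \<le> (cmod (f x) + cmod (g x))\<^sup>2"
        by (intro power_mono norm_triangle_ineq) simp
      also have "\<dots> \<le> 2 * (cmod (f x))\<^sup>2 + 2 * (cmod (g x))\<^sup>2"
        using sum_squares_bound[of "cmod (f x)" "cmod (g x)"] by (simp add: power2_sum)
      finally show ?thesis .
    qed
    then show "AE x in lebesgue. norm ((cmod (f x + g x))\<^sup>2) \<le> norm (2 * (cmod (f x))\<^sup>2 + 2 * (cmod (g x))\<^sup>2)"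
      by simp
  qed
  with m show ?thesis by (simp add: L2_def)
qed

lemma L2_diff: "f \<in> L2 \<Longrightarrow> g \<in> L2 \<Longrightarrow> (\<lambda>x. f x - g x) \<in> L2"
  using L2_add[of f "\<lambda>x. (-1) * g x"] L2_scale[of g "-1"] by simp

lemma L2_sum: "(\<And>i. i \<in> F \<Longrightarrow> f i \<in> L2) \<Longrightarrow> (\<lambda>x. \<Sum>i\<in>F. f i x) \<in> L2"
  by (induction F rule: infinite_finite_induct) (auto intro: L2_add)

lemma L2_mult_bounded:
  assumes "f \<in> L2" "m \<in> borel_measurable lebesgue" "\<And>x. cmod (m x) \<le> c"
  shows "(\<lambda>x. m x * f x) \<in> L2"
proof (rule L2_bound[where c=c, OF assms(1)])
  show "(\<lambda>x. m x * f x) \<in> borel_measurable lebesgue"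
    using assms(1,2) by measurable
  show "AE x in lebesgue. cmod (m x * f x) \<le> c * cmod (f x)"
    using assms(3) by (simp add: norm_mult mult_right_mono)
qed

lemma L2_indicator:
  assumes "f \<in> L2" "S \<in> sets lebesgue"
  shows "(\<lambda>x. indicator S x * f x) \<in> L2"
  by (rule L2_mult_bounded[OF assms(1), where c=1])
     (use assms(2) in \<open>auto simp: indicator_def\<close>)

lemma L2_mult_integrable:
  assumes "f \<in> L2" "g \<in> L2" shows "integrable lebesgue (\<lambda>x. f x * g x)"
proof -
  have "integrable lebesgue (\<lambda>x. (cmod (f x))\<^sup>2 + (cmod (g x))\<^sup>2)"
    using assms[THEN L2_integrable] by simp
  then show ?thesis
  proof (rule Bochner_Integration.integrable_bound)
    show "(\<lambda>x. f x * g x) \<in> borel_measurable lebesgue"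
      using assms by measurable
    have "cmod (f x * g x) \<le> (cmod (f x))\<^sup>2 + (cmod (g x))\<^sup>2" for x
    proof -
      have "0 \<le> cmod (f x) * cmod (g x)" by simp
      then show ?thesis
        using sum_squares_bound[of "cmod (f x)" "cmod (g x)"] unfolding norm_mult by linarith
    qed
    then show "AE x in lebesgue. norm (f x * g x) \<le> norm ((cmod (f x))\<^sup>2 + (cmod (g x))\<^sup>2)"
      by simp
  qed
qed

lemma L2_inner_integrable:
  "f \<in> L2 \<Longrightarrow> g \<in> L2 \<Longrightarrow> integrable lebesgue (\<lambda>x. f x * cnj (g x))"
  by (intro L2_mult_integrable L2_cnj)

lemma L2_norm_nonneg [simp]: "0 \<le> L2_norm f"
  by (simp add: L2_norm_def)

lemma L2_norm_sq: "(L2_norm f)\<^sup>2 = (LINT x|lebesgue. (cmod (f x))\<^sup>2)"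
  by (simp add: L2_norm_def)

lemma L2_norm_zero [simp]: "L2_norm (\<lambda>x. 0) = 0"
  by (simp add: L2_norm_def)

lemma L2_norm_scale: "L2_norm (\<lambda>x. c * f x) = cmod c * L2_norm f"
  by (simp add: L2_norm_def norm_mult power_mult_distrib real_sqrt_mult)

lemma L2_norm_cnj: "L2_norm (\<lambda>x. cnj (f x)) = L2_norm f"
  by (simp add: L2_norm_def)

lemma L2_norm_minus_commute: "L2_norm (\<lambda>x. f x - g x) = L2_norm (\<lambda>x. g x - f x)"
  by (simp add: L2_norm_def norm_minus_commute)

lemma L2_norm_cong_AE:
  assumes "f \<in> borel_measurable lebesgue" "g \<in> borel_measurable lebesgue"
    "AE x in lebesgue. f x = g x"
  shows "L2_norm f = L2_norm g"
proof -
  have "(LINT x|lebesgue. (cmod (f x))\<^sup>2) = (LINT x|lebesgue. (cmod (g x))\<^sup>2)"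
    using assms by (intro integral_cong_AE) auto
  then show ?thesis by (simp add: L2_norm_def)
qed

lemma L2_norm_mono_AE:
  assumes "g \<in> L2" "f \<in> borel_measurable lebesgue" "AE x in lebesgue. cmod (f x) \<le> cmod (g x)"
  shows "L2_norm f \<le> L2_norm g"
proof -
  have "f \<in> L2" by (rule L2_dominated[OF assms])
  have "(LINT x|lebesgue. (cmod (f x))\<^sup>2) \<le> (LINT x|lebesgue. (cmod (g x))\<^sup>2)"
    using assms L2_integrable[OF \<open>f \<in> L2\<close>] L2_integrable[OF assms(1)]
    by (intro integral_mono_AE) (auto elim!: eventually_mono intro!: power_mono)
  then show ?thesis by (simp add: L2_norm_def)
qed

lemma L2_norm_eq_0_iff:
  assumes "f \<in> L2" shows "L2_norm f = 0 \<longleftrightarrow> (AE x in lebesgue. f x = 0)"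
  using integral_nonneg_eq_0_iff_AE[OF L2_integrable[OF assms]] by (simp add: L2_norm_def)

lemma L2_norm_ennreal:
  assumes "f \<in> L2"
  shows "ennreal ((L2_norm f)\<^sup>2) = (\<integral>\<^sup>+x. ennreal ((cmod (f x))\<^sup>2) \<partial>lebesgue)"
  unfolding L2_norm_sq using L2_integrable[OF assms] by (simp add: nn_integral_eq_integral)

lemma L2_Cauchy_Schwarz_abs:
  assumes "f \<in> L2" "g \<in> L2"
  shows "(LINT x|lebesgue. cmod (f x) * cmod (g x)) \<le> L2_norm f * L2_norm g"
proof -
  have [measurable]: "f \<in> borel_measurable lebesgue" "g \<in> borel_measurable lebesgue"
    using assms by (auto dest: L2_measurable)
  have i: "integrable lebesgue (\<lambda>x. cmod (f x) * cmod (g x))"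
    using L2_mult_integrable[OF assms, THEN integrable_norm] by (simp add: norm_mult)
  let ?I = "LINT x|lebesgue. cmod (f x) * cmod (g x)"
  have "ennreal ?I = (\<integral>\<^sup>+x. ennreal (cmod (f x)) * ennreal (cmod (g x)) \<partial>lebesgue)"
    using i by (simp add: nn_integral_eq_integral flip: ennreal_mult)
  then have "(ennreal ?I)\<^sup>2 \<le> (\<integral>\<^sup>+x. (ennreal (cmod (f x)))\<^sup>2 \<partial>lebesgue) * (\<integral>\<^sup>+x. (ennreal (cmod (g x)))\<^sup>2 \<partial>lebesgue)"
    using Cauchy_Schwarz_nn_integral[of "\<lambda>x. ennreal (cmod (f x))" lebesgue "\<lambda>x. ennreal (cmod (g x))"]
    by simp
  also have "\<dots> = ennreal ((L2_norm f * L2_norm g)\<^sup>2)"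
    using assms by (simp add: L2_norm_ennreal ennreal_power power_mult_distrib ennreal_mult)
  finally have "?I\<^sup>2 \<le> (L2_norm f * L2_norm g)\<^sup>2"
    by (simp add: ennreal_power)
  then show ?thesis by (rule power2_le_imp_le) simp
qed

lemma L2_mult_integral_le:
  assumes "f \<in> L2" "g \<in> L2"
  shows "cmod (LINT x|lebesgue. f x * g x) \<le> L2_norm f * L2_norm g"
proof -
  have "cmod (LINT x|lebesgue. f x * g x) \<le> (LINT x|lebesgue. cmod (f x * g x))"
    by (rule integral_norm_bound)
  then show ?thesis using L2_Cauchy_Schwarz_abs[OF assms] by (simp add: norm_mult)
qed

lemma L2_Cauchy_Schwarz:
  assumes "f \<in> L2" "g \<in> L2" shows "cmod (L2_inner f g) \<le> L2_norm f * L2_norm g"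
  unfolding L2_inner_def using L2_mult_integral_le[OF assms(1) L2_cnj[OF assms(2)]]
  by (simp add: L2_norm_cnj)

lemma L2_inner_add_left:
  "f \<in> L2 \<Longrightarrow> g \<in> L2 \<Longrightarrow> h \<in> L2 \<Longrightarrow> L2_inner (\<lambda>x. f x + g x) h = L2_inner f h + L2_inner g h"
  by (simp add: L2_inner_def distrib_right L2_inner_integrable)

lemma L2_inner_scale_left: "L2_inner (\<lambda>x. c * f x) h = c * L2_inner f h"
  by (simp add: L2_inner_def mult.assoc)

lemma L2_inner_cnj: "cnj (L2_inner f g) = L2_inner g f"
  by (simp add: L2_inner_def mult.commute flip: Bochner_Integration.integral_cnj)

lemma L2_inner_scale_right: "L2_inner f (\<lambda>x. c * h x) = cnj c * L2_inner f h"
  by (metis L2_inner_cnj L2_inner_scale_left complex_cnj_mult)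

lemma L2_inner_add_right:
  "f \<in> L2 \<Longrightarrow> g \<in> L2 \<Longrightarrow> h \<in> L2 \<Longrightarrow> L2_inner f (\<lambda>x. g x + h x) = L2_inner f g + L2_inner f h"
  by (simp add: L2_inner_def distrib_left L2_inner_integrable)

lemma L2_inner_diff_left:
  "f \<in> L2 \<Longrightarrow> g \<in> L2 \<Longrightarrow> h \<in> L2 \<Longrightarrow> L2_inner (\<lambda>x. f x - g x) h = L2_inner f h - L2_inner g h"
  by (simp add: L2_inner_def left_diff_distrib L2_inner_integrable)

lemma L2_inner_diff_right:
  "f \<in> L2 \<Longrightarrow> g \<in> L2 \<Longrightarrow> h \<in> L2 \<Longrightarrow> L2_inner f (\<lambda>x. g x - h x) = L2_inner f g - L2_inner f h"
  by (simp add: L2_inner_def right_diff_distrib L2_inner_integrable)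

lemma L2_inner_zero [simp]: "L2_inner (\<lambda>x. 0) f = 0" "L2_inner f (\<lambda>x. 0) = 0"
  by (simp_all add: L2_inner_def)

lemma L2_inner_sum_left:
  assumes "\<And>i. i \<in> F \<Longrightarrow> f i \<in> L2" "g \<in> L2"
  shows "L2_inner (\<lambda>x. \<Sum>i\<in>F. f i x) g = (\<Sum>i\<in>F. L2_inner (f i) g)"
  using assms(1)
  by (induction F rule: infinite_finite_induct) (auto simp: L2_inner_add_left L2_sum assms(2))

lemma L2_inner_sum_right:
  assumes "\<And>i. i \<in> F \<Longrightarrow> f i \<in> L2" "g \<in> L2"
  shows "L2_inner g (\<lambda>x. \<Sum>i\<in>F. f i x) = (\<Sum>i\<in>F. L2_inner g (f i))"
  using assms(1)
  by (induction F rule: infinite_finite_induct) (auto simp: L2_inner_add_right L2_sum assms(2))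

lemma L2_inner_self: "L2_inner f f = of_real ((L2_norm f)\<^sup>2)"
  by (simp add: L2_inner_def L2_norm_sq complex_norm_square[symmetric] flip: of_real_power integral_complex_of_real)

lemma L2_norm_sq_diff:
  assumes "f \<in> L2" "g \<in> L2"
  shows "(L2_norm (\<lambda>x. f x - g x))\<^sup>2 = (L2_norm f)\<^sup>2 - 2 * Re (L2_inner f g) + (L2_norm g)\<^sup>2"
proof -
  have "L2_inner (\<lambda>x. f x - g x) (\<lambda>x. f x - g x) = L2_inner f f - L2_inner f g - L2_inner g f + L2_inner g g"
    using assms by (simp add: L2_inner_diff_left L2_inner_diff_right L2_diff)
  then have "Re (L2_inner (\<lambda>x. f x - g x) (\<lambda>x. f x - g x))
      = Re (L2_inner f f) - Re (L2_inner f g) - Re (cnj (L2_inner f g)) + Re (L2_inner g g)"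
    by (simp add: L2_inner_cnj)
  then show ?thesis by (simp add: L2_inner_self)
qed

lemma L2_norm_triangle:
  assumes "f \<in> L2" "g \<in> L2"
  shows "L2_norm (\<lambda>x. f x + g x) \<le> L2_norm f + L2_norm g"
proof -
  have "(L2_norm (\<lambda>x. f x - (-1) * g x))\<^sup>2 = (L2_norm f)\<^sup>2 + 2 * Re (L2_inner f g) + (L2_norm g)\<^sup>2"
    using L2_norm_sq_diff[OF assms(1) L2_scale[OF assms(2), of "-1"]]
      L2_norm_scale[of "-1" g] L2_inner_scale_right[of f "-1" g] by simp
  also have "\<dots> \<le> (L2_norm f + L2_norm g)\<^sup>2"
    using L2_Cauchy_Schwarz[OF assms] complex_Re_le_cmod[of "L2_inner f g"]
    by (simp add: power2_sum)
  finally have "L2_norm (\<lambda>x. f x - (-1) * g x) \<le> L2_norm f + L2_norm g"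
    by (rule power2_le_imp_le) simp
  then show ?thesis by simp
qed

lemma L2_norm_triangle_diff:
  assumes "f \<in> L2" "g \<in> L2" "h \<in> L2"
  shows "L2_norm (\<lambda>x. f x - h x) \<le> L2_norm (\<lambda>x. f x - g x) + L2_norm (\<lambda>x. g x - h x)"
  using L2_norm_triangle[OF L2_diff[OF assms(1,2)] L2_diff[OF assms(2,3)]] by simp

lemma L2_norm_diff_ge:
  assumes "f \<in> L2" "g \<in> L2"
  shows "\<bar>L2_norm f - L2_norm g\<bar> \<le> L2_norm (\<lambda>x. f x - g x)"
  using L2_norm_triangle[OF L2_diff[OF assms] assms(2)] L2_norm_triangle[OF L2_diff[OF assms(2,1)] assms(1)]
    L2_norm_minus_commute[of f g] by simp

lemma L2_tendstoD:
  assumes "L2_tendsto F f"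
  shows "F n \<in> L2" "f \<in> L2" "(\<lambda>n. L2_norm (\<lambda>x. F n x - f x)) \<longlonglongrightarrow> 0"
  using assms by (auto simp: L2_tendsto_def)

lemma L2_tendsto_norm:
  assumes "L2_tendsto F f" shows "(\<lambda>n. L2_norm (F n)) \<longlonglongrightarrow> L2_norm f"
proof -
  note F = L2_tendstoD[OF assms]
  have "(\<lambda>n. L2_norm (F n) - L2_norm f) \<longlonglongrightarrow> 0"
    by (rule Lim_null_comparison[OF _ F(3)]) (simp add: L2_norm_diff_ge[OF F(1,2)])
  then show ?thesis by (simp add: LIM_zero_iff)
qed

lemma L2_tendsto_mult_integral:
  assumes "L2_tendsto F f" "g \<in> L2"
  shows "(\<lambda>n. LINT x|lebesgue. F n x * g x) \<longlonglongrightarrow> (LINT x|lebesgue. f x * g x)"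
proof -
  note F = L2_tendstoD[OF assms(1)]
  have "(\<lambda>n. (LINT x|lebesgue. F n x * g x) - (LINT x|lebesgue. f x * g x)) \<longlonglongrightarrow> 0"
  proof (rule Lim_null_comparison)
    have "(LINT x|lebesgue. F n x * g x) - (LINT x|lebesgue. f x * g x) = (LINT x|lebesgue. (F n x - f x) * g x)" for n
      using F assms(2) by (simp add: L2_mult_integrable left_diff_distrib)
    then show "\<forall>\<^sub>F n in sequentially. norm ((LINT x|lebesgue. F n x * g x) - (LINT x|lebesgue. f x * g x))
        \<le> L2_norm (\<lambda>x. F n x - f x) * L2_norm g"
      using L2_mult_integral_le[OF L2_diff[OF F(1,2)] assms(2)] by simp
    show "(\<lambda>n. L2_norm (\<lambda>x. F n x - f x) * L2_norm g) \<longlonglongrightarrow> 0"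
      using tendsto_mult_right[OF F(3), of "L2_norm g"] by simp
  qed
  then show ?thesis by (simp add: LIM_zero_iff)
qed

lemma L2_tendsto_inner:
  assumes "L2_tendsto F f" "g \<in> L2"
  shows "(\<lambda>n. L2_inner (F n) g) \<longlonglongrightarrow> L2_inner f g"
  unfolding L2_inner_def by (rule L2_tendsto_mult_integral[OF assms(1) L2_cnj[OF assms(2)]])

lemma L2_dominated_convergence:
  fixes F :: "nat \<Rightarrow> real ^ 'n \<Rightarrow> complex"
  assumes "g \<in> L2" "\<And>n. F n \<in> borel_measurable lebesgue" "f \<in> borel_measurable lebesgue"
    "\<And>n. AE x in lebesgue. cmod (F n x) \<le> cmod (g x)" "AE x in lebesgue. (\<lambda>n. F n x) \<longlonglongrightarrow> f x"
  shows "L2_tendsto F f"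
proof -
  have Fn: "F n \<in> L2" for n
    by (rule L2_bound[where c=1 and g=g]) (use assms(1,2) assms(4)[of n] in simp_all)
  have bd: "AE x in lebesgue. \<forall>n. cmod (F n x) \<le> cmod (g x)" using assms(4) by (simp add: AE_all_countable)
  have "AE x in lebesgue. cmod (f x) \<le> cmod (g x)"
    using bd assms(5) by eventually_elim (rule Lim_bounded[OF tendsto_norm, of _ _ 0], auto)
  then have f: "f \<in> L2"
    by (rule L2_dominated[OF assms(1,3)])
  have "(\<lambda>n. LINT x|lebesgue. (cmod (F n x - f x))\<^sup>2) \<longlonglongrightarrow> (LINT x|(lebesgue::(real^'n) measure). (0::real))"
  proof (rule integral_dominated_convergence)
    \<comment> \<open>The factor 4 comes from squaring \<open>|F n - f| <= 2 |g|\<close>.\<close>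
    show "integrable lebesgue (\<lambda>x. 4 * (cmod (g x))\<^sup>2)"
      using L2_integrable[OF assms(1)] by simp
    show "AE x in lebesgue. norm ((cmod (F n x - f x))\<^sup>2) \<le> 4 * (cmod (g x))\<^sup>2" for n
      using bd \<open>AE x in lebesgue. cmod (f x) \<le> cmod (g x)\<close>
    proof eventually_elim
      case (elim x)
      have "cmod (F n x - f x) \<le> 2 * cmod (g x)"
        using norm_triangle_ineq4[of "F n x" "f x"] elim(1)[rule_format, of n] elim(2) by linarith
      then have "(cmod (F n x - f x))\<^sup>2 \<le> (2 * cmod (g x))\<^sup>2" by (rule power_mono) simp
      then show ?case by (simp add: power_mult_distrib)
    qed
    show "AE x in lebesgue. (\<lambda>n. (cmod (F n x - f x))\<^sup>2) \<longlonglongrightarrow> 0"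
      using assms(5)
    proof eventually_elim
      case (elim x)
      then have "(\<lambda>n. (cmod (F n x - f x))\<^sup>2) \<longlonglongrightarrow> (cmod (f x - f x))\<^sup>2" by (intro tendsto_intros)
      then show ?case by simp
    qed
  qed (use assms(2,3) in simp_all)
  then have "(\<lambda>n. sqrt (LINT x|lebesgue. (cmod (F n x - f x))\<^sup>2)) \<longlonglongrightarrow> sqrt (LINT x|(lebesgue::(real^'n) measure). (0::real))"
    by (rule tendsto_real_sqrt)
  then show ?thesis using Fn f by (simp add: L2_tendsto_def L2_norm_def)
qed

text \<open>Riesz-Fischer: a rapidly converging subsequence converges pointwise almost everywhere,
  and Fatou's lemma turns its limit into an L2 limit of the whole sequence.\<close>

theorem L2_complete:
  fixes F :: "nat \<Rightarrow> real ^ 'n \<Rightarrow> complex"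
  assumes F: "\<And>n. F n \<in> L2"
    and Cauchy: "\<And>\<epsilon>. \<epsilon> > 0 \<Longrightarrow> \<exists>N. \<forall>m\<ge>N. \<forall>n\<ge>N. L2_norm (\<lambda>x. F m x - F n x) < \<epsilon>"
  shows "\<exists>g. L2_tendsto F g"
proof -
  have "\<exists>N. \<forall>k. \<forall>m\<ge>N k. \<forall>n\<ge>N k. L2_norm (\<lambda>x. F m x - F n x) < (1/4)^k"
    by (intro choice allI Cauchy) simp
  then obtain N where N: "\<And>k m n. m \<ge> N k \<Longrightarrow> n \<ge> N k \<Longrightarrow> L2_norm (\<lambda>x. F m x - F n x) < (1/4)^k"
    by blast
  \<comment> \<open>Summing the thresholds makes \<open>r\<close> nondecreasing while it still
    dominates both \<open>N k\<close> and \<open>k\<close>.\<close>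
  define r where "r k = k + (\<Sum>i\<le>k. N i)" for k :: nat
  have rN: "N k \<le> r k" for k
    unfolding r_def using member_le_sum[of k "{..k}" N] by simp
  have rmono: "r k \<le> r (Suc k)" for k by (simp add: r_def)
  have rk: "k \<le> r k" for k by (simp add: r_def)
  have [measurable]: "F n \<in> borel_measurable lebesgue" for n using F[of n] by (rule L2_measurable)
  define d where "d k x = F (r (Suc k)) x - F (r k) x" for k x
  have [measurable]: "d k \<in> borel_measurable lebesgue" for k by (simp add: d_def[abs_def])
  have dL2: "d k \<in> L2" for k unfolding d_def[abs_def] by (intro L2_diff F)
  \<comment> \<open>Since the squared norms are at most 16^-k, the weights 4^k used next leave a
    summable series of integrals. Where the weighted series is finite its terms are bounded by some
    \<open>C\<close>, so \<open>|d k x|\<close> is at most sqrt C times 2^-k and the differences sum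
    absolutely.\<close>
  have dn: "(L2_norm (d k))\<^sup>2 \<le> (1/16)^k" for k
  proof -
    have "L2_norm (d k) \<le> (1/4)^k"
      unfolding d_def[abs_def] by (rule less_imp_le, rule N) (use rN[of k] rmono[of k] in auto)
    then have "(L2_norm (d k))\<^sup>2 \<le> ((1/4)^k)\<^sup>2" by (rule power_mono) simp
    then show ?thesis by (simp add: power2_eq_square flip: power_mult_distrib)
  qed
  have "(\<integral>\<^sup>+x. (\<Sum>k. ennreal (4^k * (cmod (d k x))\<^sup>2)) \<partial>lebesgue) = (\<Sum>k. \<integral>\<^sup>+x. ennreal (4^k * (cmod (d k x))\<^sup>2) \<partial>lebesgue)"
    by (rule nn_integral_suminf) measurable
  also have "\<dots> = (\<Sum>k. ennreal (4^k * (L2_norm (d k))\<^sup>2))"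
    by (intro suminf_cong) (simp add: ennreal_mult nn_integral_cmult L2_norm_ennreal[OF dL2])
  also have "\<dots> \<le> (\<Sum>k. ennreal ((1/4)^k))"
  proof (intro suminf_le summableI allI ennreal_leI)
    fix k show "4^k * (L2_norm (d k))\<^sup>2 \<le> (1/4)^k"
      using mult_left_mono[OF dn[of k], of "4^k"] by (simp flip: power_mult_distrib)
  qed
  also have "\<dots> = ennreal (\<Sum>k. (1/4)^k)"
    by (rule suminf_ennreal2) (simp_all add: summable_geometric)
  also have "\<dots> < \<infinity>" by simp
  finally have "AE x in lebesgue. (\<Sum>k. ennreal (4^k * (cmod (d k x))\<^sup>2)) \<noteq> \<infinity>"
    by (intro nn_integral_PInf_AE) auto
  then have conv: "AE x in lebesgue. convergent (\<lambda>k. F (r k) x)"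
  proof eventually_elim
    case (elim x)
    let ?a = "\<lambda>k. 4^k * (cmod (d k x))\<^sup>2"
    have "summable ?a" by (rule summable_suminf_not_top) (use elim in auto)
    then have "?a \<longlonglongrightarrow> 0" by (rule summable_LIMSEQ_zero)
    then have "Bseq ?a" by (intro convergent_imp_Bseq) (auto simp: convergent_def)
    then obtain C where C: "C > 0" "\<And>k. norm (?a k) \<le> C" by (auto simp: Bseq_def)
    have "summable (\<lambda>k. d k x)"
    proof (rule summable_comparison_test'[where N=0])
      show "summable (\<lambda>k. sqrt C * (1/2)^k)" by (intro summable_mult summable_geometric) simp
      fix k :: nat
      have "(2^k * cmod (d k x))\<^sup>2 \<le> C"
        using C(2)[of k] by (simp add: power_mult_distrib flip: power_mult) (simp add: power_mult mult.commute[of k])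
      then have "2^k * cmod (d k x) \<le> sqrt C" by (rule real_le_rsqrt)
      then show "norm (d k x) \<le> sqrt C * (1/2)^k" by (simp add: field_simps power_divide)
    qed
    then have "convergent (\<lambda>n. \<Sum>k<n. d k x)" by (simp add: summable_iff_convergent)
    moreover have "(\<Sum>k<n. d k x) = F (r n) x - F (r 0) x" for n
      unfolding d_def by (rule sum_lessThan_telescope)
    ultimately have "convergent (\<lambda>n. (F (r n) x - F (r 0) x) + F (r 0) x)"
      by (intro convergent_add convergent_const) simp
    then show ?case by simp
  qed
  define g where "g x = lim (\<lambda>k. F (r k) x)" for x
  have [measurable]: "g \<in> borel_measurable lebesgue" unfolding g_def by measurable
  have lim: "AE x in lebesgue. (\<lambda>k. F (r k) x) \<longlonglongrightarrow> g x"
    using conv by eventually_elim (simp add: g_def convergent_LIMSEQ_iff)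
  \<comment> \<open>The index \<open>n\<close> is fixed and the limit is taken along the subsequence
    in the second argument, so the bound holds for every \<open>n\<close> and not only along
    \<open>r\<close>.\<close>
  have fatou: "(\<integral>\<^sup>+x. ennreal ((cmod (F n x - g x))\<^sup>2) \<partial>lebesgue) \<le> ennreal (\<epsilon>\<^sup>2)"
    if "\<epsilon> > 0" "\<And>k. k \<ge> M \<Longrightarrow> L2_norm (\<lambda>x. F n x - F k x) < \<epsilon>" for n M \<epsilon>
  proof -
    have "(\<integral>\<^sup>+x. ennreal ((cmod (F n x - g x))\<^sup>2) \<partial>lebesgue)
        = (\<integral>\<^sup>+x. liminf (\<lambda>k. ennreal ((cmod (F n x - F (r k) x))\<^sup>2)) \<partial>lebesgue)"
    proof (intro nn_integral_cong_AE, use lim in eventually_elim)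
      case (elim x)
      have "(\<lambda>k. ennreal ((cmod (F n x - F (r k) x))\<^sup>2)) \<longlonglongrightarrow> ennreal ((cmod (F n x - g x))\<^sup>2)"
        by (intro tendsto_intros elim)
      from lim_imp_Liminf[OF _ this] show ?case by simp
    qed
    also have "\<dots> \<le> liminf (\<lambda>k. \<integral>\<^sup>+x. ennreal ((cmod (F n x - F (r k) x))\<^sup>2) \<partial>lebesgue)"
      by (rule nn_integral_liminf) measurable
    also have "\<dots> \<le> liminf (\<lambda>k. ennreal (\<epsilon>\<^sup>2))"
    proof (rule Liminf_mono, use eventually_ge_at_top[of M] in eventually_elim)
      case (elim k)
      have "(L2_norm (\<lambda>x. F n x - F (r k) x))\<^sup>2 \<le> \<epsilon>\<^sup>2"
        by (rule power_mono) (use that(2)[of "r k"] elim rk[of k] in auto)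
      then show ?case by (simp add: L2_diff F ennreal_leI flip: L2_norm_ennreal)
    qed
    finally show ?thesis by (simp add: Liminf_const)
  qed
  have sub: "(\<lambda>x. F n x - g x) \<in> L2 \<and> L2_norm (\<lambda>x. F n x - g x) \<le> \<epsilon>"
    if "\<epsilon> > 0" "\<And>k. k \<ge> M \<Longrightarrow> L2_norm (\<lambda>x. F n x - F k x) < \<epsilon>" for n M \<epsilon>
  proof -
    note fa = fatou[OF that]
    have "(\<integral>\<^sup>+x. ennreal (norm ((cmod (F n x - g x))\<^sup>2)) \<partial>lebesgue) < \<infinity>"
      using le_less_trans[OF fa ennreal_less_top] by simp
    then have L: "(\<lambda>x. F n x - g x) \<in> L2"
      by (auto simp: L2_def integrable_iff_bounded)
    have "(L2_norm (\<lambda>x. F n x - g x))\<^sup>2 \<le> \<epsilon>\<^sup>2"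
      using fa that(1) unfolding L2_norm_ennreal[OF L, symmetric] by (simp add: ennreal_le_iff)
    then have "L2_norm (\<lambda>x. F n x - g x) \<le> \<epsilon>"
      by (rule power2_le_imp_le) (use that(1) in simp)
    with L show ?thesis by simp
  qed
  have "L2_tendsto F g" unfolding L2_tendsto_def
  proof (intro conjI allI F)
    obtain M where "\<forall>m\<ge>M. \<forall>n\<ge>M. L2_norm (\<lambda>x. F m x - F n x) < 1" using Cauchy[of 1] by auto
    then have "(\<lambda>x. F M x - g x) \<in> L2" using sub[of 1 M M] by simp
    then have "(\<lambda>x. F M x - (F M x - g x)) \<in> L2" by (rule L2_diff[OF F])
    then show "g \<in> L2" by simp
    show "(\<lambda>n. L2_norm (\<lambda>x. F n x - g x)) \<longlonglongrightarrow> 0"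
    proof (rule LIMSEQ_I)
      fix e :: real assume "e > 0"
      then obtain M where M: "\<forall>m\<ge>M. \<forall>n\<ge>M. L2_norm (\<lambda>x. F m x - F n x) < e/2" using Cauchy[of "e/2"] by auto
      show "\<exists>no. \<forall>n\<ge>no. norm (L2_norm (\<lambda>x. F n x - g x) - 0) < e"
        using sub[of "e/2" M] M \<open>e > 0\<close> by (intro exI[of _ M]) (fastforce)
    qed
  qed
  then show ?thesis by blast
qed

text \<open>Both the argument and the value are cut off: bounded support makes the function
  integrable and lets contractions move its support into a cube, and bounded values keep products
  with L2 functions in L2.\<close>

definition truncate :: "nat \<Rightarrow> (real ^ 'n \<Rightarrow> complex) \<Rightarrow> real ^ 'n \<Rightarrow> complex" where
  "truncate R h x = (if norm x \<le> real R \<and> cmod (h x) \<le> real R then h x else 0)"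

lemma continuous_measurable_lebesgue:
  "continuous_on UNIV f \<Longrightarrow> f \<in> borel_measurable lebesgue"
  by (rule measurable_completion) (simp add: borel_measurable_continuous_onI)

lemma truncate_measurable [measurable]:
  assumes [measurable]: "h \<in> borel_measurable lebesgue"
  shows "truncate R h \<in> borel_measurable lebesgue"
proof -
  have [measurable]: "(\<lambda>x::real^'n. norm x) \<in> borel_measurable lebesgue"
    by (intro continuous_measurable_lebesgue continuous_intros)
  show ?thesis unfolding truncate_def[abs_def] by measurable
qed

lemma truncate_bounds:
  "cmod (truncate R h x) \<le> real R" "cmod (truncate R h x) \<le> cmod (h x)"
  "norm x > real R \<Longrightarrow> truncate R h x = 0"
  by (simp_all add: truncate_def)

lemma truncate_L2: "h \<in> L2 \<Longrightarrow> truncate R h \<in> L2"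
  by (rule L2_dominated[of h]) (auto simp: truncate_bounds intro: truncate_measurable L2_measurable)

lemma truncate_tendsto: "(\<lambda>R. truncate R h x) \<longlonglongrightarrow> h x"
proof (rule tendsto_eventually)
  obtain N where N: "max (norm x) (cmod (h x)) \<le> real N" using real_arch_simple by blast
  show "\<forall>\<^sub>F R in sequentially. truncate R h x = h x"
    using eventually_ge_at_top[of N]
  proof eventually_elim
    case (elim R)
    then have "real N \<le> real R" by simp
    with N show ?case by (simp add: truncate_def)
  qed
qed

lemma truncate_L2_tendsto: "h \<in> L2 \<Longrightarrow> L2_tendsto (\<lambda>R. truncate R h) h"
  by (rule L2_dominated_convergence[of h])
     (auto simp: truncate_bounds truncate_tendsto intro: truncate_measurable L2_measurable)

definition bounded_support :: "(real ^ 'n \<Rightarrow> complex) \<Rightarrow> bool" where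
  "bounded_support f \<longleftrightarrow> (\<exists>R. \<forall>x. norm x > R \<longrightarrow> f x = 0)"

lemma bounded_support_truncate [simp]: "bounded_support (truncate R h)"
  unfolding bounded_support_def using truncate_bounds(3) by blast

lemma L2_bounded_measurable:
  fixes f :: "real ^ 'n \<Rightarrow> complex"
  assumes [measurable]: "f \<in> borel_measurable lebesgue" and b: "\<And>x. cmod (f x) \<le> c" and "bounded_support f"
  shows "f \<in> L2"
proof -
  from assms(3) obtain R where R: "\<And>x. norm x > R \<Longrightarrow> f x = 0" by (auto simp: bounded_support_def)
  have "integrable lebesgue (\<lambda>x::real^'n. indicator (cball 0 R) x * c\<^sup>2 :: real)"
    using lmeasurable_cball[of "0::real^'n" R] unfolding lmeasurable_iff_integrable
    by (intro integrable_mult_left)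
  then have "integrable lebesgue (\<lambda>x. (cmod (f x))\<^sup>2)"
  proof (rule Bochner_Integration.integrable_bound)
    have "norm ((cmod (f x))\<^sup>2) \<le> norm (indicator (cball 0 R) x * c\<^sup>2)" for x
    proof (cases "norm x > R")
      case True then show ?thesis by (simp add: R)
    next
      case False
      then show ?thesis using power_mono[OF b[of x], of 2] by simp
    qed
    then show "AE x in lebesgue. norm ((cmod (f x))\<^sup>2) \<le> norm (indicator (cball 0 R) x * c\<^sup>2)" by simp
  qed measurable
  then show ?thesis by (simp add: L2_def)
qed

lemma bounded_support_L1:
  fixes f :: "real ^ 'n \<Rightarrow> complex"
  assumes "f \<in> L2" "bounded_support f" shows "f \<in> L1"
proof -
  from assms(2) obtain R where R: "\<And>x. norm x > R \<Longrightarrow> f x = 0" by (auto simp: bounded_support_def)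
  have "(\<lambda>x::real^'n. indicator (cball 0 R) x :: complex) \<in> L2"
  proof (rule L2_bounded_measurable[where c=1])
    show "(\<lambda>x::real^'n. indicator (cball 0 R) x :: complex) \<in> borel_measurable lebesgue"
      by (rule borel_measurable_indicator) simp
    show "bounded_support (\<lambda>x::real^'n. indicator (cball 0 R) x :: complex)"
      unfolding bounded_support_def by (intro exI[of _ R]) (auto simp: indicator_def)
  qed (simp add: indicator_def)
  then have "integrable lebesgue (\<lambda>x. f x * indicator (cball 0 R) x)"
    by (rule L2_mult_integrable[OF assms(1)])
  also have "(\<lambda>x. f x * indicator (cball 0 R) x) = f"
    using R by (auto simp: fun_eq_iff indicator_def not_le)
  finally show ?thesis by (simp add: L1_def)
qed

text \<open>Testing with truncations of the conjugate of \<open>f\<close> and passing to the limit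
  gives that the norm of \<open>f\<close> is 0.\<close>

lemma L2_eq_0_testing:
  fixes f :: "real ^ 'n \<Rightarrow> complex"
  assumes f: "f \<in> L2" and orth: "\<And>w. w \<in> L2 \<Longrightarrow> bounded_support w \<Longrightarrow> (LINT x|lebesgue. f x * w x) = 0"
  shows "AE x in lebesgue. f x = 0"
proof -
  let ?w = "\<lambda>R. truncate R (\<lambda>x. cnj (f x))"
  have "(\<lambda>R. LINT x|lebesgue. ?w R x * f x) \<longlonglongrightarrow> (LINT x|lebesgue. cnj (f x) * f x)"
    by (intro L2_tendsto_mult_integral truncate_L2_tendsto L2_cnj f)
  moreover have "(LINT x|lebesgue. ?w R x * f x) = 0" for R
    using orth[OF truncate_L2[OF L2_cnj[OF f]]] by (simp add: mult.commute)
  ultimately have "L2_inner f f = 0"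
    by (simp add: L2_inner_def LIMSEQ_const_iff mult.commute)
  then have "L2_norm f = 0" by (simp add: L2_inner_self)
  then show ?thesis using L2_norm_eq_0_iff[OF f] by simp
qed

lemma L2_eq_testing:
  fixes f g :: "real ^ 'n \<Rightarrow> complex"
  assumes "f \<in> L2" "g \<in> L2"
    and "\<And>w. w \<in> L2 \<Longrightarrow> bounded_support w \<Longrightarrow> (LINT x|lebesgue. f x * w x) = (LINT x|lebesgue. g x * w x)"
  shows "AE x in lebesgue. f x = g x"
proof -
  have "AE x in lebesgue. f x - g x = 0"
    by (rule L2_eq_0_testing) (use assms in \<open>simp_all add: L2_diff left_diff_distrib L2_mult_integrable\<close>)
  then show ?thesis by simp
qed

section \<open>Linear changes of variables\<close>

lemma linear_bij_inv:
  fixes L :: "real ^ 'n \<Rightarrow> real ^ 'n"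
  assumes "linear L" "bij L"
  shows "linear (inv L)" "bij (inv L)" "det (matrix L) \<noteq> 0" "det (matrix (inv L)) = inverse (det (matrix L))"
proof -
  show l: "linear (inv L)" using assms by (simp add: bij_is_inj inj_linear_imp_inv_linear)
  show "bij (inv L)" using assms by (simp add: bij_imp_bij_inv)
  have "inv L \<circ> L = id" using assms(2) by (simp add: bij_is_inj)
  then have "matrix (inv L) ** matrix L = mat 1"
    using matrix_compose[OF assms(1) l] by (simp add: matrix_id_mat_1)
  then have "det (matrix (inv L)) * det (matrix L) = 1"
    by (metis det_I det_mul)
  then show "det (matrix L) \<noteq> 0" "det (matrix (inv L)) = inverse (det (matrix L))"
    using inverse_unique[of "det (matrix L)" "det (matrix (inv L))"] by (auto simp: mult.commute)
qed

lemma det_matrix_shear: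
  assumes "m \<noteq> n"
  shows "det (matrix (\<lambda>v::real^'n. \<chi> i. if i = m then v $ m + v $ n else v $ i)) = 1"
proof -
  have "matrix (\<lambda>v::real^'n. \<chi> i. if i = m then v $ m + v $ n else v $ i)
      = (\<chi> k. if k = m then row m (mat 1) + 1 *s row n (mat 1) else row k (mat 1))"
    by (auto simp: vec_eq_iff matrix_def row_def mat_def axis_def)
  then show ?thesis by (simp only: det_row_operation[OF assms] det_I)
qed

text \<open>The library's \<open>measure_linear_image\<close> requires the index type to be well-ordered.\<close>

lemma lmeasurable_linear_image:
  fixes L :: "real ^ 'n \<Rightarrow> real ^ 'n"
  assumes "linear L" "S \<in> lmeasurable"
  shows "L ` S \<in> lmeasurable \<and> measure lebesgue (L ` S) = \<bar>det (matrix L)\<bar> * measure lebesgue S"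
proof -
  let ?P = "\<lambda>L::real^'n \<Rightarrow> real^'n. \<forall>S\<in>lmeasurable.
    L ` S \<in> lmeasurable \<and> measure lebesgue (L ` S) = \<bar>det (matrix L)\<bar> * measure lebesgue S"
  \<comment> \<open>For maps with determinant of modulus 1 it is enough that boxes keep their
    volume; swaps and shears are treated this way.\<close>
  have suff: "?P h" if "linear h" "\<bar>det (matrix h)\<bar> = 1"
    "\<And>a b. cbox a b \<noteq> {} \<Longrightarrow> measure lebesgue (h ` cbox a b) = measure lebesgue (cbox a b)" for h :: "real^'n \<Rightarrow> real^'n"
  proof
    fix S :: "(real^'n) set" assume S: "S \<in> lmeasurable"
    have "measure lebesgue (h ` cbox a b) = 1 * measure lebesgue (cbox a b)" for a b
      using that(3)[of a b] by (cases "cbox a b = {}") auto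
    from measure_linear_sufficient[OF that(1) S this] that(2)
    show "h ` S \<in> lmeasurable \<and> measure lebesgue (h ` S) = \<bar>det (matrix h)\<bar> * measure lebesgue S" by simp
  qed
  have "?P L"
  proof (rule induct_linear_elementary[OF assms(1)])
    fix f g :: "real^'n \<Rightarrow> real^'n" assume "linear f" "linear g" "?P f" "?P g"
    then show "?P (f \<circ> g)"
      by (simp only: image_comp[symmetric] matrix_compose det_mul abs_mult mult.assoc) simp
  next
    fix f :: "real^'n \<Rightarrow> real^'n" and i assume f: "linear f" "\<And>x. f x $ i = 0"
    then have ni: "\<not> inj f"
      by (metis (full_types) linear_injective_imp_surjective one_neq_zero surjE vec_component)
    then have "det (matrix f) = 0" using det_nz_iff_inj[OF f(1)] by blast
    moreover have "negligible (f ` S)" for S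
      using negligible_linear_singular_image[OF f(1) ni] .
    ultimately show "?P f"
      by (auto simp: negligible_imp_measurable negligible_imp_measure0)
  next
    fix c :: "'n \<Rightarrow> real" show "?P (\<lambda>x. \<chi> i. c i * x $ i)"
      by (simp add: measurable_stretch measure_stretch axis_def matrix_def det_diagonal)
  next
    fix m n :: 'n assume "m \<noteq> n"
    let ?h = "\<lambda>x::real^'n. \<chi> i. x $ Transposition.transpose m n i"
    show "?P ?h"
    proof (rule suff)
      show "linear ?h" by (rule linearI) (simp_all add: plus_vec_def scaleR_vec_def)
      have "matrix ?h = transpose (\<chi> i j. mat 1 $ i $ Transposition.transpose m n j)"
        by (auto simp: vec_eq_iff transpose_def axis_def mat_def matrix_def)
      then show "\<bar>det (matrix ?h)\<bar> = 1"
        by (simp add: det_permute_columns permutes_swap_id sign_swap_id abs_mult)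
      fix a b :: "real^'n" assume ne: "cbox a b \<noteq> {}"
      have "?h ` cbox a b = cbox (?h a) (?h b)"
        by (auto simp: image_iff lambda_swap_Galois mem_box_cart) (metis transpose_involutory)+
      moreover from this have "cbox (?h a) (?h b) \<noteq> {}" using ne by (metis image_is_empty)
      ultimately show "measure lebesgue (?h ` cbox a b) = measure lebesgue (cbox a b)"
        using ne prod.permute[OF permutes_swap_id, where S=UNIV and g="\<lambda>i. (b - a) $ i", of m n]
        by (simp add: content_cbox_cart)
    qed
  next
    fix m n :: 'n assume mn: "m \<noteq> n"
    let ?h = "\<lambda>x::real^'n. \<chi> i. if i = m then x $ m + x $ n else x $ i"
    show "?P ?h"
    proof (rule suff)
      show lin: "linear ?h"
        by (rule linearI) (auto simp: algebra_simps plus_vec_def scaleR_vec_def vec_eq_iff)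
      show "\<bar>det (matrix ?h)\<bar> = 1" using det_matrix_shear[OF mn] by simp
      fix a b :: "real^'n" assume ne: "cbox a b \<noteq> {}"
      have eq: "cbox a b = (+) a ` cbox 0 (b - a)"
        using cbox_translation[of a 0 "b - a"] by simp
      have "?h ` cbox a b = (+) (?h a) ` ?h ` cbox 0 (b - a)"
        unfolding eq image_image by (simp only: linear_add[OF lin])
      then have "measure lebesgue (?h ` cbox a b) = measure lebesgue (?h ` cbox 0 (b - a))"
        by (simp only: measure_translation)
      also have "\<dots> = measure lebesgue (cbox 0 (b - a))"
        using ne eq by (intro measure_shear_interval[OF mn]) auto
      also have "\<dots> = measure lebesgue (cbox a b)"
        unfolding eq by (simp only: measure_translation)
      finally show "measure lebesgue (?h ` cbox a b) = measure lebesgue (cbox a b)" .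
    qed
  qed
  with assms(2) show ?thesis by blast
qed

lemma linear_image_sets_lebesgue:
  fixes L :: "real ^ 'n \<Rightarrow> real ^ 'n"
  assumes "linear L" "S \<in> sets lebesgue" shows "L ` S \<in> sets lebesgue"
  using assms by (intro differentiable_image_in_sets_lebesgue linear_imp_differentiable_on) auto

lemma linear_measurable_lebesgue:
  fixes L :: "real ^ 'n \<Rightarrow> real ^ 'n"
  assumes "linear L" "bij L" shows "L \<in> lebesgue \<rightarrow>\<^sub>M lebesgue"
proof (rule measurableI)
  fix S :: "(real^'n) set" assume "S \<in> sets lebesgue"
  then show "L -` S \<inter> space lebesgue \<in> sets lebesgue"
    using linear_image_sets_lebesgue[OF linear_bij_inv(1)[OF assms]] assms(2)
    by (simp add: bij_vimage_eq_inv_image)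
qed simp

lemma emeasure_linear_image:
  fixes L :: "real ^ 'n \<Rightarrow> real ^ 'n"
  assumes L: "linear L" "bij L" and S: "S \<in> sets lebesgue"
  shows "emeasure lebesgue (L ` S) = ennreal \<bar>det (matrix L)\<bar> * emeasure lebesgue S"
proof (cases "emeasure lebesgue S < \<infinity>")
  case True
  then have "S \<in> lmeasurable" using S by (simp add: fmeasurable_def)
  then show ?thesis
    using lmeasurable_linear_image[OF L(1), of S]
    by (simp add: emeasure_eq_measure2 ennreal_mult)
next
  case False
  \<comment> \<open>An image of finite measure would be carried back by the inverse map to a set
    \<open>S\<close> of finite measure.\<close>
  have "emeasure lebesgue (L ` S) = \<infinity>"
  proof (rule ccontr)
    assume "emeasure lebesgue (L ` S) \<noteq> \<infinity>"
    then have "L ` S \<in> lmeasurable"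
      using linear_image_sets_lebesgue[OF L(1) S] by (simp add: fmeasurable_def top.not_eq_extremum)
    then have "inv L ` (L ` S) \<in> lmeasurable"
      using lmeasurable_linear_image[OF linear_bij_inv(1)[OF L]] by blast
    then have "S \<in> lmeasurable" using L(2) by (simp add: image_comp bij_is_inj)
    then have "emeasure lebesgue S < \<infinity>" unfolding fmeasurable_def by blast
    with False show False ..
  qed
  moreover have "emeasure lebesgue S = \<infinity>" using False by (simp add: not_less top_unique)
  ultimately show ?thesis using linear_bij_inv(3)[OF L] by (simp add: ennreal_mult_top)
qed

text \<open>One identity of measures from which the change of variables for integrals, for
  integrability and for almost everywhere statements all follow.\<close>

lemma distr_linear:
  fixes L :: "real ^ 'n \<Rightarrow> real ^ 'n"
  assumes L: "linear L" "bij L"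
  shows "distr lebesgue lebesgue L = density lebesgue (\<lambda>_. ennreal (inverse \<bar>det (matrix L)\<bar>))"
proof (rule measure_eqI)
  fix S :: "(real^'n) set" assume "S \<in> sets (distr lebesgue lebesgue L)"
  then have S: "S \<in> sets lebesgue" by simp
  have "L -` S = inv L ` S" using L(2) by (simp add: bij_vimage_eq_inv_image)
  then show "emeasure (distr lebesgue lebesgue L) S = emeasure (density lebesgue (\<lambda>_. ennreal (inverse \<bar>det (matrix L)\<bar>))) S"
    using S emeasure_linear_image[OF linear_bij_inv(1,2)[OF L] S]
    by (simp add: emeasure_distr linear_measurable_lebesgue[OF L] emeasure_density_const linear_bij_inv(4)[OF L] abs_inverse)
qed simp

lemma
  fixes L :: "real ^ 'n \<Rightarrow> real ^ 'n" and f :: "real ^ 'n \<Rightarrow> 'b::{banach, second_countable_topology}"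
  assumes L: "linear L" "bij L" and f: "f \<in> borel_measurable lebesgue"
  shows integral_linear: "(LINT x|lebesgue. f (L x)) = inverse \<bar>det (matrix L)\<bar> *\<^sub>R (LINT x|lebesgue. f x)"
    and integrable_linear: "integrable lebesgue (\<lambda>x. f (L x)) \<longleftrightarrow> integrable lebesgue f"
proof -
  have "(LINT x|lebesgue. f (L x)) = (LINT x|distr lebesgue lebesgue L. f x)"
    by (rule integral_distr[symmetric, OF linear_measurable_lebesgue[OF L]]) (use f in simp)
  then show "(LINT x|lebesgue. f (L x)) = inverse \<bar>det (matrix L)\<bar> *\<^sub>R (LINT x|lebesgue. f x)"
    using f by (simp add: distr_linear[OF L] integral_density)
  have "integrable lebesgue (\<lambda>x. f (L x)) \<longleftrightarrow> integrable (distr lebesgue lebesgue L) f"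
    by (rule integrable_distr_eq[symmetric, OF linear_measurable_lebesgue[OF L]]) (use f in simp)
  then show "integrable lebesgue (\<lambda>x. f (L x)) \<longleftrightarrow> integrable lebesgue f"
    using f linear_bij_inv(3)[OF L]
      integrable_scaleR_right[of "inverse \<bar>det (matrix L)\<bar>" lebesgue f]
      integrable_scaleR_right[of "\<bar>det (matrix L)\<bar>" lebesgue "\<lambda>x. inverse \<bar>det (matrix L)\<bar> *\<^sub>R f x"]
    by (auto simp: distr_linear[OF L] integrable_density)
qed

text \<open>The image measure is a multiple of Lebesgue measure. This is how exceptional null sets
  are carried along the orbits of the dilation.\<close>

lemma AE_linear:
  fixes L :: "real ^ 'n \<Rightarrow> real ^ 'n"
  assumes L: "linear L" "bij L" and P: "AE x in lebesgue. P x"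
  shows "AE x in lebesgue. P (L x)"
proof -
  have "AE x in density lebesgue (\<lambda>_. ennreal (inverse \<bar>det (matrix L)\<bar>)). P x"
    by (subst AE_density) (use P in auto)
  then have "AE x in distr lebesgue lebesgue L. P x" unfolding distr_linear[OF L] .
  then show ?thesis by (rule AE_distrD[OF linear_measurable_lebesgue[OF L]])
qed

lemma translation_measurable_lebesgue: "(\<lambda>x::real^'n. x + a) \<in> lebesgue \<rightarrow>\<^sub>M lebesgue"
  using lebesgue_affine_measurable[of "\<lambda>_. 1" a] by (simp add: euclidean_representation add.commute)

lemma distr_translation: "distr lebesgue lebesgue (\<lambda>x::real^'n. x + a) = lebesgue"
proof -
  have "lebesgue = density (distr lebesgue lebesgue (\<lambda>x::real^'n. x + a)) (\<lambda>_. 1)"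
    using lebesgue_affine_euclidean[of "\<lambda>_. 1" a] by (simp add: euclidean_representation add.commute)
  then show ?thesis by (simp add: density_1)
qed

lemma integral_translation:
  fixes f :: "real ^ 'n \<Rightarrow> 'b::{banach, second_countable_topology}"
  assumes f: "f \<in> borel_measurable lebesgue"
  shows "(LINT x|lebesgue. f (x + a)) = (LINT x|lebesgue. f x)"
    and "integrable lebesgue (\<lambda>x. f (x + a)) \<longleftrightarrow> integrable lebesgue f"
  using integral_distr[OF translation_measurable_lebesgue, of f a]
    integrable_distr_eq[OF translation_measurable_lebesgue, of f a] f
  by (simp_all add: distr_translation)

lemma nn_integral_translation:
  fixes f :: "real ^ 'n \<Rightarrow> ennreal"
  assumes f: "f \<in> borel_measurable lebesgue"
  shows "(\<integral>\<^sup>+x. f (x + a) \<partial>lebesgue) = (\<integral>\<^sup>+x. f x \<partial>lebesgue)"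
  using nn_integral_distr[OF translation_measurable_lebesgue, of f a] f
  by (simp add: distr_translation)

section \<open>Fourier series on the unit cube\<close>

lemma content_unit_cube: "measure lebesgue (cbox 0 1 :: (real^'n) set) = 1"
proof -
  have "cbox 0 1 \<noteq> ({} :: (real^'n) set)" by (auto simp: interval_ne_empty_cart)
  then show ?thesis by (simp add: content_cbox_cart)
qed

definition character :: "real ^ 'n \<Rightarrow> real ^ 'n \<Rightarrow> complex" where
  "character k x = cis (2 * pi * (k \<bullet> x))"

lemma character_add_left: "character (k + l) x = character k x * character l x"
  by (simp add: character_def inner_add_left distrib_left cis_mult)

lemma character_add_right: "character k (x + y) = character k x * character k y"
  by (simp add: character_def inner_add_right distrib_left cis_mult)

lemma character_commute: "character k x = character x k"
  by (simp add: character_def inner_commute)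

lemma character_minus: "character (- k) x = cnj (character k x)" "character k (- x) = cnj (character k x)"
  by (simp_all add: character_def cis_cnj)

lemma character_0 [simp]: "character 0 x = 1" "character k 0 = 1"
  by (simp_all add: character_def)

lemma norm_character [simp]: "cmod (character k x) = 1"
  by (simp add: character_def)

lemma character_neq_0 [simp]: "character k x \<noteq> 0"
  using norm_character[of k x] by (metis norm_zero zero_neq_one)

lemma continuous_on_character [continuous_intros]:
  "continuous_on S f \<Longrightarrow> continuous_on S (\<lambda>x. character k (f x))"
  unfolding character_def by (intro continuous_intros)

lemma character_measurable [measurable]: "character k \<in> borel_measurable lebesgue"
  by (rule continuous_measurable_lebesgue[OF continuous_on_character[OF continuous_on_id]])

lemma L2_character: "f \<in> L2 \<Longrightarrow> (\<lambda>x. character k x * f x) \<in> L2"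
  by (rule L2_mult_bounded[where c=1]) auto

lemma cis_integral_zero:
  assumes "m \<in> \<int>" "m \<noteq> 0"
  shows "(LINT t|lborel. indicator {0..1} t *\<^sub>R cis (2 * pi * (m * t))) = 0"
proof -
  let ?c = "\<i> * of_real (2 * pi * m)"
  have cis: "cis (2 * pi * (m * t)) = exp (?c * of_real t)" for t
    by (simp add: cis_conv_exp mult_ac)
  have "(LINT t|lborel. indicator {0..1} t *\<^sub>R cis (2 * pi * (m * t))) = exp (?c * of_real 1) / ?c - exp (?c * of_real 0) / ?c"
  proof (rule integral_FTC_Icc)
    fix t :: real
    have "((\<lambda>z. exp (?c * z) / ?c) has_field_derivative exp (?c * of_real t)) (at (of_real t))"
      using assms by (auto intro!: derivative_eq_intros)
    then show "((\<lambda>t. exp (?c * of_real t) / ?c) has_vector_derivative cis (2 * pi * (m * t))) (at t within {0..1})"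
      unfolding cis by (rule has_vector_derivative_real_field)
  qed (auto intro!: continuous_intros)
  also have "\<dots> = 0" using cis[of 1] assms by simp
  finally show ?thesis .
qed

text \<open>Lebesgue measure is the image of a product measure under the coordinate map, so
  integrands with separated variables factor.\<close>

lemma integral_vec_prod:
  fixes g :: "'a::euclidean_space \<Rightarrow> real \<Rightarrow> complex"
  assumes [measurable]: "\<And>b. b \<in> Basis \<Longrightarrow> g b \<in> borel_measurable borel" and "\<And>b. b \<in> Basis \<Longrightarrow> integrable lborel (g b)"
  shows "(LINT x|lborel. (\<Prod>b\<in>Basis. g b (x \<bullet> b))) = (\<Prod>b\<in>Basis. LINT t|lborel. g b t)"
proof -
  interpret product_sigma_finite "\<lambda>_::'a. lborel :: real measure" by standard
  have m: "(\<lambda>f. \<Sum>b\<in>Basis. f b *\<^sub>R b) \<in> (\<Pi>\<^sub>M b\<in>(Basis::'a set). (lborel::real measure)) \<rightarrow>\<^sub>M borel"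
    by measurable
  have "(LINT x|lborel. (\<Prod>b\<in>Basis. g b (x \<bullet> b)))
      = (LINT f|(\<Pi>\<^sub>M b\<in>Basis. lborel). (\<Prod>b\<in>Basis. g b ((\<Sum>b\<in>Basis. f b *\<^sub>R b) \<bullet> b)))"
    by (subst lborel_eq, rule integral_distr[OF m]) measurable
  also have "\<dots> = (LINT f|(\<Pi>\<^sub>M b\<in>Basis. lborel). (\<Prod>b\<in>Basis. g b (f b)))"
    by (intro Bochner_Integration.integral_cong refl prod.cong) simp
  also have "\<dots> = (\<Prod>b\<in>Basis. LINT t|lborel. g b t)"
    by (rule product_integral_prod) (use assms in auto)
  finally show ?thesis .
qed

lemma int_lattice_closed:
  "0 \<in> int_lattice" "k \<in> int_lattice \<Longrightarrow> l \<in> int_lattice \<Longrightarrow> k + l \<in> int_lattice"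
  "k \<in> int_lattice \<Longrightarrow> - k \<in> int_lattice" "k \<in> int_lattice \<Longrightarrow> l \<in> int_lattice \<Longrightarrow> k - l \<in> int_lattice"
  "axis j 1 \<in> int_lattice"
  by (auto simp: int_lattice_def axis_def)

lemma countable_int_lattice: "countable (int_lattice :: (real^'n) set)"
proof -
  have "countable (\<Pi>\<^sub>E j\<in>(UNIV::'n set). (\<int>::real set))"
    by (rule countable_PiE) (auto simp: Ints_def)
  then have "countable (vec_lambda ` (\<Pi>\<^sub>E j\<in>(UNIV::'n set). (\<int>::real set)))" by (rule countable_image)
  moreover have "(int_lattice :: (real^'n) set) \<subseteq> vec_lambda ` (\<Pi>\<^sub>E j\<in>(UNIV::'n set). (\<int>::real set))"
  proof
    fix k :: "real^'n" assume "k \<in> int_lattice"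
    then show "k \<in> vec_lambda ` (\<Pi>\<^sub>E j\<in>(UNIV::'n set). (\<int>::real set))"
      by (intro image_eqI[of _ _ "vec_nth k"]) (auto simp: int_lattice_def vec_nth_inverse)
  qed
  ultimately show ?thesis by (rule countable_subset[rotated])
qed

lemma unit_cube_character_integral:
  fixes k :: "real ^ 'n"
  assumes k: "k \<in> int_lattice"
  shows "(LINT x|lebesgue. indicator (cbox 0 1) x * character k x) = (if k = 0 then 1 else 0)"
proof (cases "k = 0")
  case True
  have "(LINT x|lebesgue. indicator (cbox 0 (1::real^'n)) x *\<^sub>R (1::complex)) = 1"
    using content_unit_cube[where 'n='n] lmeasurable_cbox[of 0 "1::real^'n"]
    by (subst Bochner_Integration.integral_scaleR_left) (simp_all add: lmeasurable_iff_integrable)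
  moreover have "indicator (cbox 0 (1::real^'n)) x *\<^sub>R (1::complex) = indicator (cbox 0 1) x" for x
    by (simp add: indicator_def)
  ultimately show ?thesis using True by simp
next
  case False
  let ?g = "\<lambda>b t. indicator {0..1} t *\<^sub>R cis (2 * pi * ((k \<bullet> b) * t))"
  obtain j where j: "k $ j \<noteq> 0" using False by (auto simp: vec_eq_iff)
  have int: "k \<bullet> axis j 1 \<in> \<int>" "k \<bullet> axis j 1 \<noteq> 0" using k j by (auto simp: int_lattice_def inner_axis)
  have "indicator (cbox 0 1) x * character k x = (\<Prod>b\<in>Basis. ?g b (x \<bullet> b))" for x :: "real^'n"
  proof -
    have "k \<bullet> x = (\<Sum>b\<in>Basis. (k \<bullet> b) * (x \<bullet> b))" by (rule euclidean_inner)
    then have "character k x = (\<Prod>b\<in>Basis. cis (2 * pi * ((k \<bullet> b) * (x \<bullet> b))))"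
      unfolding character_def by (simp add: sum_distrib_left cis_conv_exp exp_sum)
    moreover have "(\<Prod>b\<in>Basis. of_real (indicator {0..1} (x \<bullet> b))) = (indicator (cbox 0 1) x :: complex)"
    proof -
      have "x \<in> cbox 0 1 \<longleftrightarrow> (\<forall>b\<in>Basis. x \<bullet> b \<in> {0..1})"
        by (auto simp: mem_box Basis_vec_def inner_axis)
      then show ?thesis by (auto simp: indicator_def prod_zero_iff)
    qed
    ultimately show ?thesis
      by (simp add: scaleR_conv_of_real prod.distrib del: of_real_indicator)
  qed
  moreover have [measurable]: "(\<lambda>x::real^'n. cis (2 * pi * (c * (x \<bullet> b)))) \<in> borel_measurable borel" for c b
    by (intro borel_measurable_continuous_onI continuous_intros)
  ultimately have "(LINT x|lebesgue. indicator (cbox 0 1) x * character k x) = (LINT x|lborel. (\<Prod>b\<in>Basis. ?g b ((x::real^'n) \<bullet> b)))"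
    by (simp only:) (rule integral_completion, measurable)
  also have "\<dots> = (\<Prod>b\<in>Basis. LINT t|lborel. ?g b t)"
  proof (rule integral_vec_prod)
    show "?g b \<in> borel_measurable borel" for b :: "real^'n"
    proof (rule borel_measurable_scaleR)
      show "(\<lambda>t. cis (2 * pi * ((k \<bullet> b) * t))) \<in> borel_measurable borel"
        by (intro borel_measurable_continuous_onI continuous_intros)
    qed simp
    show "integrable lborel (?g b)" for b :: "real^'n"
      using borel_integrable_compact[of "{0..1}" "\<lambda>t. cis (2 * pi * ((k \<bullet> b) * t))"]
      by (simp add: continuous_intros)
  qed
  \<comment> \<open>The factor belonging to a coordinate in which \<open>k\<close> is a nonzero
    integer vanishes.\<close>
  also have "\<dots> = 0"
    using cis_integral_zero[OF int] by (intro prod_zero bexI[of _ "axis j 1"]) (auto simp: Basis_vec_def)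
  finally show ?thesis using False by simp
qed

section \<open>Trigonometric polynomials and their density on the unit cube\<close>

inductive trig_poly :: "(real ^ 'n \<Rightarrow> complex) \<Rightarrow> bool" where
  monomial: "k \<in> int_lattice \<Longrightarrow> trig_poly (\<lambda>x. c * character k x)"
| add: "trig_poly p \<Longrightarrow> trig_poly q \<Longrightarrow> trig_poly (\<lambda>x. p x + q x)"

lemma trig_poly_const: "trig_poly (\<lambda>x. c)"
  using trig_poly.monomial[OF int_lattice_closed(1), of c] by simp

lemma trig_poly_sum: "(\<And>i. i \<in> F \<Longrightarrow> trig_poly (p i)) \<Longrightarrow> trig_poly (\<lambda>x. \<Sum>i\<in>F. p i x)"
  by (induction F rule: infinite_finite_induct) (auto intro: trig_poly.add trig_poly_const)

lemma trig_poly_mult: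
  assumes "trig_poly p" "trig_poly q" shows "trig_poly (\<lambda>x. p x * q x)"
  using assms(1)
proof induction
  case (monomial k c)
  show ?case using assms(2)
  proof induction
    case (monomial l d)
    have "(\<lambda>x. c * character k x * (d * character l x)) = (\<lambda>x. (c * d) * character (k + l) x)"
      by (simp add: character_add_left mult_ac)
    then show ?case using trig_poly.monomial[OF int_lattice_closed(2)[OF \<open>k \<in> int_lattice\<close> \<open>l \<in> int_lattice\<close>]] by simp
  qed (simp add: distrib_left trig_poly.add)
qed (simp add: distrib_right trig_poly.add)

lemma trig_poly_scale: "trig_poly p \<Longrightarrow> trig_poly (\<lambda>x. c * p x)"
  by (rule trig_poly_mult[OF trig_poly_const])

text \<open>The inductive definition makes closure under products a double induction; Parseval's
  identity needs the explicit finite set of frequencies recovered here.\<close>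

lemma trig_poly_form:
  assumes "trig_poly p"
  shows "\<exists>F c. finite F \<and> F \<subseteq> int_lattice \<and> p = (\<lambda>x. \<Sum>k\<in>F. c k * character k x)"
  using assms
proof induction
  case (monomial k c)
  then show ?case by (intro exI[of _ "{k}"] exI[of _ "\<lambda>_. c"]) simp
next
  case (add p q)
  then obtain F c G d where F: "finite F" "F \<subseteq> int_lattice" "p = (\<lambda>x. \<Sum>k\<in>F. c k * character k x)"
    and G: "finite G" "G \<subseteq> int_lattice" "q = (\<lambda>x. \<Sum>k\<in>G. d k * character k x)" by blast
  let ?e = "\<lambda>k. (if k \<in> F then c k else 0) + (if k \<in> G then d k else 0)"
  have "p x + q x = (\<Sum>k\<in>F\<union>G. ?e k * character k x)" for x
  proof -
    have "(\<Sum>k\<in>F\<union>G. (if k \<in> F then c k else 0) * character k x) = p x"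
      unfolding F(3) using F(1) G(1) by (intro sum.mono_neutral_cong_right) auto
    moreover have "(\<Sum>k\<in>F\<union>G. (if k \<in> G then d k else 0) * character k x) = q x"
      unfolding G(3) using F(1) G(1) by (intro sum.mono_neutral_cong_right) auto
    ultimately show ?thesis by (simp only: distrib_right sum.distrib)
  qed
  then show ?case using F G by (intro exI[of _ "F \<union> G"] exI[of _ ?e]) auto
qed

text \<open>The torus is realized as a compact subset of complex space, so that polynomials in the
  real and imaginary parts of the coordinates become trigonometric polynomials.\<close>

definition torus_map :: "real ^ 'n \<Rightarrow> complex ^ 'n" where
  "torus_map x = (\<chi> j. cis (2 * pi * x $ j))"

text \<open>By Euler's formulas the real and imaginary parts of each coordinate of the torus are
  trigonometric polynomials with frequencies plus and minus a unit vector; sums and products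
  preserve the class.\<close>

lemma trig_poly_torus_polynomial:
  fixes q :: "complex ^ 'n \<Rightarrow> real"
  assumes "real_polynomial_function q"
  shows "trig_poly (\<lambda>x. of_real (q (torus_map x)))"
  using assms
proof induction
  case (linear f)
  have ch: "cis (2 * pi * x $ j) = character (axis j 1) x" for x :: "real^'n" and j
    by (simp add: character_def inner_axis')
  have co: "trig_poly (\<lambda>x::real^'n. of_real (Re (cis (2 * pi * x $ j))))" for j
  proof -
    have "(\<lambda>x::real^'n. complex_of_real (Re (cis (2 * pi * x $ j)))) = (\<lambda>x. 1/2 * character (axis j 1) x + 1/2 * character (- axis j 1) x)"
      by (auto simp: fun_eq_iff complex_eq_iff character_minus simp flip: ch)
    then show ?thesis by (simp only:) (intro trig_poly.intros int_lattice_closed)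
  qed
  have si: "trig_poly (\<lambda>x::real^'n. of_real (Im (cis (2 * pi * x $ j))))" for j
  proof -
    have "(\<lambda>x::real^'n. complex_of_real (Im (cis (2 * pi * x $ j)))) = (\<lambda>x. (-\<i>/2) * character (axis j 1) x + (\<i>/2) * character (- axis j 1) x)"
      by (auto simp: fun_eq_iff complex_eq_iff character_minus simp flip: ch)
    then show ?thesis by (simp only:) (intro trig_poly.intros int_lattice_closed)
  qed
  interpret f: bounded_linear f by fact
  \<comment> \<open>Expansion in a real basis of complex space: \<open>f\<close> is only
    real-linear, so real and imaginary parts need separate basis vectors.\<close>
  have dec: "z = (\<Sum>j\<in>UNIV. Re (z $ j) *\<^sub>R axis j 1 + Im (z $ j) *\<^sub>R axis j \<i>)" for z :: "complex^'n"
    by (simp add: vec_eq_iff axis_def sum.distrib if_distrib[of "\<lambda>u. _ *\<^sub>R u"] complex_eq_iff cong: if_cong)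
  have "f z = (\<Sum>j\<in>UNIV. Re (z $ j) * f (axis j 1) + Im (z $ j) * f (axis j \<i>))" for z
    by (subst dec[of z], simp only: f.sum f.add f.scaleR real_scaleR_def)
  from this[of "torus_map x" for x]
  have "(\<lambda>x. complex_of_real (f (torus_map x))) = (\<lambda>x. \<Sum>j\<in>UNIV.
      of_real (f (axis j 1)) * of_real (Re (cis (2 * pi * x $ j))) + of_real (f (axis j \<i>)) * of_real (Im (cis (2 * pi * x $ j))))"
    by (simp only: torus_map_def vec_lambda_beta of_real_sum of_real_add of_real_mult mult.commute)
  then show ?case
    by (simp only:) (intro trig_poly_sum trig_poly.add trig_poly_scale co si)
qed (simp_all add: trig_poly_const trig_poly.add trig_poly_mult)

text \<open>Coordinates with equal image differ by an integer, which in the unit interval can only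
  be 0 or plus or minus 1; a nonzero difference puts \<open>x\<close> on the boundary. So
  identifications on the closed cube only involve boundary points.\<close>

lemma torus_map_eq:
  assumes "torus_map x = torus_map y" "x \<in> cbox 0 1" "y \<in> cbox 0 1" "x \<noteq> y"
  shows "x \<notin> box 0 1"
proof -
  obtain j where j: "x $ j \<noteq> y $ j" using assms(4) by (auto simp: vec_eq_iff)
  have "cis (2 * pi * x $ j) = cis (2 * pi * y $ j)"
    using assms(1) by (simp add: torus_map_def vec_eq_iff)
  then have "sin (2 * pi * x $ j) = sin (2 * pi * y $ j) \<and> cos (2 * pi * x $ j) = cos (2 * pi * y $ j)"
    by (simp add: complex_eq_iff)
  then obtain n :: int where "2 * pi * x $ j = 2 * pi * y $ j + 2 * pi * of_int n"
    by (auto simp: sin_cos_eq_iff)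
  then have "2 * pi * x $ j = 2 * pi * (y $ j + of_int n)" by (simp add: distrib_left)
  then have n: "x $ j = y $ j + of_int n" by simp
  have "0 \<le> x $ j" "x $ j \<le> 1" "0 \<le> y $ j" "y $ j \<le> 1"
    using assms(2,3) by (auto simp: mem_box_cart)
  then have "\<bar>real_of_int n\<bar> \<le> 1" "n \<noteq> 0" using n j by auto
  then have "\<bar>n\<bar> \<le> 1" by linarith
  then have "n = 1 \<or> n = -1" using \<open>n \<noteq> 0\<close> by linarith
  then have "x $ j = 0 \<or> x $ j = 1" using n \<open>x $ j \<le> 1\<close> \<open>0 \<le> y $ j\<close> \<open>0 \<le> x $ j\<close> \<open>y $ j \<le> 1\<close> by auto
  then show ?thesis by (auto simp: mem_box_cart intro!: exI[of _ j])
qed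

lemma continuous_on_torus_map: "continuous_on S torus_map"
  unfolding torus_map_def by (intro continuous_intros)

text \<open>A continuous function vanishing on the boundary of the cube descends to the torus, where
  the Stone--Weierstrass theorem applies.\<close>

lemma trig_poly_uniformly_dense:
  fixes g :: "real ^ 'n \<Rightarrow> complex"
  assumes g: "continuous_on UNIV g" and g0: "\<And>x. x \<notin> box 0 1 \<Longrightarrow> g x = 0" and "\<epsilon> > 0"
  shows "\<exists>p. trig_poly p \<and> (\<forall>x\<in>cbox 0 1. cmod (g x - p x) < \<epsilon>)"
proof -
  let ?Q = "cbox 0 1 :: (real^'n) set" let ?T = "torus_map ` ?Q"
  \<comment> \<open>The preimage chosen by \<open>inv_into\<close> is irrelevant: two different
    preimages lie on the boundary, where \<open>g\<close> is 0.\<close>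
  define G where "G z = g (inv_into ?Q torus_map z)" for z
  have GE: "G (torus_map x) = g x" if "x \<in> ?Q" for x
  proof -
    define y where "y = inv_into ?Q torus_map (torus_map x)"
    have y: "y \<in> ?Q" "torus_map y = torus_map x"
      unfolding y_def using that by (auto intro: inv_into_into f_inv_into_f)
    have "g y = g x"
    proof (cases "x = y")
      case False
      then show ?thesis
        using torus_map_eq[OF y(2) y(1) that] torus_map_eq[OF y(2)[symmetric] that y(1)] g0 by simp
    qed simp
    then show ?thesis by (simp add: G_def y_def)
  qed
  have T: "compact ?T" by (intro compact_continuous_image continuous_on_torus_map compact_cbox)
  have "continuous_on ?T G"
  proof (subst continuous_on_closed_vimage[OF compact_imp_closed[OF T]], intro allI impI)
    fix C :: "complex set" assume "closed C"
    \<comment> \<open>The chosen inverse need not be continuous. Continuity is read off from closed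
      sets instead: their preimages under \<open>G\<close> are images of compact sets under
      \<open>torus_map\<close>.\<close>
    have "G -` C \<inter> ?T = torus_map ` (?Q \<inter> g -` C)" using GE by auto
    moreover have "compact (?Q \<inter> g -` C)"
      using \<open>closed C\<close> g by (intro compact_Int_closed compact_cbox) (simp add: closed_vimage)
    ultimately show "closed (G -` C \<inter> ?T)"
      by (simp add: compact_imp_closed compact_continuous_image continuous_on_torus_map)
  qed
  from Stone_Weierstrass_polynomial_function[OF T this assms(3)]
  obtain q where q: "polynomial_function q" "\<And>z. z \<in> ?T \<Longrightarrow> cmod (G z - q z) < \<epsilon>" by blast
  have re: "real_polynomial_function (Re \<circ> q)" "real_polynomial_function (Im \<circ> q)"
    using q(1) bounded_linear_Re bounded_linear_Im by (auto simp: polynomial_function_def)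
  let ?p = "\<lambda>x. of_real ((Re \<circ> q) (torus_map x)) + \<i> * of_real ((Im \<circ> q) (torus_map x))"
  have "trig_poly ?p"
    by (intro trig_poly.add trig_poly_scale trig_poly_torus_polynomial re)
  moreover have "cmod (g x - ?p x) < \<epsilon>" if "x \<in> ?Q" for x
  proof -
    have "?p x = q (torus_map x)" by (simp add: complex_eq_iff)
    then show ?thesis using q(2)[of "torus_map x"] GE[OF that] that by auto
  qed
  ultimately show ?thesis by blast
qed

lemma unit_cube_indicator_L2:
  "(\<lambda>x::real^'n. indicator (cbox 0 1) x :: complex) \<in> L2" "L2_norm (\<lambda>x::real^'n. indicator (cbox 0 1) x) = 1"
proof -
  have i: "(\<lambda>x::real^'n. (cmod (indicator (cbox 0 1) x))\<^sup>2) = indicator (cbox 0 1)"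
    by (auto simp: fun_eq_iff indicator_def)
  have "integrable lebesgue (indicator (cbox 0 1 :: (real^'n) set) :: _ \<Rightarrow> real)"
    using lmeasurable_cbox lmeasurable_iff_integrable by blast
  then show "(\<lambda>x::real^'n. indicator (cbox 0 1) x :: complex) \<in> L2"
    unfolding L2_def mem_Collect_eq i by (auto intro!: borel_measurable_indicator)
  show "L2_norm (\<lambda>x::real^'n. indicator (cbox 0 1) x) = 1"
    unfolding L2_norm_def i using content_unit_cube[where 'n='n] by simp
qed

lemma trig_poly_L2: "trig_poly p \<Longrightarrow> (\<lambda>x. indicator (cbox 0 1) x * p x) \<in> L2"
proof (induction rule: trig_poly.induct)
  case (monomial k c)
  have "(\<lambda>x. c * (character k x * indicator (cbox 0 1) x)) \<in> L2"
    by (intro L2_scale L2_character unit_cube_indicator_L2)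
  then show ?case by (simp add: mult_ac)
next
  case (add p q) then show ?case using L2_add by (fastforce simp: distrib_left)
qed

text \<open>Three approximations at a cost of a third of \<open_epsilon> each would be the usual
  picture: \<open>h\<close> by a truncation, the truncation by a continuous function vanishing off
  the open cube, and that one uniformly by a trigonometric polynomial. The last step is an L2
  estimate because the cube has measure 1.\<close>

lemma trig_poly_dense:
  fixes h :: "real ^ 'n \<Rightarrow> complex"
  assumes h: "h \<in> L2" and h0: "\<And>x. x \<notin> cbox 0 1 \<Longrightarrow> h x = 0" and "\<epsilon> > 0"
  shows "\<exists>p. trig_poly p \<and> L2_norm (\<lambda>x. h x - indicator (cbox 0 1) x * p x) < \<epsilon>"
proof -
  let ?Q = "cbox 0 1 :: (real^'n) set"
  obtain R where R: "L2_norm (\<lambda>x. truncate R h x - h x) < \<epsilon> / 3"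
    using order_tendstoD(2)[OF L2_tendstoD(3)[OF truncate_L2_tendsto[OF h]], of "\<epsilon>/3"] \<open>\<epsilon> > 0\<close>
    by (auto simp: eventually_sequentially)
  let ?h = "truncate R h"
  have hm: "?h \<in> borel_measurable lebesgue" using h by measurable
  obtain N G where N: "negligible N" and G: "\<And>n. continuous_on UNIV (G n)"
      "\<And>x. x \<notin> N \<Longrightarrow> (\<lambda>n. G n x) \<longlonglongrightarrow> ?h x"
    using lebesgue_measurable_imp_measurable_on[OF hm, of UNIV] unfolding measurable_on_def by auto
  \<comment> \<open>The cutoff \<open>c n\<close> vanishes off the open cube and is eventually 1 at
    each interior point. The nearest-point map \<open>r\<close> onto the disc of radius
    \<open>R\<close> keeps the approximants bounded, which provides the dominating function.\<close>
  define c where "c n x = min 1 (real n * infdist x (- box 0 1))" for n and x :: "real^'n"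
  define r where "r = closest_point (cball 0 (real R) :: complex set)"
  define F where "F n x = of_real (c n x) * r (G n x)" for n x
  have cr: "continuous_on S r" for S
    unfolding r_def by (rule continuous_on_closest_point) auto
  have rr: "cmod (r z) \<le> real R" for z
    using closest_point_in_set[of "cball 0 (real R) :: complex set" z] by (simp add: r_def)
  have rid: "r z = z" if "cmod z \<le> real R" for z
    unfolding r_def by (rule closest_point_self) (use that in simp)
  have contF: "continuous_on UNIV (F n)" for n
    unfolding F_def c_def
    by (intro continuous_intros continuous_on_compose2[OF cr[of UNIV] G(1)]) auto
  have c01: "0 \<le> c n x" "c n x \<le> 1" for n x by (auto simp: c_def infdist_nonneg)
  have F0: "F n x = 0" if "x \<notin> box 0 1" for n x
    using that by (simp add: F_def c_def)
  have Fb: "cmod (F n x) \<le> cmod (indicator ?Q x * of_real (real R))" for n x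
  proof (cases "x \<in> box 0 1")
    case True
    then have "x \<in> ?Q" using box_subset_cbox by blast
    then show ?thesis using mult_mono[OF c01(2)[of n x] rr[of "G n x"]] c01(1)[of n x]
      by (simp add: F_def norm_mult)
  qed (simp add: F0)
  have "L2_tendsto F ?h"
  proof (rule L2_dominated_convergence)
    show "(\<lambda>x. indicator ?Q x * of_real (real R)) \<in> L2"
      using L2_scale[OF unit_cube_indicator_L2(1), of "of_real (real R)"] by (simp add: mult.commute)
    show "F n \<in> borel_measurable lebesgue" for n by (rule continuous_measurable_lebesgue[OF contF])
    \<comment> \<open>On the boundary of the cube the approximants are 0 while the truncation of
      \<open>h\<close> may not be.\<close>
    have "negligible (N \<union> (?Q - box 0 1))"
      by (intro negligible_Un N negligible_frontier_interval)
    then have "AE x in lebesgue. x \<notin> N \<union> (?Q - box 0 1)"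
      by (intro AE_not_in) (simp add: negligible_iff_null_sets)
    then show "AE x in lebesgue. (\<lambda>n. F n x) \<longlonglongrightarrow> ?h x"
    proof eventually_elim
      case (elim x)
      show ?case
      proof (cases "x \<in> box 0 1")
        case False
        then have "x \<notin> ?Q" using elim by blast
        then show ?thesis using F0[OF False] h0 by (simp add: truncate_def)
      next
        case True
        have "(\<lambda>n. r (G n x)) \<longlonglongrightarrow> r (?h x)"
          using elim by (intro isCont_tendsto_compose[of _ r] G(2)) (use cr[of UNIV] in \<open>auto simp: continuous_on_eq_continuous_at\<close>)
        also have "r (?h x) = ?h x" by (rule rid) (rule truncate_bounds)
        finally have 1: "(\<lambda>n. r (G n x)) \<longlonglongrightarrow> ?h x" .
        have "infdist x (- box 0 1) > 0"
        proof (rule infdist_pos_not_in_closed)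
          show "closed (- box (0::real^'n) 1)" by (simp add: closed_Compl open_box)
          show "x \<notin> - box 0 1" using True by simp
          have "(0::real^'n) \<in> - box 0 1" by (simp add: mem_box_cart)
          then show "- box (0::real^'n) 1 \<noteq> {}" by blast
        qed
        then obtain M where M: "1 < real M * infdist x (- box 0 1)" using ex_less_of_nat_mult by blast
        have "\<forall>\<^sub>F n in sequentially. c n x = 1"
          using eventually_ge_at_top[of M]
        proof eventually_elim
          case (elim n)
          have "real M * infdist x (- box 0 1) \<le> real n * infdist x (- box 0 1)"
            using elim by (intro mult_right_mono) (auto simp: infdist_nonneg)
          with M show ?case by (simp add: c_def)
        qed
        then have "\<forall>\<^sub>F n in sequentially. r (G n x) = F n x"
          by eventually_elim (simp add: F_def)
        with 1 show ?thesis by (rule Lim_transform_eventually)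
      qed
    qed
  qed (use Fb hm in auto)
  note Fh = L2_tendstoD[OF this]
  obtain n where n: "L2_norm (\<lambda>x. F n x - ?h x) < \<epsilon> / 3"
    using order_tendstoD(2)[OF Fh(3), of "\<epsilon>/3"] \<open>\<epsilon> > 0\<close> by (auto simp: eventually_sequentially)
  obtain p where p: "trig_poly p" "\<And>x. x \<in> ?Q \<Longrightarrow> cmod (F n x - p x) < \<epsilon> / 3"
    using trig_poly_uniformly_dense[OF contF[of n] F0[of _ n], of "\<epsilon>/3"] \<open>\<epsilon> > 0\<close> by auto
  let ?p = "\<lambda>x. indicator ?Q x * p x"
  note pL = trig_poly_L2[OF p(1)]
  have "L2_norm (\<lambda>x. F n x - ?p x) \<le> L2_norm (\<lambda>x. of_real (\<epsilon>/3) * (indicator ?Q x :: complex))"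
  proof (rule L2_norm_mono_AE[OF L2_scale[OF unit_cube_indicator_L2(1)] L2_measurable[OF L2_diff[OF Fh(1) pL]]], rule AE_I2)
    fix x
    have "F n x = 0" if "x \<notin> ?Q" using that F0[of x n] box_subset_cbox[of 0 1] by blast
    then show "cmod (F n x - ?p x) \<le> cmod (of_real (\<epsilon>/3) * (indicator ?Q x :: complex))"
      using p(2)[of x] \<open>\<epsilon> > 0\<close> by (cases "x \<in> ?Q") (auto simp: norm_mult)
  qed
  also have "\<dots> = \<epsilon> / 3" using \<open>\<epsilon> > 0\<close> unfolding L2_norm_scale unit_cube_indicator_L2(2) by simp
  finally have 3: "L2_norm (\<lambda>x. F n x - ?p x) \<le> \<epsilon> / 3" .
  have "L2_norm (\<lambda>x. h x - ?p x) \<le> L2_norm (\<lambda>x. h x - ?h x) + L2_norm (\<lambda>x. ?h x - ?p x)"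
    by (rule L2_norm_triangle_diff[OF h Fh(2) pL])
  also have "L2_norm (\<lambda>x. ?h x - ?p x) \<le> L2_norm (\<lambda>x. ?h x - F n x) + L2_norm (\<lambda>x. F n x - ?p x)"
    by (rule L2_norm_triangle_diff[OF Fh(2) Fh(1) pL])
  finally have "L2_norm (\<lambda>x. h x - ?p x) < \<epsilon>"
    using R n 3 L2_norm_minus_commute[of h ?h] L2_norm_minus_commute[of ?h "F n"] by linarith
  with p(1) show ?thesis by blast
qed

lemma cube_character_L2: "(\<lambda>x. indicator (cbox 0 1) x * character k x) \<in> L2"
  using L2_character[OF unit_cube_indicator_L2(1), of k] by (simp add: mult.commute)

lemma cube_character_orthonormal:
  assumes "k \<in> int_lattice" "l \<in> int_lattice"
  shows "L2_inner (\<lambda>x. indicator (cbox 0 1) x * character k x) (\<lambda>x. indicator (cbox 0 1) x * character l x)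
    = (if k = l then 1 else 0)"
proof -
  have "indicator (cbox 0 1) x * character k x * cnj (indicator (cbox 0 1) x * character l x)
     = indicator (cbox 0 1) x * character (k + - l) x" for x
    unfolding character_add_left character_minus(1) by (simp add: indicator_def)
  then show ?thesis
    unfolding L2_inner_def using unit_cube_character_integral[OF int_lattice_closed(4)[OF assms]]
    by (simp only: add_uminus_conv_diff right_minus_eq)
qed

text \<open>Completing the square in the coefficients \<open>a\<close>. Choosing them optimal gives
  Bessel's inequality; choosing those of a given approximant bounds the defect in Bessel's
  inequality by its error.\<close>

lemma orthonormal_best_approximation:
  fixes h :: "real ^ 'n \<Rightarrow> complex"
  assumes h: "h \<in> L2" and F: "finite F" and e: "\<And>k. k \<in> F \<Longrightarrow> e k \<in> L2"
    and on: "\<And>k l. k \<in> F \<Longrightarrow> l \<in> F \<Longrightarrow> L2_inner (e k) (e l) = (if k = l then 1 else 0)"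
  shows "(L2_norm (\<lambda>x. h x - (\<Sum>k\<in>F. a k * e k x)))\<^sup>2
    = (L2_norm h)\<^sup>2 - (\<Sum>k\<in>F. (cmod (L2_inner h (e k)))\<^sup>2) + (\<Sum>k\<in>F. (cmod (a k - L2_inner h (e k)))\<^sup>2)"
proof -
  let ?s = "\<lambda>x. \<Sum>k\<in>F. a k * e k x" let ?c = "\<lambda>k. L2_inner h (e k)"
  have aL: "\<And>k. k \<in> F \<Longrightarrow> (\<lambda>x. a k * e k x) \<in> L2" by (intro L2_scale e)
  have sL: "?s \<in> L2" by (intro L2_sum aL)
  have 1: "L2_inner h ?s = (\<Sum>k\<in>F. cnj (a k) * ?c k)"
    by (subst L2_inner_sum_right[OF aL h]) (simp_all add: L2_inner_scale_right)
  have "L2_inner (e l) ?s = cnj (a l)" if "l \<in> F" for l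
  proof -
    have "L2_inner (e l) ?s = (\<Sum>k\<in>F. cnj (a k) * L2_inner (e l) (e k))"
      by (subst L2_inner_sum_right[OF aL e[OF that]]) (simp_all add: L2_inner_scale_right)
    also have "\<dots> = (\<Sum>k\<in>F. if k = l then cnj (a k) else 0)"
      using that by (intro sum.cong) (auto simp: on)
    finally show ?thesis using F that by simp
  qed
  then have "L2_inner ?s ?s = (\<Sum>k\<in>F. a k * cnj (a k))"
    by (subst L2_inner_sum_left[OF aL sL]) (simp_all add: L2_inner_scale_left)
  then have "of_real ((L2_norm ?s)\<^sup>2) = (of_real (\<Sum>k\<in>F. (cmod (a k))\<^sup>2) :: complex)"
    by (simp only: L2_inner_self of_real_sum complex_norm_square)
  then have 2: "(L2_norm ?s)\<^sup>2 = (\<Sum>k\<in>F. (cmod (a k))\<^sup>2)" using of_real_eq_iff by blast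
  have 3: "(cmod (a k - ?c k))\<^sup>2 = (cmod (a k))\<^sup>2 - 2 * Re (cnj (a k) * ?c k) + (cmod (?c k))\<^sup>2" for k
    unfolding cmod_power2 by (simp add: power2_eq_square algebra_simps)
  show ?thesis
    unfolding L2_norm_sq_diff[OF h sL] 1 2 3
    by (simp add: sum.distrib sum_subtractf sum_distrib_left)
qed

text \<open>If a trigonometric polynomial with frequencies \<open>F0\<close> approximates
  \<open>h\<close>, then for every finite set of frequencies containing \<open>F0\<close> the Bessel
  defect is at most the squared error, and this is convergence of the unordered sum.\<close>

theorem unit_cube_Parseval:
  fixes h :: "real ^ 'n \<Rightarrow> complex"
  assumes h: "h \<in> L2" and h0: "\<And>x. x \<notin> cbox 0 1 \<Longrightarrow> h x = 0"
  shows "((\<lambda>k. (cmod (LINT x|lebesgue. h x * cnj (character k x)))\<^sup>2) has_sum (L2_norm h)\<^sup>2) int_lattice"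
proof -
  let ?e = "\<lambda>k x. indicator (cbox 0 (1::real^'n)) x * character k x"
  have c: "(LINT x|lebesgue. h x * cnj (character k x)) = L2_inner h (?e k)" for k
    unfolding L2_inner_def by (intro Bochner_Integration.integral_cong) (use h0 in \<open>auto simp: indicator_def\<close>)
  let ?c = "\<lambda>k. (cmod (L2_inner h (?e k)))\<^sup>2"
  have ap: "(L2_norm (\<lambda>x. h x - (\<Sum>k\<in>F. a k * ?e k x)))\<^sup>2
    = (L2_norm h)\<^sup>2 - sum ?c F + (\<Sum>k\<in>F. (cmod (a k - L2_inner h (?e k)))\<^sup>2)" if "finite F" "F \<subseteq> int_lattice" for F a
    using that by (intro orthonormal_best_approximation h cube_character_L2 cube_character_orthonormal) auto
  have "(?c has_sum (L2_norm h)\<^sup>2) int_lattice"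
    unfolding has_sum_def tendsto_iff eventually_finite_subsets_at_top
  proof (intro allI impI)
    fix \<epsilon> :: real assume "\<epsilon> > 0"
    then obtain p where p: "trig_poly p" "L2_norm (\<lambda>x. h x - indicator (cbox 0 1) x * p x) < sqrt \<epsilon>"
      using trig_poly_dense[OF h h0, of "sqrt \<epsilon>"] by auto
    obtain F0 a where F0: "finite F0" "F0 \<subseteq> int_lattice" "p = (\<lambda>x. \<Sum>k\<in>F0. a k * character k x)"
      using trig_poly_form[OF p(1)] by blast
    have "dist (sum ?c F) ((L2_norm h)\<^sup>2) < \<epsilon>" if F: "finite F" "F0 \<subseteq> F" "F \<subseteq> int_lattice" for F
    proof -
      let ?a = "\<lambda>k. if k \<in> F0 then a k else 0"
      have "indicator (cbox 0 1) x * p x = (\<Sum>k\<in>F. ?a k * ?e k x)" for x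
        unfolding F0(3) sum_distrib_left using F by (intro sum.mono_neutral_cong_left) auto
      then have "(L2_norm h)\<^sup>2 - sum ?c F \<le> (L2_norm (\<lambda>x. h x - indicator (cbox 0 1) x * p x))\<^sup>2"
        using ap[OF F(1,3), of ?a] by (simp add: sum_nonneg)
      also have "\<dots> < (sqrt \<epsilon>)\<^sup>2" using p(2) by (intro power_strict_mono) auto
      also have "\<dots> = \<epsilon>" using \<open>\<epsilon> > 0\<close> by simp
      finally have "(L2_norm h)\<^sup>2 - sum ?c F < \<epsilon>" .
      moreover have "0 \<le> (L2_norm h)\<^sup>2 - sum ?c F"
        using ap[OF F(1,3), of "\<lambda>k. L2_inner h (?e k)"]
          zero_le_power2[of "L2_norm (\<lambda>x. h x - (\<Sum>k\<in>F. L2_inner h (?e k) * ?e k x))"] by simp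
      ultimately show ?thesis by (simp add: dist_real_def)
    qed
    then show "\<exists>X. finite X \<and> X \<subseteq> int_lattice \<and> (\<forall>Y. finite Y \<and> X \<subseteq> Y \<and> Y \<subseteq> int_lattice \<longrightarrow> dist (sum ?c Y) ((L2_norm h)\<^sup>2) < \<epsilon>)"
      using F0(1,2) by blast
  qed
  then show ?thesis by (simp only: c)
qed

lemma L2_translate:
  assumes "f \<in> L2" shows "(\<lambda>x. f (x + a)) \<in> L2" "L2_norm (\<lambda>x. f (x + a)) = L2_norm f"
proof -
  have [measurable]: "f \<in> borel_measurable lebesgue" using assms by (rule L2_measurable)
  have m: "(\<lambda>x. (cmod (f x))\<^sup>2) \<in> borel_measurable lebesgue" by measurable
  have "(\<lambda>x. f (x + a)) \<in> borel_measurable lebesgue"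
    using measurable_compose[OF translation_measurable_lebesgue, of f borel a] by simp
  then show "(\<lambda>x. f (x + a)) \<in> L2"
    using integral_translation(2)[OF m, of a] assms by (simp add: L2_def)
  show "L2_norm (\<lambda>x. f (x + a)) = L2_norm f"
    using integral_translation(1)[OF m, of a] by (simp add: L2_norm_def)
qed

text \<open>Moving the cube by \<open>a\<close> multiplies the coefficient at \<open>k\<close> by
  the unimodular number \<open>character k a\<close>.\<close>

theorem cube_Parseval:
  fixes h :: "real ^ 'n \<Rightarrow> complex"
  assumes h: "h \<in> L2" and h0: "\<And>x. x \<notin> cbox a (a + 1) \<Longrightarrow> h x = 0"
  shows "((\<lambda>k. (cmod (LINT x|lebesgue. h x * cnj (character k x)))\<^sup>2) has_sum (L2_norm h)\<^sup>2) int_lattice"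
proof -
  have "h (x + a) = 0" if "x \<notin> cbox 0 1" for x
    using that by (intro h0) (auto simp: mem_box_cart)
  from unit_cube_Parseval[OF L2_translate(1)[OF h] this]
  have "((\<lambda>k. (cmod (LINT x|lebesgue. h (x + a) * cnj (character k x)))\<^sup>2) has_sum (L2_norm h)\<^sup>2) int_lattice"
    unfolding L2_translate(2)[OF h] .
  moreover have "cmod (LINT x|lebesgue. h (x + a) * cnj (character k x)) = cmod (LINT x|lebesgue. h x * cnj (character k x))" for k
  proof -
    have m: "(\<lambda>x. h x * cnj (character k (x - a))) \<in> borel_measurable lebesgue"
      by (intro borel_measurable_times L2_measurable[OF h] continuous_measurable_lebesgue continuous_intros)
    have "(LINT x|lebesgue. h (x + a) * cnj (character k x)) = (LINT x|lebesgue. h x * cnj (character k (x - a)))"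
      using integral_translation(1)[OF m, of a] by simp
    also have "\<dots> = (LINT x|lebesgue. character k a * (h x * cnj (character k x)))"
      using character_add_right[of k _ "- a"] by (simp add: character_minus mult_ac)
    also have "\<dots> = character k a * (LINT x|lebesgue. h x * cnj (character k x))" by simp
    finally show ?thesis by (simp add: norm_mult)
  qed
  ultimately show ?thesis by simp
qed

section \<open>The Plancherel theorem\<close>

lemma sigma_finite_lebesgue: "sigma_finite_measure (lebesgue :: (real^'n) measure)"
proof
  show "\<exists>A. countable A \<and> A \<subseteq> sets lebesgue \<and> \<Union> A = space (lebesgue :: (real^'n) measure) \<and> (\<forall>a\<in>A. emeasure lebesgue a \<noteq> \<infinity>)"
  proof (intro exI[of _ "range (\<lambda>n. cball 0 (real n))"] conjI ballI)
    show "\<Union> (range (\<lambda>n. cball 0 (real n))) = space (lebesgue :: (real^'n) measure)"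
      using real_arch_simple by auto
    fix a :: "(real^'n) set" assume "a \<in> range (\<lambda>n. cball 0 (real n))"
    then show "emeasure lebesgue a \<noteq> \<infinity>"
      using lmeasurable_cball by (auto simp: fmeasurable_def less_top)
  qed auto
qed

lemma pair_sigma_finite_lebesgue:
  "pair_sigma_finite (lebesgue :: (real^'n) measure) (lebesgue :: (real^'m) measure)"
  unfolding pair_sigma_finite_def by (simp add: sigma_finite_lebesgue)

lemma character_pair_measurable [measurable]:
  "(\<lambda>(x, y). character x y) \<in> borel_measurable ((lebesgue :: (real^'n) measure) \<Otimes>\<^sub>M lebesgue)"
proof -
  have "id \<in> lebesgue \<rightarrow>\<^sub>M (borel :: (real^'n) measure)" by simp
  then have [measurable]: "(\<lambda>p. fst p) \<in> ((lebesgue :: (real^'n) measure) \<Otimes>\<^sub>M (lebesgue :: (real^'n) measure)) \<rightarrow>\<^sub>M borel"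
    "(\<lambda>p. snd p) \<in> ((lebesgue :: (real^'n) measure) \<Otimes>\<^sub>M (lebesgue :: (real^'n) measure)) \<rightarrow>\<^sub>M borel"
    using measurable_compose[OF measurable_fst \<open>id \<in> lebesgue \<rightarrow>\<^sub>M borel\<close>]
      measurable_compose[OF measurable_snd \<open>id \<in> lebesgue \<rightarrow>\<^sub>M borel\<close>] by simp_all
  have [measurable]: "cis \<in> borel_measurable borel"
    by (intro borel_measurable_continuous_onI continuous_intros)
  show ?thesis unfolding character_def split_beta by measurable
qed

lemma fourier_L1_eq: "fourier_L1 f \<xi> = (LINT x|lebesgue. f x * cnj (character \<xi> x))"
proof -
  have "exp (- 2 * of_real pi * \<i> * of_real (x \<bullet> \<xi>)) = cnj (character \<xi> x)" for x
    by (simp add: character_def cis_conv_exp exp_cnj inner_commute mult_ac)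
  then show ?thesis by (simp only: fourier_L1_def)
qed

lemma cnj_measurable [measurable (raw)]:
  "f \<in> borel_measurable M \<Longrightarrow> (\<lambda>x. cnj (f x)) \<in> borel_measurable M"
  by (rule borel_measurable_continuous_on[of cnj, rotated]) (auto intro: continuous_intros)

lemma fourier_L1_measurable [measurable]:
  assumes [measurable]: "f \<in> borel_measurable lebesgue" shows "fourier_L1 f \<in> borel_measurable lebesgue"
proof -
  interpret sigma_finite_measure "lebesgue :: (real^'n) measure" by (rule sigma_finite_lebesgue)
  have "(\<lambda>\<xi>. LINT x|lebesgue. f x * cnj (character \<xi> x)) \<in> borel_measurable lebesgue"
    by (rule borel_measurable_lebesgue_integral) measurable
  then show ?thesis by (simp add: fourier_L1_eq[abs_def])
qed

lemma L1_character_integrable: "f \<in> L1 \<Longrightarrow> integrable lebesgue (\<lambda>x. f x * cnj (character \<xi> x))"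
  unfolding L1_def mem_Collect_eq
  by (rule Bochner_Integration.integrable_bound[of _ f]) (auto simp: norm_mult)

lemma fourier_L1_diff: "f \<in> L1 \<Longrightarrow> g \<in> L1 \<Longrightarrow> fourier_L1 (\<lambda>x. f x - g x) \<xi> = fourier_L1 f \<xi> - fourier_L1 g \<xi>"
  by (simp add: fourier_L1_eq left_diff_distrib L1_character_integrable)

text \<open>Fubini for a kernel symmetric in its two variables. The pairing is bilinear, with no
  conjugate on \<open>g\<close>, so the transform simply moves from one factor to the other; this is
  the property by which transforms are later identified.\<close>

lemma fourier_L1_multiplication:
  fixes f g :: "real ^ 'n \<Rightarrow> complex"
  assumes "f \<in> L1" "g \<in> L1"
  shows "(LINT \<xi>|lebesgue. fourier_L1 f \<xi> * g \<xi>) = (LINT x|lebesgue. f x * fourier_L1 g x)"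
proof -
  interpret pair_sigma_finite "lebesgue :: (real^'n) measure" "lebesgue :: (real^'n) measure"
    by (rule pair_sigma_finite_lebesgue)
  have i: "integrable lebesgue f" "integrable lebesgue g" using assms by (simp_all add: L1_def)
  then have [measurable]: "f \<in> borel_measurable lebesgue" "g \<in> borel_measurable lebesgue" by auto
  let ?F = "\<lambda>x \<xi>. f x * (g \<xi> * cnj (character x \<xi>))"
  have "integrable (lebesgue \<Otimes>\<^sub>M lebesgue) (case_prod ?F)"
  proof (rule Fubini_integrable)
    show "case_prod ?F \<in> borel_measurable (lebesgue \<Otimes>\<^sub>M lebesgue)" by measurable
    show "integrable lebesgue (\<lambda>x. LINT y|lebesgue. norm (case_prod ?F (x, y)))"
      using i by (simp add: norm_mult)
    show "AE x in lebesgue. integrable lebesgue (\<lambda>y. case_prod ?F (x, y))"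
      using L1_character_integrable[OF assms(2)] by simp
  qed
  from Fubini_integral[OF this]
  have "(LINT \<xi>|lebesgue. LINT x|lebesgue. ?F x \<xi>) = (LINT x|lebesgue. LINT \<xi>|lebesgue. ?F x \<xi>)" .
  moreover have "(LINT x|lebesgue. ?F x \<xi>) = fourier_L1 f \<xi> * g \<xi>" for \<xi>
  proof -
    have "(LINT x|lebesgue. ?F x \<xi>) = (LINT x|lebesgue. (f x * cnj (character \<xi> x)) * g \<xi>)"
      by (simp add: mult_ac character_commute[of _ \<xi>])
    then show ?thesis by (simp add: fourier_L1_eq)
  qed
  moreover have "(LINT \<xi>|lebesgue. ?F x \<xi>) = f x * fourier_L1 g x" for x
    unfolding fourier_L1_eq by simp
  ultimately show ?thesis by (simp only:)
qed

text \<open>Translates unordered sums into integrals over a counting measure, so that sums and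
  integrals can be interchanged by Tonelli's theorem.\<close>

lemma nn_integral_count_space_has_sum:
  fixes f :: "'a \<Rightarrow> real"
  assumes "(f has_sum s) A" "countable A" "\<And>x. x \<in> A \<Longrightarrow> f x \<ge> 0"
  shows "(\<integral>\<^sup>+x. ennreal (f x) \<partial>count_space A) = ennreal s"
proof (cases "finite A")
  case True
  then have "s = sum f A" using assms(1) has_sum_finite has_sum_unique by blast
  then show ?thesis using True assms(3) by (simp add: nn_integral_count_space_finite sum_ennreal)
next
  case False
  let ?g = "from_nat_into A"
  have g: "bij_betw ?g UNIV A" using bij_betw_from_nat_into[OF assms(2) False] .
  have "((\<lambda>n. f (?g n)) has_sum s) UNIV"
    using assms(1) has_sum_reindex_bij_betw[OF g, of f s] by simp
  then have sums: "(\<lambda>n. f (?g n)) sums s" by (rule has_sum_imp_sums)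
  have nn: "f (?g n) \<ge> 0" for n using assms(3) g by (auto simp: bij_betw_def)
  have "(\<integral>\<^sup>+x. ennreal (f x) \<partial>count_space A) = (\<integral>\<^sup>+n. ennreal (f (?g n)) \<partial>count_space UNIV)"
    using nn_integral_bij_count_space[OF g, of "\<lambda>x. ennreal (f x)"] by simp
  also have "\<dots> = (\<Sum>n. ennreal (f (?g n)))" by (rule nn_integral_count_space_nat)
  also have "\<dots> = ennreal (\<Sum>n. f (?g n))"
    using sums nn by (intro suminf_ennreal2) (auto simp: sums_iff)
  finally show ?thesis using sums by (simp add: sums_iff)
qed

text \<open>An exact fundamental domain for the lattice; translates of the closed cube overlap on
  faces.\<close>

definition half_open_cube :: "(real ^ 'n) set" where
  "half_open_cube = {x. \<forall>j. 0 \<le> x $ j \<and> x $ j < 1}"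

lemma half_open_cube_measure:
  "(half_open_cube :: (real^'n) set) \<in> sets lebesgue" "emeasure lebesgue (half_open_cube :: (real^'n) set) = 1"
proof -
  let ?H = "half_open_cube :: (real^'n) set"
  have sub: "box 0 1 \<subseteq> ?H" "?H \<subseteq> cbox 0 1"
    by (auto simp: half_open_cube_def mem_box_cart less_imp_le)
  have n: "cbox 0 1 - box 0 1 \<in> null_sets (lebesgue :: (real^'n) measure)"
    using negligible_frontier_interval negligible_iff_null_sets by blast
  have d: "cbox 0 1 - ?H \<in> null_sets lebesgue"
    by (rule null_sets_completion_subset[OF _ n]) (use sub in auto)
  have eq: "?H = cbox 0 1 - (cbox 0 1 - ?H)" using sub by auto
  show "?H \<in> sets lebesgue" using d by (subst eq) (auto intro: sets.Diff)
  have "emeasure lebesgue (cbox 0 1 - (cbox 0 1 - ?H)) = emeasure lebesgue (cbox 0 (1::real^'n))"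
    by (rule emeasure_Diff_null_set[OF d]) simp
  then show "emeasure lebesgue ?H = 1"
    using content_unit_cube[where 'n='n] eq
    by (simp add: emeasure_eq_measure2 lmeasurable_cbox)
qed

lemma half_open_cube_tiling:
  fixes x :: "real ^ 'n"
  shows "\<exists>!k. k \<in> int_lattice \<and> x - k \<in> half_open_cube"
proof (rule ex1I)
  let ?k = "(\<chi> j. of_int \<lfloor>x $ j\<rfloor>) :: real ^ 'n"
  show "?k \<in> int_lattice \<and> x - ?k \<in> half_open_cube"
    by (auto simp: int_lattice_def half_open_cube_def) linarith+
  fix k :: "real^'n" assume k: "k \<in> int_lattice \<and> x - k \<in> half_open_cube"
  show "k = ?k"
  proof (rule vec_eq_iff[THEN iffD2], rule allI)
    fix j
    from k obtain m where m: "k $ j = of_int m" by (auto simp: int_lattice_def Ints_def)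
    have "0 \<le> x $ j - of_int m" "x $ j - of_int m < 1"
      using k by (auto simp: half_open_cube_def simp flip: m)
    then have "\<lfloor>x $ j\<rfloor> = m" by linarith
    then show "k $ j = ?k $ j" using m by simp
  qed
qed

text \<open>Space is tiled by lattice translates of the half-open cube, and each tile is moved back
  to the cube. Tonelli's theorem is used twice, around the translation.\<close>

lemma nn_integral_periodization:
  fixes f :: "real ^ 'n \<Rightarrow> ennreal"
  assumes [measurable]: "f \<in> borel_measurable lebesgue"
  shows "(\<integral>\<^sup>+x. f x \<partial>lebesgue) = (\<integral>\<^sup>+\<xi>. (\<integral>\<^sup>+k. f (\<xi> + k) \<partial>count_space int_lattice) * indicator half_open_cube \<xi> \<partial>lebesgue)"
proof -
  let ?\<Lambda> = "int_lattice :: (real^'n) set" let ?H = "half_open_cube :: (real^'n) set"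
  interpret pair_sigma_finite "count_space ?\<Lambda>" "lebesgue :: (real^'n) measure"
    unfolding pair_sigma_finite_def
    by (simp add: sigma_finite_lebesgue sigma_finite_measure_count_space_countable countable_int_lattice)
  have [measurable]: "?H \<in> sets lebesgue" by (rule half_open_cube_measure)
  have tr [measurable]: "(\<lambda>x. x - k) \<in> lebesgue \<rightarrow>\<^sub>M lebesgue" "(\<lambda>x. x + k) \<in> lebesgue \<rightarrow>\<^sub>M lebesgue" for k :: "real^'n"
    using translation_measurable_lebesgue[of "- k"] translation_measurable_lebesgue[of k] by simp_all
  have one: "(\<integral>\<^sup>+k. f x * indicator ?H (x - k) \<partial>count_space ?\<Lambda>) = f x" for x
  proof -
    obtain k0 where k0: "k0 \<in> ?\<Lambda>" "x - k0 \<in> ?H" "\<And>k. k \<in> ?\<Lambda> \<Longrightarrow> x - k \<in> ?H \<Longrightarrow> k = k0"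
      using half_open_cube_tiling[of x] by blast
    have "(\<integral>\<^sup>+k. f x * indicator ?H (x - k) \<partial>count_space ?\<Lambda>) = (\<integral>\<^sup>+k. f x * indicator {k0} k \<partial>count_space ?\<Lambda>)"
    proof (rule nn_integral_cong)
      fix k assume "k \<in> space (count_space ?\<Lambda>)"
      then have "x - k \<in> ?H \<longleftrightarrow> k = k0" using k0 by (metis space_count_space)
      then show "f x * indicator ?H (x - k) = f x * indicator {k0} k" by (simp add: indicator_def)
    qed
    also have "\<dots> = f x" using k0(1) by (simp add: nn_integral_cmult_indicator one_ennreal_def[symmetric])
    finally show ?thesis .
  qed
  have "(\<integral>\<^sup>+x. f x \<partial>lebesgue) = (\<integral>\<^sup>+x. (\<integral>\<^sup>+k. f x * indicator ?H (x - k) \<partial>count_space ?\<Lambda>) \<partial>lebesgue)"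
    by (simp add: one)
  also have "\<dots> = (\<integral>\<^sup>+k. (\<integral>\<^sup>+x. f x * indicator ?H (x - k) \<partial>lebesgue) \<partial>count_space ?\<Lambda>)"
  proof (rule Fubini')
    show "(\<lambda>(k, x). f x * indicator ?H (x - k)) \<in> borel_measurable (count_space ?\<Lambda> \<Otimes>\<^sub>M lebesgue)"
      by (rule measurable_pair_measure_countable1[OF countable_int_lattice]) (simp, measurable)
  qed
  also have "\<dots> = (\<integral>\<^sup>+k. (\<integral>\<^sup>+\<xi>. f (\<xi> + k) * indicator ?H \<xi> \<partial>lebesgue) \<partial>count_space ?\<Lambda>)"
  proof (rule nn_integral_cong)
    fix k :: "real^'n"
    show "(\<integral>\<^sup>+x. f x * indicator ?H (x - k) \<partial>lebesgue) = (\<integral>\<^sup>+\<xi>. f (\<xi> + k) * indicator ?H \<xi> \<partial>lebesgue)"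
      using nn_integral_translation[of "\<lambda>x. f x * indicator ?H (x - k)" k] by simp
  qed
  also have "\<dots> = (\<integral>\<^sup>+\<xi>. (\<integral>\<^sup>+k. f (\<xi> + k) * indicator ?H \<xi> \<partial>count_space ?\<Lambda>) \<partial>lebesgue)"
  proof (rule Fubini'[symmetric])
    show "(\<lambda>(k, \<xi>). f (\<xi> + k) * indicator ?H \<xi>) \<in> borel_measurable (count_space ?\<Lambda> \<Otimes>\<^sub>M lebesgue)"
      by (rule measurable_pair_measure_countable1[OF countable_int_lattice]) (simp, measurable)
  qed
  also have "\<dots> = (\<integral>\<^sup>+\<xi>. (\<integral>\<^sup>+k. f (\<xi> + k) \<partial>count_space ?\<Lambda>) * indicator ?H \<xi> \<partial>lebesgue)"
    by (simp add: nn_integral_multc)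
  finally show ?thesis .
qed

text \<open>For every \<open>\<xi>\<close> the values \<open>fourier_L1 h (\<xi> + k)\<close> are the Fourier coefficients of a function
  with the same modulus as \<open>h\<close>, so Plancherel for cube-supported functions follows from Parseval
  by integrating over the cube.\<close>

lemma cube_Plancherel:
  fixes h :: "real ^ 'n \<Rightarrow> complex"
  assumes h: "h \<in> L2" and h0: "\<And>x. x \<notin> cbox a (a + 1) \<Longrightarrow> h x = 0"
  shows "fourier_L1 h \<in> L2" "L2_norm (fourier_L1 h) = L2_norm h"
proof -
  have m [measurable]: "fourier_L1 h \<in> borel_measurable lebesgue" using h by measurable
  have "(\<integral>\<^sup>+k. ennreal ((cmod (fourier_L1 h (\<xi> + k)))\<^sup>2) \<partial>count_space int_lattice) = ennreal ((L2_norm h)\<^sup>2)" for \<xi>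
  proof (rule nn_integral_count_space_has_sum[OF _ countable_int_lattice])
    let ?h = "\<lambda>x. character (- \<xi>) x * h x"
    have "((\<lambda>k. (cmod (LINT x|lebesgue. ?h x * cnj (character k x)))\<^sup>2) has_sum (L2_norm ?h)\<^sup>2) int_lattice"
      by (rule cube_Parseval[where a=a]) (use h0 in \<open>auto intro: L2_character h\<close>)
    moreover have "L2_norm ?h = L2_norm h" by (simp add: L2_norm_def norm_mult)
    moreover have "(LINT x|lebesgue. ?h x * cnj (character k x)) = fourier_L1 h (\<xi> + k)" for k
      by (simp add: fourier_L1_eq character_add_left character_minus mult_ac)
    ultimately show "((\<lambda>k. (cmod (fourier_L1 h (\<xi> + k)))\<^sup>2) has_sum (L2_norm h)\<^sup>2) int_lattice" by simp
  qed simp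
  then have I: "(\<integral>\<^sup>+\<xi>. ennreal ((cmod (fourier_L1 h \<xi>))\<^sup>2) \<partial>lebesgue) = ennreal ((L2_norm h)\<^sup>2)"
    by (subst nn_integral_periodization)
      (simp_all add: nn_integral_cmult_indicator half_open_cube_measure[where 'n='n])
  then show L: "fourier_L1 h \<in> L2"
    by (auto simp: L2_def integrable_iff_bounded)
  have "(L2_norm (fourier_L1 h))\<^sup>2 = (L2_norm h)\<^sup>2"
    using I unfolding L2_norm_ennreal[OF L, symmetric] by simp
  then show "L2_norm (fourier_L1 h) = L2_norm h" by (simp add: power2_eq_iff_nonneg)
qed

lemma L2_linear:
  fixes L :: "real ^ 'n \<Rightarrow> real ^ 'n"
  assumes L: "linear L" "bij L" and f: "f \<in> L2"
  shows "(\<lambda>x. f (L x)) \<in> L2" "L2_norm (\<lambda>x. f (L x)) = L2_norm f / sqrt \<bar>det (matrix L)\<bar>"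
proof -
  have [measurable]: "f \<in> borel_measurable lebesgue" using f by (rule L2_measurable)
  have m: "(\<lambda>x. (cmod (f x))\<^sup>2) \<in> borel_measurable lebesgue" by measurable
  have "(\<lambda>x. f (L x)) \<in> borel_measurable lebesgue"
    using measurable_compose[OF linear_measurable_lebesgue[OF L], of f borel] by simp
  then show "(\<lambda>x. f (L x)) \<in> L2"
    using integrable_linear[OF L m] f by (simp add: L2_def)
  show "L2_norm (\<lambda>x. f (L x)) = L2_norm f / sqrt \<bar>det (matrix L)\<bar>"
    using integral_linear[OF L m] by (simp add: L2_norm_def real_sqrt_mult real_sqrt_inverse divide_inverse mult.commute)
qed

lemma adjoint_bij:
  fixes L :: "real ^ 'n \<Rightarrow> real ^ 'n"
  assumes L: "linear L" "bij L"
  shows "linear (adjoint L)" "bij (adjoint L)" "inv (adjoint L) = adjoint (inv L)"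
    "det (matrix (adjoint L)) = det (matrix L)"
proof -
  show l: "linear (adjoint L)" using L(1) by (rule adjoint_linear)
  note li = linear_bij_inv(1)[OF L]
  have "z \<bullet> adjoint L (adjoint (inv L) x) = z \<bullet> x" "z \<bullet> adjoint (inv L) (adjoint L x) = z \<bullet> x" for z x
    using L(2) by (simp_all add: adjoint_works L(1) li surj_f_inv_f bij_is_surj inv_f_f bij_is_inj)
  then have 1: "adjoint L (adjoint (inv L) x) = x" and 2: "adjoint (inv L) (adjoint L x) = x" for x
    by (blast intro: vector_eq_ldot[THEN iffD1])+
  show "bij (adjoint L)" by (rule o_bij[of "adjoint (inv L)"]) (use 1 2 in auto)
  show "inv (adjoint L) = adjoint (inv L)" by (rule inv_equality) (use 1 2 in auto)
  show "det (matrix (adjoint L)) = det (matrix L)" by (simp add: matrix_adjoint L(1))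
qed

lemma fourier_L1_linear:
  fixes L :: "real ^ 'n \<Rightarrow> real ^ 'n"
  assumes L: "linear L" "bij L" and f: "f \<in> borel_measurable lebesgue"
  shows "fourier_L1 (\<lambda>x. f (L x)) \<xi> = inverse \<bar>det (matrix L)\<bar> *\<^sub>R fourier_L1 f (adjoint (inv L) \<xi>)"
proof -
  note li = linear_bij_inv(1)[OF L]
  have "character (adjoint (inv L) \<xi>) (L x) = character \<xi> x" for x
    by (simp add: character_def inner_commute[of _ "L x"] adjoint_works[OF li] inv_f_f[OF bij_is_inj[OF L(2)]] inner_commute[of x])
  then have "fourier_L1 (\<lambda>x. f (L x)) \<xi> = (LINT x|lebesgue. f (L x) * cnj (character (adjoint (inv L) \<xi>) (L x)))"
    by (simp add: fourier_L1_eq)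
  also have "\<dots> = inverse \<bar>det (matrix L)\<bar> *\<^sub>R fourier_L1 f (adjoint (inv L) \<xi>)"
    unfolding fourier_L1_eq
    by (intro integral_linear[OF L, of "\<lambda>x. f x * cnj (character (adjoint (inv L) \<xi>) x)"] borel_measurable_times f
        cnj_measurable character_measurable)
  finally show ?thesis .
qed

text \<open>A dilation brings the support into a cube of side 1 centred at the origin; the powers of
  the determinant on the two sides cancel.\<close>

lemma bounded_support_Plancherel:
  fixes f :: "real ^ 'n \<Rightarrow> complex"
  assumes f: "f \<in> L2" "bounded_support f"
  shows "fourier_L1 f \<in> L2" "L2_norm (fourier_L1 f) = L2_norm f"
proof -
  obtain R where R: "\<And>x. norm x > R \<Longrightarrow> f x = 0" using f(2) by (auto simp: bounded_support_def)
  \<comment> \<open>\<open>s\<close> is at least 2R, so every \<open>x\<close> of norm above 1/2 is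
    sent outside the ball of radius \<open>R\<close>; the maximum with 1 keeps \<open>s\<close>
    positive.\<close>
  define s where "s = 2 * max R 1"
  have s: "s > 0" "2 * R \<le> s" by (auto simp: s_def)
  let ?L = "\<lambda>x::real^'n. s *\<^sub>R x"
  have L: "linear ?L" "bij ?L"
    using s(1) by (auto intro!: bijI' linear_scaleR simp: exI[of _ "_ /\<^sub>R s"])
  note Li = linear_bij_inv[OF L] note adj = adjoint_bij[OF Li(1,2)]
  let ?u = "\<lambda>x. f (?L x)"
  have u: "?u \<in> L2" using L2_linear(1)[OF L f(1)] .
  have "?u x = 0" if "x \<notin> cbox (-(1/2) *\<^sub>R 1) (-(1/2) *\<^sub>R 1 + 1)" for x
  proof -
    have "\<exists>j. \<not> (- (1/2) \<le> x $ j \<and> x $ j \<le> 1/2)" using that by (auto simp: mem_box_cart)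
    then obtain j where "\<not> (- (1/2) \<le> x $ j \<and> x $ j \<le> 1/2)" by blast
    then have "1/2 < \<bar>x $ j\<bar>" by auto
    also have "\<dots> \<le> norm x" by (rule component_le_norm_cart)
    finally have n: "1/2 < norm x" .
    have "s * (1/2) < s * norm x" by (rule mult_strict_left_mono[OF n s(1)])
    moreover have "norm (?L x) = s * norm x" using s(1) by simp
    ultimately have "R < norm (?L x)" using s(2) by linarith
    then show ?thesis by (rule R)
  qed
  note P = cube_Plancherel[OF u, where a = "-(1/2) *\<^sub>R 1", OF this]
  let ?c = "inverse \<bar>det (matrix ?L)\<bar>"
  have c: "?c > 0" using Li(3) by simp
  have eq: "fourier_L1 ?u = (\<lambda>\<xi>. of_real ?c * fourier_L1 f (adjoint (inv ?L) \<xi>))"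
    using fourier_L1_linear[OF L L2_measurable[OF f(1)]] by (simp add: scaleR_conv_of_real fun_eq_iff)
  note ia = linear_bij_inv[OF adj(1,2)]
  have "(\<lambda>\<xi>. inverse (of_real ?c) * fourier_L1 ?u (inv (adjoint (inv ?L)) \<xi>)) \<in> L2"
    by (intro L2_scale L2_linear(1)[OF ia(1,2)] P(1))
  moreover have "(\<lambda>\<xi>. inverse (of_real ?c) * fourier_L1 ?u (inv (adjoint (inv ?L)) \<xi>)) = fourier_L1 f"
    unfolding eq using Li(3) adj(2) by (simp add: surj_f_inv_f bij_is_surj fun_eq_iff)
  ultimately show F: "fourier_L1 f \<in> L2" by simp
  have "L2_norm (fourier_L1 ?u) = ?c * (L2_norm (fourier_L1 f) / sqrt ?c)"
    unfolding eq L2_norm_scale L2_linear(2)[OF adj(1,2) F] adj(4) Li(4) by (simp add: abs_inverse norm_inverse)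
  moreover have "L2_norm ?u = L2_norm f * sqrt ?c"
    unfolding L2_linear(2)[OF L f(1)] by (simp add: divide_inverse real_sqrt_inverse)
  ultimately have "?c * (L2_norm (fourier_L1 f) / sqrt ?c) = L2_norm f * sqrt ?c"
    using P(2) by simp
  moreover have "?c / sqrt ?c = sqrt ?c" using c by (simp add: real_div_sqrt)
  ultimately have "sqrt ?c * L2_norm (fourier_L1 f) = sqrt ?c * L2_norm f"
    by (metis mult.commute times_divide_eq_left times_divide_eq_right)
  then show "L2_norm (fourier_L1 f) = L2_norm f" using c by simp
qed

section \<open>Extension of the transform to all of L2\<close>

lemma bounded_support_diff:
  assumes "bounded_support f" "bounded_support g" shows "bounded_support (\<lambda>x. f x - g x)"
proof -
  from assms obtain R S where "\<And>x. norm x > R \<Longrightarrow> f x = 0" "\<And>x. norm x > S \<Longrightarrow> g x = 0"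
    by (auto simp: bounded_support_def)
  then show ?thesis unfolding bounded_support_def by (intro exI[of _ "max R S"]) auto
qed

lemma bounded_support_mult: "bounded_support f \<Longrightarrow> bounded_support (\<lambda>x. m x * f x)"
  unfolding bounded_support_def by auto

text \<open>The isometry for bounded supports makes the transforms of the truncations a Cauchy
  sequence. This provides the witness for the choice in \<open>fourier\<close>.\<close>

lemma fourier_approximation:
  fixes f :: "real ^ 'n \<Rightarrow> complex"
  assumes f: "f \<in> L2"
  shows "\<exists>g. L2_tendsto (\<lambda>n. fourier_L1 (truncate n f)) g"
proof (rule L2_complete)
  let ?F = "\<lambda>n. truncate n f"
  have F: "?F n \<in> L2" "bounded_support (?F n)" for n by (simp_all add: truncate_L2 f)
  show "fourier_L1 (?F n) \<in> L2" for n using bounded_support_Plancherel(1)[OF F] .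
  have d: "L2_norm (\<lambda>x. fourier_L1 (?F m) x - fourier_L1 (?F n) x) = L2_norm (\<lambda>x. ?F m x - ?F n x)" for m n
    using bounded_support_Plancherel(2)[OF L2_diff[OF F(1) F(1)] bounded_support_diff[OF F(2) F(2)], of m n]
    by (simp add: fourier_L1_diff[OF bounded_support_L1[OF F] bounded_support_L1[OF F], abs_def])
  fix \<epsilon> :: real assume "\<epsilon> > 0"
  then obtain N where N: "\<And>n. n \<ge> N \<Longrightarrow> L2_norm (\<lambda>x. ?F n x - f x) < \<epsilon> / 2"
    using order_tendstoD(2)[OF L2_tendstoD(3)[OF truncate_L2_tendsto[OF f]], of "\<epsilon>/2"]
    by (auto simp: eventually_sequentially)
  have "L2_norm (\<lambda>x. ?F m x - ?F n x) < \<epsilon>" if "m \<ge> N" "n \<ge> N" for m n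
    using L2_norm_triangle_diff[OF F(1)[of m] f F(1)[of n]] L2_norm_minus_commute[of f "?F n"]
      N[OF that(1)] N[OF that(2)] by linarith
  then show "\<exists>N. \<forall>m\<ge>N. \<forall>n\<ge>N. L2_norm (\<lambda>x. fourier_L1 (?F m) x - fourier_L1 (?F n) x) < \<epsilon>"
    unfolding d by blast
qed

text \<open>The right-hand side mentions only \<open>f\<close>, so all admissible limits
  \<open>g\<close> agree almost everywhere, whichever approximating sequence produced them.\<close>

lemma weak_fourier_limit:
  fixes f :: "real ^ 'n \<Rightarrow> complex"
  assumes F: "\<And>n. F n \<in> L1" "L2_tendsto F f" "L2_tendsto (\<lambda>n. fourier_L1 (F n)) g"
    and w: "w \<in> L2" "bounded_support w"
  shows "(LINT x|lebesgue. g x * w x) = (LINT x|lebesgue. f x * fourier_L1 w x)"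
proof -
  have "(\<lambda>n. LINT x|lebesgue. fourier_L1 (F n) x * w x) \<longlonglongrightarrow> (LINT x|lebesgue. g x * w x)"
    by (rule L2_tendsto_mult_integral[OF F(3) w(1)])
  moreover have "(\<lambda>n. LINT x|lebesgue. F n x * fourier_L1 w x) \<longlonglongrightarrow> (LINT x|lebesgue. f x * fourier_L1 w x)"
    by (rule L2_tendsto_mult_integral[OF F(2) bounded_support_Plancherel(1)[OF w]])
  ultimately show ?thesis
    using fourier_L1_multiplication[OF F(1) bounded_support_L1[OF w]] LIMSEQ_unique by simp
qed

lemma
  fixes f :: "real ^ 'n \<Rightarrow> complex"
  assumes f: "f \<in> L2"
  shows fourier_L2: "fourier f \<in> L2"
    and fourier_weak: "w \<in> L2 \<Longrightarrow> bounded_support w \<Longrightarrow>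
      (LINT x|lebesgue. fourier f x * w x) = (LINT x|lebesgue. f x * fourier_L1 w x)"
proof -
  obtain g where "L2_tendsto (\<lambda>n. fourier_L1 (truncate n f)) g"
    using fourier_approximation[OF f] by blast
  then have "\<exists>F. (\<forall>n. F n \<in> L1 \<inter> L2) \<and> L2_tendsto F f \<and> L2_tendsto (\<lambda>n. fourier_L1 (F n)) g"
    using truncate_L2_tendsto[OF f] truncate_L2[OF f] bounded_support_L1[OF truncate_L2[OF f]]
    by (intro exI[of _ "\<lambda>n. truncate n f"]) auto
  then have "\<exists>F. (\<forall>n. F n \<in> L1 \<inter> L2) \<and> L2_tendsto F f \<and> L2_tendsto (\<lambda>n. fourier_L1 (F n)) (fourier f)"
    unfolding fourier_def
    by (rule someI[of "\<lambda>g. \<exists>F. (\<forall>n. F n \<in> L1 \<inter> L2) \<and> L2_tendsto F f \<and> L2_tendsto (\<lambda>n. fourier_L1 (F n)) g"])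
  then obtain F where F: "\<And>n. F n \<in> L1" "L2_tendsto F f" "L2_tendsto (\<lambda>n. fourier_L1 (F n)) (fourier f)" by blast
  show "fourier f \<in> L2" using L2_tendstoD(2)[OF F(3)] .
  show "w \<in> L2 \<Longrightarrow> bounded_support w \<Longrightarrow>
      (LINT x|lebesgue. fourier f x * w x) = (LINT x|lebesgue. f x * fourier_L1 w x)"
    by (rule weak_fourier_limit[OF F])
qed

lemma fourier_measurable: "f \<in> L2 \<Longrightarrow> fourier f \<in> borel_measurable lebesgue"
  by (rule L2_measurable[OF fourier_L2])

text \<open>Computing a transform reduces to the multiplication formula for test functions
  \<open>w\<close>, where explicit integrals can be manipulated.\<close>

lemma fourier_eqI:
  fixes f g :: "real ^ 'n \<Rightarrow> complex"
  assumes "f \<in> L2" "g \<in> L2"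
    and "\<And>w. w \<in> L2 \<Longrightarrow> bounded_support w \<Longrightarrow> (LINT x|lebesgue. g x * w x) = (LINT x|lebesgue. f x * fourier_L1 w x)"
  shows "AE x in lebesgue. fourier f x = g x"
  by (rule L2_eq_testing) (use assms in \<open>simp_all add: fourier_L2 fourier_weak\<close>)

text \<open>The sequence hidden in the choice of \<open>fourier\<close> is unknown. The limit along
  truncations satisfies the same pairing identity and hence agrees with the chosen one almost
  everywhere.\<close>

lemma fourier_truncate_tendsto:
  fixes f :: "real ^ 'n \<Rightarrow> complex"
  assumes f: "f \<in> L2" shows "L2_tendsto (\<lambda>n. fourier_L1 (truncate n f)) (fourier f)"
proof -
  obtain g where g: "L2_tendsto (\<lambda>n. fourier_L1 (truncate n f)) g"
    using fourier_approximation[OF f] by blast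
  have gL: "g \<in> L2" using L2_tendstoD(2)[OF g] .
  have ae: "AE x in lebesgue. fourier f x = g x"
    by (rule fourier_eqI[OF f gL], rule weak_fourier_limit[OF _ truncate_L2_tendsto[OF f] g])
       (simp_all add: bounded_support_L1 truncate_L2 f)
  have "L2_norm (\<lambda>x. fourier_L1 (truncate n f) x - fourier f x) = L2_norm (\<lambda>x. fourier_L1 (truncate n f) x - g x)" for n
    using L2_tendstoD(1)[OF g, of n] gL fourier_L2[OF f] ae
    by (intro L2_norm_cong_AE L2_measurable[OF L2_diff]) auto
  then show ?thesis using g fourier_L2[OF f] by (simp add: L2_tendsto_def)
qed

theorem fourier_isometry: "f \<in> L2 \<Longrightarrow> L2_norm (fourier f) = L2_norm f"
  using L2_tendsto_norm[OF fourier_truncate_tendsto] L2_tendsto_norm[OF truncate_L2_tendsto]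
    bounded_support_Plancherel(2)[OF truncate_L2] LIMSEQ_unique by fastforce

lemma fourier_multiplication:
  fixes f w :: "real ^ 'n \<Rightarrow> complex"
  assumes f: "f \<in> L2" and w: "w \<in> L2"
  shows "(LINT x|lebesgue. fourier f x * w x) = (LINT x|lebesgue. f x * fourier w x)"
proof -
  have "(\<lambda>n. LINT x|lebesgue. truncate n w x * fourier f x) \<longlonglongrightarrow> (LINT x|lebesgue. w x * fourier f x)"
    by (rule L2_tendsto_mult_integral[OF truncate_L2_tendsto[OF w] fourier_L2[OF f]])
  moreover have "(\<lambda>n. LINT x|lebesgue. fourier_L1 (truncate n w) x * f x) \<longlonglongrightarrow> (LINT x|lebesgue. fourier w x * f x)"
    by (rule L2_tendsto_mult_integral[OF fourier_truncate_tendsto[OF w] f])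
  moreover have "(LINT x|lebesgue. truncate n w x * fourier f x) = (LINT x|lebesgue. fourier_L1 (truncate n w) x * f x)" for n
    using fourier_weak[OF f truncate_L2[OF w], of n] by (simp add: mult.commute)
  ultimately show ?thesis using LIMSEQ_unique by (simp add: mult.commute)
qed

lemma fourier_add:
  fixes f g :: "real ^ 'n \<Rightarrow> complex"
  assumes f: "f \<in> L2" and g: "g \<in> L2"
  shows "AE x in lebesgue. fourier (\<lambda>x. f x + g x) x = fourier f x + fourier g x"
  by (rule fourier_eqI)
     (simp_all add: L2_add f g fourier_L2 distrib_right L2_mult_integrable fourier_weak bounded_support_Plancherel(1))

lemma fourier_scale:
  fixes f :: "real ^ 'n \<Rightarrow> complex"
  assumes f: "f \<in> L2"
  shows "AE x in lebesgue. fourier (\<lambda>x. c * f x) x = c * fourier f x"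
  by (rule fourier_eqI)
     (simp_all add: L2_scale f fourier_L2 mult.assoc fourier_weak)

lemma fourier_diff:
  fixes f g :: "real ^ 'n \<Rightarrow> complex"
  assumes f: "f \<in> L2" and g: "g \<in> L2"
  shows "AE x in lebesgue. fourier (\<lambda>x. f x - g x) x = fourier f x - fourier g x"
  by (rule fourier_eqI)
     (simp_all add: L2_diff f g fourier_L2 left_diff_distrib L2_mult_integrable fourier_weak bounded_support_Plancherel(1))

text \<open>Polarization: norms of differences determine the real part, and replacing
  \<open>f\<close> by -i times \<open>f\<close> turns the imaginary part into a real part.\<close>

theorem fourier_inner:
  fixes f g :: "real ^ 'n \<Rightarrow> complex"
  assumes f: "f \<in> L2" and g: "g \<in> L2"
  shows "L2_inner (fourier f) (fourier g) = L2_inner f g"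
proof -
  have re: "Re (L2_inner (fourier f) (fourier g)) = Re (L2_inner f g)" if f: "f \<in> L2" and g: "g \<in> L2" for f g :: "real^'n \<Rightarrow> complex"
  proof -
    have "L2_norm (\<lambda>x. fourier f x - fourier g x) = L2_norm (fourier (\<lambda>x. f x - g x))"
      using fourier_diff[OF f g] fourier_L2 L2_diff f g
      by (intro L2_norm_cong_AE L2_measurable) (auto intro: L2_diff fourier_L2 simp: eq_commute)
    also have "\<dots> = L2_norm (\<lambda>x. f x - g x)" by (rule fourier_isometry[OF L2_diff[OF f g]])
    finally show ?thesis
      using L2_norm_sq_diff[OF fourier_L2[OF f] fourier_L2[OF g]] L2_norm_sq_diff[OF f g]
      by (simp add: fourier_isometry f g)
  qed
  have im: "Im z = Re (- \<i> * z)" for z by simp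
  have "L2_inner (fourier (\<lambda>x. - \<i> * f x)) (fourier g) = L2_inner (\<lambda>x. - \<i> * fourier f x) (fourier g)"
    unfolding L2_inner_def using fourier_scale[OF f, of "- \<i>"]
    by (intro integral_cong_AE borel_measurable_integrable L2_inner_integrable L2_scale fourier_L2 f g)
       (elim eventually_mono, simp)
  then have "Re (- \<i> * L2_inner (fourier f) (fourier g)) = Re (- \<i> * L2_inner f g)"
    using re[OF L2_scale[OF f, of "- \<i>"] g] by (simp only: L2_inner_scale_left)
  with re[OF f g] show ?thesis unfolding im[symmetric] by (simp add: complex_eq_iff)
qed

text \<open>The Fourier operator is symmetric for the bilinear pairing and isometric, hence unitary:
  its inverse is \<open>h \<mapsto> cnj (fourier (cnj h))\<close>.\<close>

theorem fourier_surj: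
  fixes h :: "real ^ 'n \<Rightarrow> complex"
  assumes h: "h \<in> L2"
  shows "\<exists>f\<in>L2. AE x in lebesgue. fourier f x = h x"
proof
  let ?g = "\<lambda>x. cnj (h x)" let ?f = "\<lambda>x. cnj (fourier ?g x)"
  have g: "?g \<in> L2" by (rule L2_cnj[OF h])
  show f: "?f \<in> L2" by (intro L2_cnj fourier_L2 g)
  show "AE x in lebesgue. fourier ?f x = h x"
  proof (rule L2_eq_testing[OF fourier_L2[OF f] h])
    fix w :: "real^'n \<Rightarrow> complex" assume w: "w \<in> L2"
    have "(LINT x|lebesgue. fourier ?f x * w x) = (LINT x|lebesgue. ?f x * fourier w x)"
      by (rule fourier_multiplication[OF f w])
    also have "\<dots> = L2_inner (fourier w) (fourier ?g)" by (simp add: L2_inner_def mult.commute)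
    also have "\<dots> = L2_inner w ?g" by (rule fourier_inner[OF w g])
    finally show "(LINT x|lebesgue. fourier ?f x * w x) = (LINT x|lebesgue. h x * w x)"
      by (simp add: L2_inner_def mult.commute)
  qed
qed

section \<open>Translations and dilations on the frequency side\<close>

lemma translate_L2:
  assumes "f \<in> L2" shows "translate k f \<in> L2" "L2_norm (translate k f) = L2_norm f"
  using L2_translate[OF assms, of "- k"] by (simp_all add: translate_def)

lemma fourier_translate:
  fixes f :: "real ^ 'n \<Rightarrow> complex"
  assumes f: "f \<in> L2"
  shows "AE \<xi> in lebesgue. fourier (translate k f) \<xi> = cnj (character k \<xi>) * fourier f \<xi>"
proof (rule fourier_eqI)
  have e: "(\<lambda>\<xi>. cnj (character k \<xi>) * g \<xi>) \<in> L2" if "g \<in> L2" for g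
    using L2_character[OF that, of "- k"] by (simp add: character_minus)
  show "translate k f \<in> L2" by (rule translate_L2[OF f])
  show "(\<lambda>\<xi>. cnj (character k \<xi>) * fourier f \<xi>) \<in> L2" by (rule e[OF fourier_L2[OF f]])
  fix w :: "real^'n \<Rightarrow> complex" assume w: "w \<in> L2" "bounded_support w"
  let ?w = "\<lambda>\<xi>. cnj (character k \<xi>) * w \<xi>"
  have "(LINT \<xi>|lebesgue. cnj (character k \<xi>) * fourier f \<xi> * w \<xi>) = (LINT \<xi>|lebesgue. fourier f \<xi> * ?w \<xi>)"
    by (simp add: mult_ac)
  also have "\<dots> = (LINT x|lebesgue. f x * fourier_L1 ?w x)"
    by (rule fourier_weak[OF f e[OF w(1)] bounded_support_mult[OF w(2)]])
  \<comment> \<open>Modulating \<open>w\<close> translates its transform.\<close>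
  also have "\<dots> = (LINT x|lebesgue. f x * fourier_L1 w (x + k))"
    by (simp add: fourier_L1_eq character_add_left mult_ac)
  also have "\<dots> = (LINT x|lebesgue. f (x + k - k) * fourier_L1 w (x + k))" by simp
  also have "\<dots> = (LINT x|lebesgue. f (x - k) * fourier_L1 w x)"
    using translate_L2(1)[OF f, of k] bounded_support_Plancherel(1)[OF w]
    by (intro integral_translation(1)[of "\<lambda>x. f (x - k) * fourier_L1 w x"] borel_measurable_times L2_measurable)
       (simp_all add: translate_def)
  finally show "(LINT \<xi>|lebesgue. cnj (character k \<xi>) * fourier f \<xi> * w \<xi>) = (LINT x|lebesgue. translate k f x * fourier_L1 w x)"
    by (simp add: translate_def)
qed

lemma dilation_op_L2:
  fixes L :: "real ^ 'n \<Rightarrow> real ^ 'n"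
  assumes L: "linear L" "bij L" and f: "f \<in> L2"
  shows "dilation_op L f \<in> L2" "L2_norm (dilation_op L f) = L2_norm f"
proof -
  show "dilation_op L f \<in> L2" unfolding dilation_op_def by (intro L2_scale L2_linear(1)[OF L f])
  show "L2_norm (dilation_op L f) = L2_norm f"
    unfolding dilation_op_def L2_norm_scale L2_linear(2)[OF L f] using linear_bij_inv(3)[OF L] by simp
qed

text \<open>The dilation is moved onto the test function by the change of variables with the
  adjoint, and back to \<open>f\<close> after the pairing identity. Composition with an invertible
  linear map keeps the support of the test function bounded.\<close>

lemma fourier_dilation:
  fixes L :: "real ^ 'n \<Rightarrow> real ^ 'n"
  assumes L: "linear L" "bij L" and f: "f \<in> L2"
  shows "AE \<xi> in lebesgue. fourier (dilation_op L f) \<xi> = of_real (1 / sqrt \<bar>det (matrix L)\<bar>) * fourier f (inv (adjoint L) \<xi>)"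
proof (rule fourier_eqI)
  note adj = adjoint_bij[OF L] note iadj = linear_bij_inv[OF adj(1,2)]
  let ?d = "\<bar>det (matrix L)\<bar>" let ?s = "of_real (1 / sqrt ?d) :: complex"
  have d: "?d > 0" using linear_bij_inv(3)[OF L] by simp
  show "dilation_op L f \<in> L2" by (rule dilation_op_L2[OF L f])
  show "(\<lambda>\<xi>. ?s * fourier f (inv (adjoint L) \<xi>)) \<in> L2"
    by (intro L2_scale L2_linear(1)[OF iadj(1,2)] fourier_L2 f)
  fix w :: "real^'n \<Rightarrow> complex" assume w: "w \<in> L2" "bounded_support w"
  have wa: "(\<lambda>\<eta>. w (adjoint L \<eta>)) \<in> L2" by (rule L2_linear(1)[OF adj(1,2) w(1)])
  have wab: "bounded_support (\<lambda>\<eta>. w (adjoint L \<eta>))"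
  proof -
    obtain R where R: "\<And>x. norm x > R \<Longrightarrow> w x = 0" using w(2) by (auto simp: bounded_support_def)
    obtain C where C: "C > 0" "\<And>x. norm (inv (adjoint L) x) \<le> norm x * C"
      using bounded_linear.pos_bounded[OF linear_conv_bounded_linear[THEN iffD1, OF iadj(1)]] by blast
    have "w (adjoint L \<eta>) = 0" if "norm \<eta> > R * C" for \<eta>
    proof (rule R)
      have "norm \<eta> \<le> norm (adjoint L \<eta>) * C"
        using C(2)[of "adjoint L \<eta>"] by (simp add: inv_f_f bij_is_inj adj(2))
      then have "R * C < norm (adjoint L \<eta>) * C" using that by simp
      then show "norm (adjoint L \<eta>) > R" using C(1) by simp
    qed
    then show ?thesis unfolding bounded_support_def by blast
  qed
  have "(LINT \<xi>|lebesgue. ?s * fourier f (inv (adjoint L) \<xi>) * w \<xi>)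
      = ?s * (LINT \<xi>|lebesgue. fourier f (inv (adjoint L) \<xi>) * w (adjoint L (inv (adjoint L) \<xi>)))"
    using adj(2) by (simp add: mult.assoc surj_f_inv_f bij_is_surj)
  also have "(LINT \<xi>|lebesgue. fourier f (inv (adjoint L) \<xi>) * w (adjoint L (inv (adjoint L) \<xi>)))
      = ?d *\<^sub>R (LINT \<eta>|lebesgue. fourier f \<eta> * w (adjoint L \<eta>))"
    using fourier_L2[OF f] wa iadj(4) adj(4)
    by (subst integral_linear[OF iadj(1,2), of "\<lambda>\<eta>. fourier f \<eta> * w (adjoint L \<eta>)"])
      (auto intro!: borel_measurable_times L2_measurable simp: abs_inverse)
  also have "(LINT \<eta>|lebesgue. fourier f \<eta> * w (adjoint L \<eta>)) = (LINT x|lebesgue. f x * fourier_L1 (\<lambda>\<eta>. w (adjoint L \<eta>)) x)"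
    by (rule fourier_weak[OF f wa wab])
  also have "\<dots> = (LINT x|lebesgue. f (L (inv L x)) * (inverse ?d *\<^sub>R fourier_L1 w (inv L x)))"
  proof -
    have "adjoint (inv (adjoint L)) = inv L"
      using adj(3) adjoint_adjoint[OF linear_bij_inv(1)[OF L]] by simp
    then show ?thesis
      using L(2) by (simp add: fourier_L1_linear[OF adj(1,2) L2_measurable[OF w(1)]] adj(4) surj_f_inv_f bij_is_surj)
  qed
  also have "\<dots> = ?d *\<^sub>R (LINT x|lebesgue. f (L x) * (inverse ?d *\<^sub>R fourier_L1 w x))"
    using L2_linear(1)[OF L f] bounded_support_Plancherel(1)[OF w] linear_bij_inv(4)[OF L]
    by (subst integral_linear[OF linear_bij_inv(1,2)[OF L], of "\<lambda>x. f (L x) * (inverse ?d *\<^sub>R fourier_L1 w x)"])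
      (auto intro!: borel_measurable_times borel_measurable_scaleR L2_measurable simp: abs_inverse)
  also have "\<dots> = (LINT x|lebesgue. f (L x) * fourier_L1 w x)"
    using d by simp
  also have "?s * (?d *\<^sub>R \<dots>) = (LINT x|lebesgue. dilation_op L f x * fourier_L1 w x)"
  proof -
    have "?s * (?d *\<^sub>R z) = of_real (sqrt ?d) * z" for z
      using d by (simp add: scaleR_conv_of_real real_div_sqrt flip: of_real_mult of_real_divide)
    then show ?thesis by (simp add: dilation_op_def mult.assoc)
  qed
  finally show "(LINT \<xi>|lebesgue. ?s * fourier f (inv (adjoint L) \<xi>) * w \<xi>) = (LINT x|lebesgue. dilation_op L f x * fourier_L1 w x)" .
qed

section \<open>Parseval frames\<close>

text \<open>Cancels one factor in estimates obtained from Cauchy-Schwarz, where that factor may be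
  0.\<close>

lemma le_of_mult_self_le:
  fixes s b :: real
  assumes "s * s \<le> b * s" "0 \<le> b" "0 \<le> s" shows "s \<le> b"
  using assms mult_right_le_imp_le[of s s b] by (cases "s = 0") auto

lemma sum_sqrt_Cauchy_Schwarz:
  fixes a b :: "'a \<Rightarrow> complex"
  shows "cmod (\<Sum>i\<in>F. a i * b i) \<le> sqrt (\<Sum>i\<in>F. (cmod (a i))\<^sup>2) * sqrt (\<Sum>i\<in>F. (cmod (b i))\<^sup>2)"
proof -
  have "cmod (\<Sum>i\<in>F. a i * b i) \<le> (\<Sum>i\<in>F. cmod (a i) * cmod (b i))"
    using sum_norm_le[of F "\<lambda>i. a i * b i" "\<lambda>i. cmod (a i) * cmod (b i)"] by (simp add: norm_mult)
  also have "\<dots> \<le> sqrt ((\<Sum>i\<in>F. (cmod (a i))\<^sup>2) * (\<Sum>i\<in>F. (cmod (b i))\<^sup>2))"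
    by (rule real_le_rsqrt) (rule Cauchy_Schwarz_ineq_sum)
  finally show ?thesis by (simp add: real_sqrt_mult)
qed

definition L2_subspace :: "(real ^ 'n \<Rightarrow> complex) set \<Rightarrow> bool" where
  "L2_subspace V \<longleftrightarrow> V \<subseteq> L2 \<and> (\<lambda>x. 0) \<in> V \<and> (\<forall>f\<in>V. \<forall>g\<in>V. (\<lambda>x. f x + g x) \<in> V) \<and> (\<forall>c. \<forall>f\<in>V. (\<lambda>x. c * f x) \<in> V)"

lemma closed_subspace_L2_subspace: "closed_subspace V \<Longrightarrow> L2_subspace V"
  by (simp add: closed_subspace_def L2_subspace_def)

lemma L2_subspace_sum:
  assumes "L2_subspace V" "\<And>i. i \<in> F \<Longrightarrow> f i \<in> V" shows "(\<lambda>x. \<Sum>i\<in>F. c i * f i x) \<in> V"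
  using assms(2) by (induction F rule: infinite_finite_induct) (use assms(1) in \<open>auto simp: L2_subspace_def\<close>)

text \<open>Orthogonality is not assumed, and the Parseval identity concerns elements of
  \<open>V\<close> only; for other functions of L2 an inequality is derived. The arbitrary index
  type covers pairs of a generator and a lattice point.\<close>

locale parseval_frame =
  fixes J :: "'i set" and e :: "'i \<Rightarrow> real ^ 'n \<Rightarrow> complex" and V :: "(real ^ 'n \<Rightarrow> complex) set"
  assumes subspace: "L2_subspace V"
    and mem: "i \<in> J \<Longrightarrow> e i \<in> V"
    and parseval: "f \<in> V \<Longrightarrow> ((\<lambda>i. (cmod (L2_inner f (e i)))\<^sup>2) has_sum (L2_norm f)\<^sup>2) J"
begin

lemma V_L2: "f \<in> V \<Longrightarrow> f \<in> L2"
  using subspace by (auto simp: L2_subspace_def)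

lemma e_L2: "i \<in> J \<Longrightarrow> e i \<in> L2"
  by (intro V_L2 mem)

lemma synthesis_mem: "F \<subseteq> J \<Longrightarrow> (\<lambda>x. \<Sum>i\<in>F. c i * e i x) \<in> V"
  by (rule L2_subspace_sum[OF subspace]) (auto intro: mem)

lemma inner_synthesis:
  assumes "F \<subseteq> J" "f \<in> L2"
  shows "L2_inner f (\<lambda>x. \<Sum>i\<in>F. c i * e i x) = (\<Sum>i\<in>F. cnj (c i) * L2_inner f (e i))"
proof -
  have "L2_inner f (\<lambda>x. \<Sum>i\<in>F. c i * e i x) = (\<Sum>i\<in>F. L2_inner f (\<lambda>x. c i * e i x))"
    using assms by (intro L2_inner_sum_right L2_scale e_L2) auto
  then show ?thesis by (simp add: L2_inner_scale_right)
qed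

text \<open>Synthesis is adjoint to the isometric coefficient map, hence a contraction: expand one
  side of the inner product of the sum with itself, apply Cauchy-Schwarz to the coefficients and
  cancel one norm.\<close>

lemma synthesis_norm:
  assumes F: "finite F" "F \<subseteq> J"
  shows "(L2_norm (\<lambda>x. \<Sum>i\<in>F. c i * e i x))\<^sup>2 \<le> (\<Sum>i\<in>F. (cmod (c i))\<^sup>2)"
proof -
  let ?g = "\<lambda>x. \<Sum>i\<in>F. c i * e i x" let ?C = "\<Sum>i\<in>F. (cmod (c i))\<^sup>2"
  have g: "?g \<in> V" by (rule synthesis_mem[OF F(2)])
  have "(\<Sum>i\<in>F. (cmod (L2_inner ?g (e i)))\<^sup>2) \<le> (L2_norm ?g)\<^sup>2"
    by (rule finite_sum_le_has_sum[OF parseval[OF g] F]) simp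
  then have s: "sqrt (\<Sum>i\<in>F. (cmod (L2_inner ?g (e i)))\<^sup>2) \<le> L2_norm ?g"
    by (intro real_le_lsqrt) (auto intro: sum_nonneg)
  have "(L2_norm ?g)\<^sup>2 = cmod (L2_inner ?g ?g)" unfolding L2_inner_self norm_of_real by simp
  also have "\<dots> = cmod (\<Sum>i\<in>F. cnj (c i) * L2_inner ?g (e i))"
    by (subst inner_synthesis[OF F(2) V_L2[OF g]]) simp
  also have "\<dots> \<le> sqrt ?C * sqrt (\<Sum>i\<in>F. (cmod (L2_inner ?g (e i)))\<^sup>2)"
    using sum_sqrt_Cauchy_Schwarz[of "\<lambda>i. cnj (c i)" _ F] by simp
  also have "\<dots> \<le> sqrt ?C * L2_norm ?g"
    by (rule mult_left_mono[OF s]) (simp add: sum_nonneg)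
  finally have "L2_norm ?g * L2_norm ?g \<le> sqrt ?C * L2_norm ?g" by (simp add: power2_eq_square)
  then have "L2_norm ?g \<le> sqrt ?C"
    by (rule le_of_mult_self_le) (simp_all add: sum_nonneg)
  then have "(L2_norm ?g)\<^sup>2 \<le> (sqrt ?C)\<^sup>2" by (intro power_mono) auto
  then show ?thesis by (simp add: sum_nonneg)
qed

text \<open>A partial sum of the frame expansion; it stands in for the orthogonal projection of
  \<open>f\<close>.\<close>

definition analysis :: "(real ^ 'n \<Rightarrow> complex) \<Rightarrow> 'i set \<Rightarrow> real ^ 'n \<Rightarrow> complex" where
  "analysis f F = (\<lambda>x. \<Sum>i\<in>F. L2_inner f (e i) * e i x)"

lemma analysis_props:
  assumes F: "finite F" "F \<subseteq> J" and f: "f \<in> L2"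
  shows "analysis f F \<in> V" "L2_inner f (analysis f F) = of_real (\<Sum>i\<in>F. (cmod (L2_inner f (e i)))\<^sup>2)"
    "(L2_norm (analysis f F))\<^sup>2 \<le> (\<Sum>i\<in>F. (cmod (L2_inner f (e i)))\<^sup>2)"
proof -
  show "analysis f F \<in> V" unfolding analysis_def by (rule synthesis_mem[OF F(2)])
  show "L2_inner f (analysis f F) = of_real (\<Sum>i\<in>F. (cmod (L2_inner f (e i)))\<^sup>2)"
    unfolding analysis_def inner_synthesis[OF F(2) f] of_real_sum complex_norm_square by (simp add: mult.commute)
  show "(L2_norm (analysis f F))\<^sup>2 \<le> (\<Sum>i\<in>F. (cmod (L2_inner f (e i)))\<^sup>2)"
    unfolding analysis_def by (rule synthesis_norm[OF F])
qed

text \<open>With \<open>S\<close> the partial energy, the cross term contributes -2S and the squared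
  norm of the partial sum at most \<open>S\<close>. Nonnegativity of the left-hand side is then
  Bessel's inequality.\<close>

lemma analysis_error:
  assumes F: "finite F" "F \<subseteq> J" and f: "f \<in> L2"
  shows "(L2_norm (\<lambda>x. f x - analysis f F x))\<^sup>2 \<le> (L2_norm f)\<^sup>2 - (\<Sum>i\<in>F. (cmod (L2_inner f (e i)))\<^sup>2)"
  unfolding L2_norm_sq_diff[OF f V_L2[OF analysis_props(1)[OF F f]]]
  using analysis_props(2,3)[OF F f] by simp

lemma bessel:
  assumes F: "finite F" "F \<subseteq> J" and f: "f \<in> L2"
  shows "(\<Sum>i\<in>F. (cmod (L2_inner f (e i)))\<^sup>2) \<le> (L2_norm f)\<^sup>2"
  using analysis_error[OF F f] by (smt (verit) zero_le_power2)

definition energy :: "(real ^ 'n \<Rightarrow> complex) \<Rightarrow> real" where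
  "energy f = infsum (\<lambda>i. (cmod (L2_inner f (e i)))\<^sup>2) J"

lemma energy_has_sum:
  assumes f: "f \<in> L2" shows "((\<lambda>i. (cmod (L2_inner f (e i)))\<^sup>2) has_sum energy f) J"
  unfolding energy_def
proof (intro has_sum_infsum nonneg_bdd_above_summable_on)
  show "bdd_above (sum (\<lambda>i. (cmod (L2_inner f (e i)))\<^sup>2) ` {F. F \<subseteq> J \<and> finite F})"
    using bessel[OF _ _ f] by (intro bdd_aboveI[of _ "(L2_norm f)\<^sup>2"]) auto
qed simp

lemma energy_nonneg: "0 \<le> energy f"
  unfolding energy_def by (rule infsum_nonneg) simp

lemma energy_le: "f \<in> L2 \<Longrightarrow> energy f \<le> (L2_norm f)\<^sup>2"
  by (rule has_sum_le_finite_sums[OF energy_has_sum]) (auto intro: bessel)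

lemma energy_approx:
  assumes "f \<in> L2" "\<epsilon> > 0"
  shows "\<exists>F. finite F \<and> F \<subseteq> J \<and> energy f - \<epsilon> < (\<Sum>i\<in>F. (cmod (L2_inner f (e i)))\<^sup>2)"
proof -
  have "\<forall>\<^sub>F F in finite_subsets_at_top J. energy f - \<epsilon> < (\<Sum>i\<in>F. (cmod (L2_inner f (e i)))\<^sup>2)"
    using energy_has_sum[OF assms(1)] assms(2) unfolding has_sum_def by (intro order_tendstoD(1)) auto
  then show ?thesis unfolding eventually_finite_subsets_at_top by blast
qed

text \<open>Pythagoras with a finite partial sum in place of the projection: its squared error is
  the missing energy up to an arbitrarily small amount.\<close>

lemma dist_le_energy:
  assumes f: "f \<in> L2" and "energy f > (L2_norm f)\<^sup>2 - \<epsilon>"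
  shows "\<exists>g\<in>V. (L2_norm (\<lambda>x. f x - g x))\<^sup>2 < \<epsilon>"
proof -
  obtain F where F: "finite F" "F \<subseteq> J" "(L2_norm f)\<^sup>2 - \<epsilon> < (\<Sum>i\<in>F. (cmod (L2_inner f (e i)))\<^sup>2)"
    using energy_approx[OF f, of "energy f - ((L2_norm f)\<^sup>2 - \<epsilon>)"] assms(2) by auto
  then have "(L2_norm (\<lambda>x. f x - analysis f F x))\<^sup>2 < \<epsilon>"
    using analysis_error[OF F(1,2) f] by simp
  then show ?thesis using analysis_props(1)[OF F(1,2) f] by blast
qed

text \<open>Against an element of \<open>V\<close> only the part of \<open>f\<close> seen by the
  frame matters. The element \<open>g\<close> is replaced by a partial sum of its expansion, for
  which Cauchy-Schwarz applies to the two coefficient families.\<close>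

lemma inner_le_energy:
  assumes f: "f \<in> L2" and g: "g \<in> V"
  shows "cmod (L2_inner f g) \<le> sqrt (energy f) * L2_norm g"
proof (rule field_le_epsilon)
  fix \<delta> :: real assume "\<delta> > 0"
  note gL = V_L2[OF g]
  \<comment> \<open>Chosen so that the norm of \<open>f\<close> times \<epsilon> is at most
    \<delta>; adding 1 keeps the denominator positive.\<close>
  define \<epsilon> where "\<epsilon> = \<delta> / (L2_norm f + 1)"
  have \<epsilon>: "\<epsilon> > 0" "L2_norm f * \<epsilon> \<le> \<delta>"
    using \<open>\<delta> > 0\<close> L2_norm_nonneg[of f] add_nonneg_pos[OF L2_norm_nonneg[of f] zero_less_one]
    by (simp_all add: \<epsilon>_def divide_le_eq mult_left_mono algebra_simps)
  have "energy g = (L2_norm g)\<^sup>2"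
    using infsumI[OF parseval[OF g]] by (simp add: energy_def)
  then obtain F where F: "finite F" "F \<subseteq> J" "(L2_norm g)\<^sup>2 - \<epsilon>\<^sup>2 < (\<Sum>i\<in>F. (cmod (L2_inner g (e i)))\<^sup>2)"
    using energy_approx[OF gL, of "\<epsilon>\<^sup>2"] \<epsilon>(1) by auto
  note a = analysis_props[OF F(1,2) gL]
  have "(L2_norm (\<lambda>x. g x - analysis g F x))\<^sup>2 \<le> \<epsilon>\<^sup>2"
    using analysis_error[OF F(1,2) gL] F(3) by simp
  then have d: "L2_norm (\<lambda>x. g x - analysis g F x) \<le> \<epsilon>"
    by (rule power2_le_imp_le) (use \<epsilon> in simp)
  have "cmod (L2_inner f (\<lambda>x. g x - analysis g F x)) \<le> L2_norm f * L2_norm (\<lambda>x. g x - analysis g F x)"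
    by (intro L2_Cauchy_Schwarz f L2_diff gL V_L2[OF a(1)])
  also have "\<dots> \<le> L2_norm f * \<epsilon>" by (rule mult_left_mono[OF d]) simp
  finally have 1: "cmod (L2_inner f (\<lambda>x. g x - analysis g F x)) \<le> \<delta>" using \<epsilon>(2) by simp
  have "cmod (L2_inner f (analysis g F)) = cmod (\<Sum>i\<in>F. L2_inner f (e i) * cnj (L2_inner g (e i)))"
    unfolding analysis_def inner_synthesis[OF F(2) f] by (simp add: mult.commute)
  also have "\<dots> \<le> sqrt (\<Sum>i\<in>F. (cmod (L2_inner f (e i)))\<^sup>2) * sqrt (\<Sum>i\<in>F. (cmod (L2_inner g (e i)))\<^sup>2)"
    using sum_sqrt_Cauchy_Schwarz[of "\<lambda>i. L2_inner f (e i)" "\<lambda>i. cnj (L2_inner g (e i))" F] by simp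
  also have "\<dots> \<le> sqrt (energy f) * L2_norm g"
  proof (intro mult_mono real_sqrt_le_mono)
    show "(\<Sum>i\<in>F. (cmod (L2_inner f (e i)))\<^sup>2) \<le> energy f"
      by (rule finite_sum_le_has_sum[OF energy_has_sum[OF f] F(1,2)]) simp
    show "sqrt (\<Sum>i\<in>F. (cmod (L2_inner g (e i)))\<^sup>2) \<le> L2_norm g"
      using bessel[OF F(1,2) gL] by (intro real_le_lsqrt) auto
  qed (auto simp: energy_nonneg sum_nonneg)
  finally have 2: "cmod (L2_inner f (analysis g F)) \<le> sqrt (energy f) * L2_norm g" .
  have "L2_inner f g = L2_inner f (\<lambda>x. g x - analysis g F x) + L2_inner f (analysis g F)"
    by (simp add: L2_inner_diff_right f gL V_L2[OF a(1)])
  then show "cmod (L2_inner f g) \<le> sqrt (energy f) * L2_norm g + \<delta>"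
    using norm_triangle_ineq[of "L2_inner f (\<lambda>x. g x - analysis g F x)" "L2_inner f (analysis g F)"] 1 2 by simp
qed

end

text \<open>A partial energy \<open>S\<close> of \<open>f\<close> is the inner product of
  \<open>f\<close> with its own partial sum, an element of the larger space of norm at most sqrt S.
  Hence S is at most sqrt S times the root of the larger energy.\<close>

lemma energy_mono:
  assumes "parseval_frame J e V" "parseval_frame J' e' V'" "V \<subseteq> V'" and f: "f \<in> L2"
  shows "parseval_frame.energy J e f \<le> parseval_frame.energy J' e' f"
proof -
  interpret a: parseval_frame J e V by fact
  interpret b: parseval_frame J' e' V' by fact
  show ?thesis
  proof (rule has_sum_le_finite_sums[OF a.energy_has_sum[OF f]])
    fix F assume F: "finite F" "F \<subseteq> J"
    let ?S = "\<Sum>i\<in>F. (cmod (L2_inner f (e i)))\<^sup>2"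
    note p = a.analysis_props[OF F f]
    have S0: "0 \<le> ?S" by (simp add: sum_nonneg)
    have "?S \<le> sqrt (b.energy f) * L2_norm (a.analysis f F)"
      using b.inner_le_energy[OF f subsetD[OF assms(3) p(1)]] S0 unfolding p(2) norm_of_real by simp
    also have "\<dots> \<le> sqrt (b.energy f) * sqrt ?S"
      using p(3) by (intro mult_left_mono real_le_rsqrt) (auto simp: b.energy_nonneg)
    finally have "sqrt ?S * sqrt ?S \<le> sqrt (b.energy f) * sqrt ?S" using S0 by simp
    then have "sqrt ?S \<le> sqrt (b.energy f)"
      by (rule le_of_mult_self_le) (simp_all add: S0 b.energy_nonneg)
    then show "?S \<le> b.energy f" by simp
  qed
qed

lemma dilation_op_inner:
  fixes L :: "real ^ 'n \<Rightarrow> real ^ 'n"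
  assumes L: "linear L" "bij L" and f: "f \<in> L2" and g: "g \<in> L2"
  shows "L2_inner (dilation_op L f) (dilation_op L g) = L2_inner f g"
proof -
  let ?d = "\<bar>det (matrix L)\<bar>"
  have "dilation_op L f x * cnj (dilation_op L g x) = of_real ?d * (f (L x) * cnj (g (L x)))" for x
    unfolding dilation_op_def complex_cnj_mult complex_cnj_complex_of_real
    by (simp add: mult_ac flip: of_real_mult)
  then have "L2_inner (dilation_op L f) (dilation_op L g) = of_real ?d * (LINT x|lebesgue. f (L x) * cnj (g (L x)))"
    by (simp add: L2_inner_def)
  also have "(LINT x|lebesgue. f (L x) * cnj (g (L x))) = inverse ?d *\<^sub>R L2_inner f g"
    unfolding L2_inner_def using f g
    by (intro integral_linear[OF L, of "\<lambda>x. f x * cnj (g x)"]) (auto intro!: borel_measurable_times cnj_measurable L2_measurable)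
  finally show ?thesis using linear_bij_inv(3)[OF L] by (simp add: scaleR_conv_of_real)
qed

lemma dilation_op_comp:
  fixes L M :: "real ^ 'n \<Rightarrow> real ^ 'n"
  assumes "linear L" "linear M" shows "dilation_op M (dilation_op L f) = dilation_op (L \<circ> M) f"
  using assms by (simp add: dilation_op_def fun_eq_iff matrix_compose det_mul abs_mult real_sqrt_mult mult_ac)

lemma dilation_op_id: "dilation_op id f = f"
  by (simp add: dilation_op_def matrix_id_mat_1)

lemma dilation_op_inv:
  fixes L :: "real ^ 'n \<Rightarrow> real ^ 'n"
  assumes L: "linear L" "bij L"
  shows "dilation_op L (dilation_op (inv L) f) = f" "dilation_op (inv L) (dilation_op L f) = f"
    "inv (dilation_op L) = dilation_op (inv L)"
proof -
  show 1: "dilation_op L (dilation_op (inv L) f) = f" "dilation_op (inv L) (dilation_op L f) = f" for f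
    using L linear_bij_inv(1)[OF L] dilation_op_id[of f]
    by (simp_all add: dilation_op_comp bij_is_inj surj_iff[THEN iffD1, OF bij_is_surj])
  show "inv (dilation_op L) = dilation_op (inv L)"
    by (rule inv_equality) (use 1 in auto)
qed

lemma parseval_frame_dilation:
  fixes L :: "real ^ 'n \<Rightarrow> real ^ 'n"
  assumes L: "linear L" "bij L" and F: "parseval_frame J e V"
  shows "parseval_frame J (\<lambda>i. dilation_op L (e i)) (dilation_op L ` V)"
proof -
  interpret a: parseval_frame J e V by fact
  note s = a.subspace
  show ?thesis
  proof
    show "L2_subspace (dilation_op L ` V)"
      unfolding L2_subspace_def
    proof (intro conjI ballI allI)
      show "dilation_op L ` V \<subseteq> L2" using a.V_L2 dilation_op_L2(1)[OF L] by auto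
      have "(\<lambda>x. 0) = dilation_op L (\<lambda>x. 0)" by (simp add: dilation_op_def)
      then show "(\<lambda>x. 0) \<in> dilation_op L ` V" using s by (auto simp: L2_subspace_def)
    next
      fix f g assume "f \<in> dilation_op L ` V" "g \<in> dilation_op L ` V"
      then obtain f' g' where fg: "f' \<in> V" "g' \<in> V" "f = dilation_op L f'" "g = dilation_op L g'" by auto
      have "(\<lambda>x. f x + g x) = dilation_op L (\<lambda>x. f' x + g' x)"
        unfolding fg by (simp add: dilation_op_def distrib_left)
      then show "(\<lambda>x. f x + g x) \<in> dilation_op L ` V" using s fg by (auto simp: L2_subspace_def)
    next
      fix c f assume "f \<in> dilation_op L ` V"
      then obtain f' where fg: "f' \<in> V" "f = dilation_op L f'" by auto
      have "(\<lambda>x. c * f x) = dilation_op L (\<lambda>x. c * f' x)"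
        unfolding fg by (simp add: dilation_op_def mult_ac)
      then show "(\<lambda>x. c * f x) \<in> dilation_op L ` V" using s fg by (auto simp: L2_subspace_def)
    qed
    show "dilation_op L (e i) \<in> dilation_op L ` V" if "i \<in> J" for i using a.mem[OF that] by simp
    fix f assume "f \<in> dilation_op L ` V"
    then obtain f' where f: "f' \<in> V" "f = dilation_op L f'" by auto
    have "(cmod (L2_inner f (dilation_op L (e i))))\<^sup>2 = (cmod (L2_inner f' (e i)))\<^sup>2" if "i \<in> J" for i
      unfolding f(2) by (simp add: dilation_op_inner[OF L] a.V_L2 f(1) a.e_L2 that)
    then show "((\<lambda>i. (cmod (L2_inner f (dilation_op L (e i))))\<^sup>2) has_sum (L2_norm f)\<^sup>2) J"
      using a.parseval[OF f(1)] unfolding f(2) dilation_op_L2(2)[OF L a.V_L2[OF f(1)]]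
      by (simp cong: has_sum_cong)
  qed
qed

section \<open>Expansive dilations\<close>

text \<open>Horner's scheme for a matrix polynomial applied to a fixed vector, so that only vectors,
  and no polynomials with matrix values, have to be handled.\<close>

primrec list_apply :: "complex ^ 'n ^ 'n \<Rightarrow> complex list \<Rightarrow> complex ^ 'n \<Rightarrow> complex ^ 'n" where
  "list_apply M [] v = 0"
| "list_apply M (a # as) v = a *s v + M *v list_apply M as v"

definition poly_apply :: "complex ^ 'n ^ 'n \<Rightarrow> complex poly \<Rightarrow> complex ^ 'n \<Rightarrow> complex ^ 'n" where
  "poly_apply M p = list_apply M (coeffs p)"

lemma poly_apply_0 [simp]: "poly_apply M 0 v = 0"
  by (simp add: poly_apply_def)

lemma poly_apply_pCons: "poly_apply M (pCons a p) v = a *s v + M *v poly_apply M p v"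
  by (simp add: poly_apply_def cCons_def)

lemma poly_apply_add: "poly_apply M (p + q) v = poly_apply M p v + poly_apply M q v"
  by (induction p q rule: poly_induct2)
     (simp_all add: poly_apply_pCons matrix_vector_right_distrib vector_sadd_rdistrib)

lemma poly_apply_smult: "poly_apply M (smult c p) v = c *s poly_apply M p v"
  by (induction p) (simp_all add: poly_apply_pCons vector_add_ldistrib vector_scalar_commute)

lemma poly_apply_sum: "poly_apply M (\<Sum>i\<in>F. p i) v = (\<Sum>i\<in>F. poly_apply M (p i) v)"
  by (induction F rule: infinite_finite_induct) (simp_all add: poly_apply_add)

lemma poly_apply_monom: "poly_apply M (monom c i) v = c *s ((*v) M ^^ i) v"
  by (induction i) (simp_all add: monom_0 monom_Suc poly_apply_pCons vector_scalar_commute)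

lemma poly_apply_shift: "poly_apply M p (M *v v) = M *v poly_apply M p v"
  by (induction p) (simp_all add: poly_apply_pCons matrix_vector_right_distrib vector_scalar_commute)

lemma poly_apply_scale: "poly_apply M p (c *s v) = c *s poly_apply M p v"
  by (induction p) (simp_all add: poly_apply_pCons vector_add_ldistrib vector_scalar_commute mult.commute)

lemma poly_apply_diff: "poly_apply M p (v - w) = poly_apply M p v - poly_apply M p w"
  by (induction p) (simp_all add: poly_apply_pCons matrix_vector_mult_diff_distrib vector_ssub_ldistrib)

lemma poly_apply_linear_factor:
  "poly_apply M ([:- c, 1:] * q) v = M *v poly_apply M q v - c *s poly_apply M q v"
proof -
  have "[:- c, 1:] * q = smult (- c) q + pCons 0 q" by simp
  then show ?thesis by (simp only: poly_apply_add poly_apply_smult poly_apply_pCons) (simp add: vec.scale_minus_left)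
qed

text \<open>One iterate more than the dimension forces a linear relation. Dependence is a property
  of the set of iterates, so a repetition among them is a separate case, with the difference of two
  monomials as witness.\<close>

lemma annihilating_poly:
  fixes M :: "complex ^ 'n ^ 'n"
  shows "\<exists>p. p \<noteq> 0 \<and> poly_apply M p v = 0"
proof -
  let ?x = "\<lambda>i. ((*v) M ^^ i) v" let ?N = "CARD('n)"
  show ?thesis
  proof (cases "inj_on ?x {..?N}")
    case False
    then obtain i j where ij: "i \<noteq> j" "?x i = ?x j" by (auto simp: inj_on_def)
    have "poly_apply M (monom 1 i + monom (-1) j) v = 0"
      unfolding poly_apply_add poly_apply_monom ij(2) by (simp add: vector_sneg_minus1[symmetric])
    moreover have "coeff (monom 1 i + monom (-1::complex) j) i \<noteq> 0" using ij(1) by simp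
    ultimately show ?thesis by (metis coeff_0)
  next
    case True
    have "card (?x ` {..?N}) > vec.dim (UNIV :: (complex ^ 'n) set)"
      by (simp add: card_image[OF True] vec.dim_UNIV card_cart_basis)
    then have "vec.dependent (?x ` {..?N})"
      using vec.dependent_biggerset_general[of "?x ` {..?N}"] vec.dim_subset[of "?x ` {..?N}" UNIV] by simp
    then obtain u where u: "\<exists>w\<in>?x ` {..?N}. u w \<noteq> 0" "(\<Sum>w\<in>?x ` {..?N}. u w *s w) = 0"
      using vec.dependent_finite[of "?x ` {..?N}"] by auto
    let ?p = "\<Sum>i\<le>?N. monom (u (?x i)) i"
    have "poly_apply M ?p v = (\<Sum>i\<le>?N. u (?x i) *s ?x i)"
      by (simp add: poly_apply_sum poly_apply_monom)
    also have "\<dots> = 0" using u(2) by (simp add: sum.reindex[OF True])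
    finally have p0: "poly_apply M ?p v = 0" .
    obtain i where "i \<le> ?N" "u (?x i) \<noteq> 0" using u(1) by auto
    then have "coeff ?p i \<noteq> 0" by (simp add: coeff_sum)
    then have "?p \<noteq> 0" by (rule contrapos_nn) (simp only: coeff_0)
    with p0 show ?thesis by blast
  qed
qed

text \<open>Once \<open>b\<close> is below (1 - q) d, the value \<open>d\<close> is stable under the
  recursion and the excess over it decays like q^k.\<close>

lemma contraction_perturbation_tendsto_0:
  fixes a b :: "nat \<Rightarrow> real"
  assumes q: "0 \<le> q" "q < 1" and a: "\<And>j. 0 \<le> a j" "\<And>j. a (Suc j) \<le> q * a j + b j" and b: "b \<longlonglongrightarrow> 0"
  shows "a \<longlonglongrightarrow> 0"
proof (rule LIMSEQ_I)
  fix \<epsilon> :: real assume \<epsilon>: "\<epsilon> > 0"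
  define d where "d = \<epsilon> / 2"
  have d: "d > 0" using \<epsilon> by (simp add: d_def)
  have "(1 - q) * d > 0" using q d by simp
  then obtain N where N: "\<And>j. j \<ge> N \<Longrightarrow> b j < (1 - q) * d"
    using order_tendstoD(2)[OF b] by (auto simp: eventually_sequentially)
  have bd: "a (N + k) \<le> q ^ k * a N + d" for k
  proof (induction k)
    case (Suc k)
    have "a (N + Suc k) \<le> q * a (N + k) + (1 - q) * d" using a(2)[of "N + k"] N[of "N + k"] by simp
    also have "\<dots> \<le> q * (q ^ k * a N + d) + (1 - q) * d" using Suc q by (simp add: mult_left_mono)
    finally show ?case by (simp add: algebra_simps)
  qed (use d in simp)
  have "(\<lambda>k. q ^ k * a N) \<longlonglongrightarrow> 0"
    using q by (intro tendsto_mult_left_zero LIMSEQ_power_zero) simp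
  then obtain K where K: "\<And>k. k \<ge> K \<Longrightarrow> q ^ k * a N < d"
    using order_tendstoD(2)[of _ 0 sequentially d] d by (auto simp: eventually_sequentially)
  have "norm (a n - 0) < \<epsilon>" if "n \<ge> N + K" for n
  proof -
    have "q ^ (n - N) * a N < d" by (rule K) (use that in simp)
    moreover have "a n \<le> q ^ (n - N) * a N + d" using bd[of "n - N"] that by simp
    ultimately show ?thesis using a(1)[of n] by (simp add: d_def)
  qed
  then show "\<exists>no. \<forall>n\<ge>no. norm (a n - 0) < \<epsilon>" by blast
qed

lemma norm_vector_scalar_mult: "norm (c *s (v :: complex ^ 'n)) = cmod c * norm v"
  by (simp add: norm_vec_def norm_mult L2_set_right_distrib)

text \<open>Induction on the degree of an annihilating polynomial: a root that is not an eigenvalue can be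
  dropped, and an eigenvalue contributes a contraction because its modulus is less than \<open>1\<close>.\<close>

lemma matrix_powers_tendsto_0_aux:
  fixes M :: "complex ^ 'n ^ 'n"
  assumes ev: "\<And>c v. v \<noteq> 0 \<Longrightarrow> M *v v = c *s v \<Longrightarrow> cmod c < 1"
    and "p \<noteq> 0" "poly_apply M p v = 0"
  shows "(\<lambda>j. ((*v) M ^^ j) v) \<longlonglongrightarrow> 0"
  using assms(2,3)
proof (induction "degree p" arbitrary: p v)
  case 0
  then obtain c where c: "p = [:c:]" by (metis degree_eq_zeroE)
  then have "c \<noteq> 0" "c *s v = 0" using 0 by (auto simp: poly_apply_pCons)
  then have "v = 0" by simp
  moreover have "((*v) M ^^ j) 0 = 0" for j by (induction j) auto
  ultimately show ?case by simp
next
  case (Suc n)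
  have "\<not> constant (poly p)" using Suc(2) by (simp add: constant_degree)
  then obtain c where "poly p c = 0" using fundamental_theorem_of_algebra by blast
  then obtain q where q: "p = [:- c, 1:] * q" using poly_eq_0_iff_dvd by (metis dvdE)
  have q0: "q \<noteq> 0" using q Suc(3) by auto
  have dq: "n = degree q" using Suc(2) q0 unfolding q by (subst (asm) degree_mult_eq) auto
  show ?case
  proof (cases "poly_apply M q v = 0")
    case True
    show ?thesis by (rule Suc(1)[OF dq q0 True])
  next
    case False
    have "M *v poly_apply M q v = c *s poly_apply M q v"
      using Suc(4) unfolding q poly_apply_linear_factor by simp
    then have c: "cmod c < 1" using ev[OF False] by blast
    \<comment> \<open>The linear factor is moved from the polynomial to the vector:
      \<open>?w\<close> is annihilated by \<open>q\<close>, so its iterates tend to 0 by induction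
      and act as the perturbation in the recursion for the iterates of \<open>v\<close>.\<close>
    let ?w = "M *v v - c *s v"
    have "poly_apply M q ?w = 0"
      using Suc(4) unfolding q poly_apply_linear_factor by (simp add: poly_apply_diff poly_apply_shift poly_apply_scale)
    then have w: "(\<lambda>j. ((*v) M ^^ j) ?w) \<longlonglongrightarrow> 0" by (rule Suc(1)[OF dq q0])
    have st: "((*v) M ^^ j) (a + b *s x) = ((*v) M ^^ j) a + b *s ((*v) M ^^ j) x" for j a b and x :: "complex^'n"
      by (induction j) (simp_all add: matrix_vector_right_distrib vector_scalar_commute)
    have step: "((*v) M ^^ Suc j) v = ((*v) M ^^ j) ?w + c *s ((*v) M ^^ j) v" for j
    proof -
      have "((*v) M ^^ Suc j) v = ((*v) M ^^ j) (?w + c *s v)" by (simp add: funpow_swap1)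
      then show ?thesis by (simp only: st)
    qed
    have "(\<lambda>j. norm (((*v) M ^^ j) v)) \<longlonglongrightarrow> 0"
    proof (rule contraction_perturbation_tendsto_0[of "cmod c" _ "\<lambda>j. norm (((*v) M ^^ j) ?w)"])
      show "norm (((*v) M ^^ Suc j) v) \<le> cmod c * norm (((*v) M ^^ j) v) + norm (((*v) M ^^ j) ?w)" for j
        unfolding step using norm_triangle_ineq[of "((*v) M ^^ j) ?w" "c *s ((*v) M ^^ j) v"]
        by (simp add: norm_vector_scalar_mult)
      show "(\<lambda>j. norm (((*v) M ^^ j) ?w)) \<longlonglongrightarrow> 0" using tendsto_norm[OF w] by simp
    qed (use c in auto)
    then show ?thesis by (rule tendsto_norm_zero_cancel)
  qed
qed

lemma matrix_powers_tendsto_0: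
  fixes M :: "complex ^ 'n ^ 'n"
  assumes "\<And>c v. v \<noteq> 0 \<Longrightarrow> M *v v = c *s v \<Longrightarrow> cmod c < 1"
  shows "(\<lambda>j. ((*v) M ^^ j) v) \<longlonglongrightarrow> 0"
proof -
  obtain p where "p \<noteq> 0" "poly_apply M p v = 0" using annihilating_poly[of M v] by blast
  then show ?thesis using matrix_powers_tendsto_0_aux[of M p v] assms by blast
qed

text \<open>Norm-preserving passage to complex space, where the hypothesis on eigenvalues can be
  applied to orbits of real vectors.\<close>

definition complexify :: "real ^ 'n \<Rightarrow> complex ^ 'n" where
  "complexify x = (\<chi> i. of_real (x $ i))"

lemma complexify_linear_map:
  assumes "linear L" shows "map_matrix complex_of_real (matrix L) *v complexify x = complexify (L x)"
proof -
  have "L x = matrix L *v x" using assms by simp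
  then show ?thesis by (simp add: vec_eq_iff complexify_def matrix_vector_mult_def)
qed

lemma map_matrix_mult:
  "map_matrix complex_of_real (A ** B) = map_matrix complex_of_real A ** map_matrix complex_of_real B"
  by (simp add: vec_eq_iff matrix_matrix_mult_def)

lemma map_matrix_one: "map_matrix complex_of_real (mat 1) = mat 1"
  by (simp add: vec_eq_iff mat_def)

text \<open>A kernel vector would make 0 an eigenvalue, and 0 does not have modulus above 1.\<close>

lemma expansive_bij:
  assumes "expansive_dilation A" shows "linear A" "bij A"
proof -
  show l: "linear A" using assms by (simp add: expansive_dilation_def)
  have "x = 0" if "A x = 0" for x
  proof (rule ccontr)
    assume "x \<noteq> 0"
    then have "complexify x \<noteq> 0" by (auto simp: complexify_def vec_eq_iff)
    moreover have "map_matrix complex_of_real (matrix A) *v complexify x = 0 *s complexify x"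
      unfolding complexify_linear_map[OF l] that by (simp add: complexify_def vec_eq_iff)
    ultimately have "complex_eigenvalue A 0" unfolding complex_eigenvalue_def by blast
    then have "cmod 0 > 1" using assms unfolding expansive_dilation_def by blast
    then show False by simp
  qed
  then have "inj A" using linear_injective_0[OF l] by blast
  then show "bij A" using linear_injective_imp_surjective[OF l] by (simp add: bij_def)
qed

text \<open>The eigenvalues of the inverse are reciprocals of eigenvalues of \<open>A\<close>, so
  they have modulus below 1.\<close>

lemma expansive_inv_tendsto_0:
  assumes A: "expansive_dilation A" shows "(\<lambda>j. (inv A ^^ j) x) \<longlonglongrightarrow> 0"
proof -
  note L = expansive_bij[OF A] note Li = linear_bij_inv(1)[OF L]
  let ?A = "map_matrix complex_of_real (matrix A)" let ?M = "map_matrix complex_of_real (matrix (inv A))"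
  have "A \<circ> inv A = id" using surj_iff[THEN iffD1, OF bij_is_surj[OF L(2)]] .
  then have "matrix A ** matrix (inv A) = mat 1"
    using matrix_compose[OF Li L(1)] by (simp add: matrix_id_mat_1)
  then have AM: "?A ** ?M = mat 1" by (simp flip: map_matrix_mult add: map_matrix_one)
  have M: "(\<lambda>j. ((*v) ?M ^^ j) (complexify x)) \<longlonglongrightarrow> 0"
  proof (rule matrix_powers_tendsto_0)
    fix c and v :: "complex^'a" assume v: "v \<noteq> 0" "?M *v v = c *s v"
    have "v = ?A *v (?M *v v)" using AM by (simp add: matrix_vector_mul_assoc)
    also have "\<dots> = c *s (?A *v v)" by (simp add: v(2) vector_scalar_commute)
    finally have e: "v = c *s (?A *v v)" .
    then have c: "c \<noteq> 0" using v(1) by auto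
    have "?A *v v = inverse c *s v" using c by (subst (2) e) simp
    then have "complex_eigenvalue A (inverse c)" using v(1) unfolding complex_eigenvalue_def by blast
    then have "cmod (inverse c) > 1" using A unfolding expansive_dilation_def by blast
    then show "cmod c < 1" using c one_less_inverse_iff[of "cmod c"] by (simp add: norm_inverse)
  qed
  have "((*v) ?M ^^ j) (complexify x) = complexify ((inv A ^^ j) x)" for j
    by (induction j) (simp_all add: complexify_linear_map[OF Li])
  with M have "(\<lambda>j. complexify ((inv A ^^ j) x)) \<longlonglongrightarrow> 0" by simp
  from tendsto_norm[OF this] have n: "(\<lambda>j. norm (complexify ((inv A ^^ j) x))) \<longlonglongrightarrow> 0" by simp
  have "norm (complexify y) = norm y" for y :: "real^'a"
    by (simp add: complexify_def norm_vec_def)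
  with n show ?thesis by (simp add: tendsto_norm_zero_iff)
qed

lemma funpow_linear_bij:
  fixes L :: "real ^ 'n \<Rightarrow> real ^ 'n"
  assumes L: "linear L" "bij L"
  shows "linear (L ^^ j)" "bij (L ^^ j)" "inv (L ^^ j) = inv L ^^ j" "adjoint (L ^^ j) = adjoint L ^^ j"
proof -
  show l: "linear (L ^^ j)"
  proof (induction j)
    case (Suc j) show ?case unfolding funpow.simps by (rule linear_compose[OF Suc L(1)])
  qed (simp add: linear_iff)
  show "bij (L ^^ j)" using L(2) by (rule bij_fn)
  show "inv (L ^^ j) = inv L ^^ j" using L(2) by (rule inv_fn)
  show "adjoint (L ^^ j) = adjoint L ^^ j"
  proof (rule adjoint_unique, intro allI)
    fix x y show "(L ^^ j) x \<bullet> y = x \<bullet> (adjoint L ^^ j) y"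
    proof (induction j arbitrary: x)
      case (Suc j)
      have "(L ^^ Suc j) x \<bullet> y = L x \<bullet> (adjoint L ^^ j) y" by (simp only: funpow_Suc_right o_apply Suc)
      then show ?case by (simp add: adjoint_works[OF L(1)])
    qed simp
  qed
qed

text \<open>The coordinates of an iterate of the inverse adjoint are inner products of
  \<open>x\<close> with iterates of \<open>inv A\<close> on the unit vectors. Convergence on
  finitely many vectors thus becomes a bound uniform in \<open>x\<close>, without a spectral
  argument for the adjoint.\<close>

lemma expansive_adjoint_inv_bound:
  fixes A :: "real ^ 'n \<Rightarrow> real ^ 'n"
  assumes A: "expansive_dilation A"
  shows "\<exists>\<eta>. \<eta> \<longlonglongrightarrow> 0 \<and> (\<forall>j x. norm ((inv (adjoint A) ^^ j) x) \<le> \<eta> j * norm x)"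
proof -
  note L = expansive_bij[OF A] note Li = linear_bij_inv(1,2)[OF L]
  define \<eta> where "\<eta> j = (\<Sum>i\<in>UNIV. norm ((inv A ^^ j) (axis i 1 :: real^'n)))" for j
  have "\<eta> \<longlonglongrightarrow> (\<Sum>i\<in>(UNIV::'n set). 0)"
    unfolding \<eta>_def using tendsto_norm[OF expansive_inv_tendsto_0[OF A]] by (intro tendsto_sum) auto
  moreover have "norm ((inv (adjoint A) ^^ j) x) \<le> \<eta> j * norm x" for j x
  proof -
    let ?y = "(inv (adjoint A) ^^ j) x"
    have "\<bar>?y $ i\<bar> \<le> norm ((inv A ^^ j) (axis i 1)) * norm x" for i
    proof -
      have "?y $ i = axis i 1 \<bullet> adjoint (inv A ^^ j) x"
        by (simp add: inner_axis' adjoint_bij(3)[OF L] funpow_linear_bij(4)[OF Li])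
      also have "\<dots> = (inv A ^^ j) (axis i 1) \<bullet> x"
        by (rule adjoint_works[OF funpow_linear_bij(1)[OF Li]])
      finally show ?thesis by (simp add: Cauchy_Schwarz_ineq2)
    qed
    then have "(\<Sum>i\<in>UNIV. \<bar>?y $ i\<bar>) \<le> \<eta> j * norm x"
      unfolding \<eta>_def sum_distrib_right by (rule sum_mono)
    with norm_le_l1_cart[of ?y] show ?thesis by linarith
  qed
  ultimately show ?thesis by (intro exI[of _ \<eta>]) simp
qed

section \<open>Frame energy of functions with small frequency support\<close>

text \<open>Tonelli's theorem with a counting measure. Integrability of the limit function is a
  conclusion, drawn from the finite total \<open>E\<close>.\<close>

lemma has_sum_nn_integral_swap:
  fixes b :: "'i \<Rightarrow> real ^ 'n \<Rightarrow> real"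
  assumes I: "countable I" and m: "\<And>i. i \<in> I \<Longrightarrow> b i \<in> borel_measurable lebesgue" and nn: "\<And>i x. 0 \<le> b i x"
    and B: "\<And>i. i \<in> I \<Longrightarrow> (\<integral>\<^sup>+x. ennreal (b i x) \<partial>lebesgue) = ennreal (\<beta> i)" "\<And>i. i \<in> I \<Longrightarrow> 0 \<le> \<beta> i"
    and sum: "(\<beta> has_sum E) I" and s: "AE x in lebesgue. ((\<lambda>i. b i x) has_sum s x) I" and sm: "s \<in> borel_measurable lebesgue"
  shows "integrable lebesgue s" "(LINT x|lebesgue. s x) = E" "0 \<le> E"
proof -
  interpret pair_sigma_finite "count_space I" "lebesgue :: (real^'n) measure"
    unfolding pair_sigma_finite_def
    by (simp add: sigma_finite_lebesgue sigma_finite_measure_count_space_countable I)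
  show E: "0 \<le> E" using sum B(2) by (rule has_sum_nonneg)
  have s0: "AE x in lebesgue. 0 \<le> s x" using s by eventually_elim (auto intro: has_sum_nonneg nn)
  have "ennreal E = (\<integral>\<^sup>+i. ennreal (\<beta> i) \<partial>count_space I)"
    using nn_integral_count_space_has_sum[OF sum I B(2)] by simp
  also have "\<dots> = (\<integral>\<^sup>+i. (\<integral>\<^sup>+x. ennreal (b i x) \<partial>lebesgue) \<partial>count_space I)"
    by (intro nn_integral_cong) (simp add: B)
  also have "\<dots> = (\<integral>\<^sup>+x. (\<integral>\<^sup>+i. ennreal (b i x) \<partial>count_space I) \<partial>lebesgue)"
  proof (rule Fubini'[symmetric])
    show "(\<lambda>(i, x). ennreal (b i x)) \<in> borel_measurable (count_space I \<Otimes>\<^sub>M lebesgue)"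
      by (rule measurable_pair_measure_countable1[OF I]) (use m in simp)
  qed
  also have "\<dots> = (\<integral>\<^sup>+x. ennreal (s x) \<partial>lebesgue)"
    using s by (intro nn_integral_cong_AE) (elim eventually_mono, rule nn_integral_count_space_has_sum[OF _ I nn])
  finally have I: "(\<integral>\<^sup>+x. ennreal (s x) \<partial>lebesgue) = ennreal E" ..
  have "(\<integral>\<^sup>+x. ennreal (norm (s x)) \<partial>lebesgue) = (\<integral>\<^sup>+x. ennreal (s x) \<partial>lebesgue)"
    using s0 by (intro nn_integral_cong_AE) (elim eventually_mono, simp)
  then show int: "integrable lebesgue s" using I sm by (simp add: integrable_iff_bounded)
  show "(LINT x|lebesgue. s x) = E"
    using nn_integral_eq_integral[OF int s0] I E integral_nonneg_AE[OF s0] by simp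
qed

lemma tight_frame_parseval_frame:
  assumes "shift_invariant V" "tight_frame_generator I \<phi> V"
  shows "parseval_frame (I \<times> int_lattice) (\<lambda>(\<alpha>, k). translate k (\<phi> \<alpha>)) V"
proof
  show "L2_subspace V" using assms(1) by (intro closed_subspace_L2_subspace) (simp add: shift_invariant_def)
  show "(case i of (\<alpha>, k) \<Rightarrow> translate k (\<phi> \<alpha>)) \<in> V" if "i \<in> I \<times> int_lattice" for i
    using that assms by (auto simp: tight_frame_generator_def shift_invariant_def)
  show "((\<lambda>i. (cmod (L2_inner f (case i of (\<alpha>, k) \<Rightarrow> translate k (\<phi> \<alpha>))))\<^sup>2) has_sum (L2_norm f)\<^sup>2) (I \<times> int_lattice)"
    if "f \<in> V" for f
    using assms(2) that unfolding tight_frame_generator_def split_beta by blast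
qed

lemma has_sum_int_lattice_minus:
  "((\<lambda>k. f (- k)) has_sum s) int_lattice \<longleftrightarrow> (f has_sum s) (int_lattice :: (real^'n) set)"
  by (rule has_sum_reindex_bij_betw[where g = uminus])
     (auto intro!: bij_betwI[of _ _ _ uminus] int_lattice_closed)

text \<open>For one generator the inner products with its shifts are, up to the sign of
  \<open>k\<close>, the Fourier coefficients of \<open>h\<close> times the conjugate of the
  generator's transform. Parseval on the cube sums them over \<open>k\<close>, and Tonelli sums over
  the generators to produce \<sigma>. The representative \<open>h\<close> has its bound and support
  everywhere, not just almost everywhere.\<close>

lemma energy_formula:
  fixes V :: "(real ^ 'n \<Rightarrow> complex) set"
  assumes V: "shift_invariant V" and I: "tight_frame_generator I \<phi> V"
    and \<sigma>: "AE \<xi> in lebesgue. ((\<lambda>\<alpha>. (cmod (fourier (\<phi> \<alpha>) \<xi>))\<^sup>2) has_sum \<sigma> \<xi>) I" "\<sigma> \<in> borel_measurable lebesgue"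
    and f: "f \<in> L2" "AE \<xi> in lebesgue. fourier f \<xi> = h \<xi>"
    and h: "h \<in> borel_measurable lebesgue" "\<And>\<xi>. cmod (h \<xi>) \<le> c" "\<And>\<xi>. h \<xi> \<noteq> 0 \<Longrightarrow> \<xi> \<in> cbox a (a + 1)"
  shows "integrable lebesgue (\<lambda>\<xi>. (cmod (h \<xi>))\<^sup>2 * \<sigma> \<xi>)"
    and "parseval_frame.energy (I \<times> int_lattice) (\<lambda>(\<alpha>, k). translate k (\<phi> \<alpha>)) f = (LINT \<xi>|lebesgue. (cmod (h \<xi>))\<^sup>2 * \<sigma> \<xi>)"
proof -
  interpret parseval_frame "I \<times> int_lattice" "\<lambda>(\<alpha>, k). translate k (\<phi> \<alpha>)" V
    by (rule tight_frame_parseval_frame[OF V I])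
  have \<phi>: "\<phi> \<alpha> \<in> L2" if "\<alpha> \<in> I" for \<alpha>
    using I that V_L2 by (auto simp: tight_frame_generator_def)
  let ?g = "\<lambda>\<alpha> \<xi>. h \<xi> * cnj (fourier (\<phi> \<alpha>) \<xi>)"
  have g: "?g \<alpha> \<in> L2" if "\<alpha> \<in> I" for \<alpha>
    by (rule L2_mult_bounded[OF L2_cnj[OF fourier_L2[OF \<phi>[OF that]]] h(1,2)])
  have coef: "L2_inner f (translate k (\<phi> \<alpha>)) = (LINT \<xi>|lebesgue. ?g \<alpha> \<xi> * cnj (character (- k) \<xi>))" if "\<alpha> \<in> I" for \<alpha> k
  proof -
    have t: "translate k (\<phi> \<alpha>) \<in> L2" by (rule translate_L2(1)[OF \<phi>[OF that]])
    have "L2_inner f (translate k (\<phi> \<alpha>)) = (LINT \<xi>|lebesgue. fourier f \<xi> * cnj (fourier (translate k (\<phi> \<alpha>)) \<xi>))"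
      using fourier_inner[OF f(1) t] by (simp add: L2_inner_def)
    also have "\<dots> = (LINT \<xi>|lebesgue. ?g \<alpha> \<xi> * cnj (character (- k) \<xi>))"
    proof (rule integral_cong_AE)
      show "AE \<xi> in lebesgue. fourier f \<xi> * cnj (fourier (translate k (\<phi> \<alpha>)) \<xi>) = ?g \<alpha> \<xi> * cnj (character (- k) \<xi>)"
        using f(2) fourier_translate[OF \<phi>[OF that], of k] by eventually_elim (simp add: character_minus)
    qed (intro borel_measurable_times cnj_measurable fourier_measurable f(1) t character_measurable h(1) \<phi>[OF that])+
    finally show ?thesis .
  qed
  have row: "((\<lambda>k. (cmod (L2_inner f (translate k (\<phi> \<alpha>))))\<^sup>2) has_sum (L2_norm (?g \<alpha>))\<^sup>2) int_lattice" if "\<alpha> \<in> I" for \<alpha>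
  proof -
    have "((\<lambda>k. (cmod (LINT \<xi>|lebesgue. ?g \<alpha> \<xi> * cnj (character k \<xi>)))\<^sup>2) has_sum (L2_norm (?g \<alpha>))\<^sup>2) int_lattice"
      by (rule cube_Parseval[OF g[OF that], where a=a]) (use h(3) in auto)
    then show ?thesis
      unfolding coef[OF that]
      by (subst has_sum_int_lattice_minus[of "\<lambda>k. (cmod (LINT \<xi>|lebesgue. ?g \<alpha> \<xi> * cnj (character k \<xi>)))\<^sup>2"])
  qed
  have sumE: "((\<lambda>\<alpha>. (L2_norm (?g \<alpha>))\<^sup>2) has_sum energy f) I"
    by (rule has_sum_SigmaD[OF energy_has_sum[OF f(1)]]) (use row in simp)
  have sumS: "AE \<xi> in lebesgue. ((\<lambda>\<alpha>. (cmod (?g \<alpha> \<xi>))\<^sup>2) has_sum (cmod (h \<xi>))\<^sup>2 * \<sigma> \<xi>) I"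
    using \<sigma>(1) by eventually_elim (simp add: norm_mult power_mult_distrib has_sum_cmult_right)
  have gm: "(\<lambda>\<xi>. (cmod (?g \<alpha> \<xi>))\<^sup>2) \<in> borel_measurable lebesgue" if "\<alpha> \<in> I" for \<alpha>
    using L2_measurable[OF g[OF that]] by measurable
  have sm: "(\<lambda>\<xi>. (cmod (h \<xi>))\<^sup>2 * \<sigma> \<xi>) \<in> borel_measurable lebesgue" using h(1) \<sigma>(2) by measurable
  note sw = has_sum_nn_integral_swap[OF _ gm _ L2_norm_ennreal[OF g, symmetric] _ sumE sumS sm]
  show "integrable lebesgue (\<lambda>\<xi>. (cmod (h \<xi>))\<^sup>2 * \<sigma> \<xi>)" by (rule sw(1)) auto
  show "energy f = (LINT \<xi>|lebesgue. (cmod (h \<xi>))\<^sup>2 * \<sigma> \<xi>)" by (rule sw(2)[symmetric]) auto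
qed

text \<open>Testing with the part of the exceptional set inside a ball shows that this part is null,
  and a locally negligible set is negligible.\<close>

lemma AE_le_of_local_integrals:
  fixes u v :: "real ^ 'n \<Rightarrow> real"
  assumes m: "u \<in> borel_measurable lebesgue" "v \<in> borel_measurable lebesgue" and r: "r > 0"
    and int: "\<And>m S. S \<in> sets lebesgue \<Longrightarrow> S \<subseteq> ball m r \<Longrightarrow>
      integrable lebesgue (\<lambda>x. indicator S x * u x) \<and> integrable lebesgue (\<lambda>x. indicator S x * v x) \<and>
      (LINT x|lebesgue. indicator S x * u x) \<le> (LINT x|lebesgue. indicator S x * v x)"
  shows "AE x in lebesgue. u x \<le> v x"
proof -
  let ?N = "{x. v x < u x}"
  have N: "?N \<in> sets lebesgue" using borel_measurable_less[OF m(2,1)] by simp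
  have "negligible (?N \<inter> ball m r)" for m
  proof -
    let ?S = "?N \<inter> ball m r"
    have S: "?S \<in> sets lebesgue" using N by auto
    let ?w = "\<lambda>x. indicator ?S x * u x - indicator ?S x * v x"
    have w0: "AE x in lebesgue. 0 \<le> ?w x" by (rule AE_I2) (auto simp: indicator_def)
    have i: "integrable lebesgue ?w" "(LINT x|lebesgue. ?w x) \<le> 0"
      using int[OF S, of m] by simp_all
    then have "(LINT x|lebesgue. ?w x) = 0" using integral_nonneg_AE[OF w0] by linarith
    then have "AE x in lebesgue. ?w x = 0" using integral_nonneg_eq_0_iff_AE[OF i(1) w0] by simp
    then have "AE x in lebesgue. x \<notin> ?S" by eventually_elim (auto simp: indicator_def)
    then show ?thesis using S by (simp add: negligible_iff_null_sets AE_iff_null_sets)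
  qed
  then have "negligible ?N"
    unfolding locally_negligible_alt[of ?N] using r
    by (intro ballI) (rule_tac x="?N \<inter> ball x r" in exI, auto simp: openin_open_Int)
  then have "AE x in lebesgue. x \<notin> ?N" by (intro AE_not_in) (simp add: negligible_iff_null_sets)
  then show ?thesis by eventually_elim simp
qed

section \<open>Monotonicity and dichotomy of the spectral function\<close>

locale refinable_space =
  fixes A :: "real ^ 'n \<Rightarrow> real ^ 'n" and V :: "(real ^ 'n \<Rightarrow> complex) set"
    and \<sigma> :: "real ^ 'n \<Rightarrow> real" and I :: "nat set" and \<phi> :: "nat \<Rightarrow> real ^ 'n \<Rightarrow> complex"
  assumes A: "expansive_dilation A" and V: "shift_invariant V" and refine: "refinable A V"
    and frame: "tight_frame_generator I \<phi> V" and \<sigma>m [measurable]: "\<sigma> \<in> borel_measurable lebesgue"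
    and \<sigma>: "AE \<xi> in lebesgue. ((\<lambda>\<alpha>. (cmod (fourier (\<phi> \<alpha>) \<xi>))\<^sup>2) has_sum \<sigma> \<xi>) I"
begin

definition contract :: "nat \<Rightarrow> real ^ 'n \<Rightarrow> real ^ 'n" where
  "contract j = inv (adjoint A) ^^ j"

text \<open>The density that represents the energy at scale \<open>j\<close>, in the way \<sigma>
  does at scale 0.\<close>

definition spectral :: "nat \<Rightarrow> real ^ 'n \<Rightarrow> real" where
  "spectral j \<xi> = \<sigma> (contract j \<xi>)"

lemmas A_bij = expansive_bij[OF A]
lemmas B_bij = adjoint_bij[OF A_bij]
lemmas Binv = linear_bij_inv[OF B_bij(1,2)]

lemma contract_bij: "linear (contract j)" "bij (contract j)"
  unfolding contract_def by (rule funpow_linear_bij[OF Binv(1,2)])+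

lemma contract_measurable [measurable]: "contract j \<in> lebesgue \<rightarrow>\<^sub>M lebesgue"
  by (rule linear_measurable_lebesgue[OF contract_bij])

lemma spectral_measurable [measurable]: "spectral j \<in> borel_measurable lebesgue"
  unfolding spectral_def[abs_def] by measurable

lemma contract_add: "contract i (contract j \<xi>) = contract (i + j) \<xi>"
  by (simp add: contract_def funpow_add)

lemma spectral_contract: "spectral i (contract j \<xi>) = spectral (i + j) \<xi>"
  by (simp add: spectral_def contract_add)

lemma contract_0 [simp]: "contract 0 \<xi> = \<xi>" "contract j 0 = 0"
  by (simp_all add: contract_def linear_0[OF contract_bij(1)[unfolded contract_def]])

lemma spectral_0 [simp]: "spectral 0 = \<sigma>"
  by (simp add: spectral_def fun_eq_iff)

text \<open>Uniformity over the ball matters: the whole support of a truncation has to enter the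
  cube at one common index.\<close>

lemma contract_small:
  assumes "\<delta> > 0" shows "\<exists>N. \<forall>j\<ge>N. \<forall>x. norm x \<le> R \<longrightarrow> norm (contract j x) < \<delta>"
proof -
  obtain \<eta> where \<eta>: "\<eta> \<longlonglongrightarrow> 0" "\<And>j x. norm (contract j x) \<le> \<eta> j * norm x"
    using expansive_adjoint_inv_bound[OF A] by (auto simp: contract_def)
  have "(\<lambda>j. \<bar>\<eta> j\<bar> * \<bar>R\<bar>) \<longlonglongrightarrow> 0" using \<eta>(1) by (intro tendsto_mult_left_zero tendsto_rabs_zero)
  then obtain N where N: "\<And>j. j \<ge> N \<Longrightarrow> \<bar>\<eta> j\<bar> * \<bar>R\<bar> < \<delta>"
    using order_tendstoD(2)[of _ 0 sequentially \<delta>] assms by (auto simp: eventually_sequentially)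
  have "norm (contract j x) < \<delta>" if "j \<ge> N" "norm x \<le> R" for j x
  proof -
    have "norm (contract j x) \<le> \<bar>\<eta> j\<bar> * \<bar>R\<bar>"
      using \<eta>(2)[of j x] mult_mono[of "\<eta> j" "\<bar>\<eta> j\<bar>" "norm x" "\<bar>R\<bar>"] that(2) abs_ge_self[of "\<eta> j"] by simp
    with N[OF that(1)] show ?thesis by simp
  qed
  then show ?thesis by blast
qed

abbreviation frame_elt :: "nat \<times> (real ^ 'n) \<Rightarrow> real ^ 'n \<Rightarrow> complex" where
  "frame_elt \<equiv> \<lambda>(\<alpha>, k). translate k (\<phi> \<alpha>)"

abbreviation scaled_energy :: "nat \<Rightarrow> (real ^ 'n \<Rightarrow> complex) \<Rightarrow> real" where
  "scaled_energy j \<equiv> parseval_frame.energy (I \<times> int_lattice) (\<lambda>i. dilation_op (A ^^ j) (frame_elt i))"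

lemmas base_frame = tight_frame_parseval_frame[OF V frame]

lemma scaled_frame:
  "parseval_frame (I \<times> int_lattice) (\<lambda>i. dilation_op (A ^^ j) (frame_elt i)) (dilation_op (A ^^ j) ` V)"
  by (rule parseval_frame_dilation[OF funpow_linear_bij(1,2)[OF A_bij] base_frame])

lemma scaled_spaces_mono: "i \<le> j \<Longrightarrow> dilation_op (A ^^ i) ` V \<subseteq> dilation_op (A ^^ j) ` V"
proof (rule lift_Suc_mono_le[of "\<lambda>i. dilation_op (A ^^ i) ` V"])
  fix n
  have "dilation_op (A ^^ n) ` V \<subseteq> dilation_op (A ^^ n) ` (dilation_op A ` V)"
    using refine by (intro image_mono) (simp add: refinable_def)
  also have "\<dots> = dilation_op (A ^^ Suc n) ` V"
    by (simp add: image_image dilation_op_comp[OF A_bij(1) funpow_linear_bij(1)[OF A_bij]])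
  finally show "dilation_op (A ^^ n) ` V \<subseteq> dilation_op (A ^^ Suc n) ` V" .
qed

lemma V_scaled: "V \<subseteq> dilation_op (A ^^ j) ` V"
proof -
  have "dilation_op (A ^^ 0) = id" by (auto simp: dilation_op_id fun_eq_iff[of _ id] simp flip: id_def)
  then show ?thesis using scaled_spaces_mono[of 0 j] by simp
qed

lemma V_L2: "V \<subseteq> L2"
  using V by (simp add: shift_invariant_def closed_subspace_def)

lemma scaled_energy_mono: "f \<in> L2 \<Longrightarrow> i \<le> j \<Longrightarrow> scaled_energy i f \<le> scaled_energy j f"
  by (rule energy_mono[OF scaled_frame scaled_frame scaled_spaces_mono])

lemma inv_contract: "inv (contract j) = adjoint A ^^ j" "adjoint A ^^ j = adjoint (A ^^ j)"
proof -
  show "inv (contract j) = adjoint A ^^ j"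
    unfolding contract_def funpow_linear_bij(3)[OF Binv(1,2)] inv_inv_eq[OF B_bij(2)] ..
  show "adjoint A ^^ j = adjoint (A ^^ j)" using funpow_linear_bij(4)[OF A_bij] by simp
qed

lemma contract_inverse:
  "contract j ((adjoint A ^^ j) \<xi>) = \<xi>" "(adjoint A ^^ j) (contract j \<xi>) = \<xi>"
  using contract_bij(2)[of j] by (simp_all flip: inv_contract(1) add: surj_f_inv_f bij_is_surj bij_is_inj)

text \<open>Dilation is unitary, so the energy of \<open>f\<close> at scale \<open>j\<close> is the
  base energy of the back-dilated \<open>f'\<close>. Its transform is \<open>h\<close> composed with
  the \<open>j\<close>-th power of the adjoint, and the normalizing determinant cancels in the
  change of variables.\<close>

lemma scaled_energy_formula:
  assumes f: "f \<in> L2" "AE \<xi> in lebesgue. fourier f \<xi> = h \<xi>"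
    and h: "h \<in> borel_measurable lebesgue" "\<And>\<xi>. cmod (h \<xi>) \<le> c" "\<And>\<xi>. h \<xi> \<noteq> 0 \<Longrightarrow> contract j \<xi> \<in> cbox a (a + 1)"
  shows "integrable lebesgue (\<lambda>\<xi>. (cmod (h \<xi>))\<^sup>2 * spectral j \<xi>)"
    and "scaled_energy j f = (LINT \<xi>|lebesgue. (cmod (h \<xi>))\<^sup>2 * spectral j \<xi>)"
proof -
  let ?L = "A ^^ j" let ?M = "inv ?L" let ?B = "adjoint A ^^ j"
  note L = funpow_linear_bij(1,2)[OF A_bij, of j] note M = linear_bij_inv[OF L]
  note Bj = funpow_linear_bij(1,2)[OF B_bij(1,2), of j]
  let ?d = "\<bar>det (matrix ?L)\<bar>"
  have d: "?d > 0" using M(3) by simp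
  have dB: "\<bar>det (matrix ?B)\<bar> = ?d" using adjoint_bij(4)[OF L] by (simp add: inv_contract(2))
  define f' where "f' = dilation_op ?M f"
  define h' where "h' \<xi> = of_real (sqrt ?d) * h (?B \<xi>)" for \<xi>
  have f': "f' \<in> L2" unfolding f'_def by (rule dilation_op_L2(1)[OF M(1,2) f(1)])
  have ff: "f = dilation_op ?L f'" by (simp add: f'_def dilation_op_inv(1)[OF L])
  have iM: "inv (adjoint ?M) = ?B"
    using adjoint_bij(3)[OF M(1,2)] inv_inv_eq[OF L(2)] by (simp add: inv_contract(2))
  have sq: "1 / sqrt \<bar>det (matrix ?M)\<bar> = sqrt ?d" using M(4) by (simp add: abs_inverse real_sqrt_inverse divide_inverse)
  have f'h: "AE \<xi> in lebesgue. fourier f' \<xi> = h' \<xi>"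
    using fourier_dilation[OF M(1,2) f(1)] AE_linear[OF Bj f(2)] unfolding f'_def h'_def iM sq
    by eventually_elim simp
  have h'm: "h' \<in> borel_measurable lebesgue"
    unfolding h'_def[abs_def] using measurable_compose[OF linear_measurable_lebesgue[OF Bj] h(1)] by measurable
  have h'b: "cmod (h' \<xi>) \<le> sqrt ?d * c" for \<xi>
    using h(2)[of "?B \<xi>"] d by (simp add: h'_def norm_mult mult_left_mono)
  have h's: "\<xi> \<in> cbox a (a + 1)" if "h' \<xi> \<noteq> 0" for \<xi>
    using h(3)[of "?B \<xi>"] that by (simp add: h'_def contract_inverse)
  note F = energy_formula[OF V frame \<sigma> \<sigma>m f' f'h h'm h'b h's]
  let ?w = "\<lambda>\<xi>. (cmod (h \<xi>))\<^sup>2 * spectral j \<xi>"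
  have w: "?w \<in> borel_measurable lebesgue" using h(1) by measurable
  have eq: "(cmod (h' \<xi>))\<^sup>2 * \<sigma> \<xi> = ?d * ?w (?B \<xi>)" for \<xi>
    using d by (simp add: h'_def norm_mult power_mult_distrib spectral_def contract_inverse)
  have "integrable lebesgue (\<lambda>\<xi>. ?w (?B \<xi>))" using F(1) M(3) unfolding eq by simp
  then show "integrable lebesgue ?w" using integrable_linear[OF Bj w] by simp
  have "scaled_energy j f = parseval_frame.energy (I \<times> int_lattice) frame_elt f'"
  proof -
    interpret b: parseval_frame "I \<times> int_lattice" frame_elt V by (rule base_frame)
    interpret s: parseval_frame "I \<times> int_lattice" "\<lambda>i. dilation_op ?L (frame_elt i)" "dilation_op ?L ` V" by (rule scaled_frame)
    show ?thesis unfolding s.energy_def b.energy_def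
    proof (rule infsum_cong)
      fix i :: "nat \<times> (real ^ 'n)" assume i: "i \<in> I \<times> int_lattice"
      show "(cmod (L2_inner f (dilation_op ?L (frame_elt i))))\<^sup>2 = (cmod (L2_inner f' (frame_elt i)))\<^sup>2"
        by (subst ff, subst dilation_op_inner[OF L f' b.e_L2[OF i]]) (rule refl)
    qed
  qed
  also have "\<dots> = (LINT \<xi>|lebesgue. (cmod (h' \<xi>))\<^sup>2 * \<sigma> \<xi>)" by (rule F(2))
  also have "\<dots> = ?d * (LINT \<xi>|lebesgue. ?w (?B \<xi>))" unfolding eq by simp
  also have "(LINT \<xi>|lebesgue. ?w (?B \<xi>)) = inverse ?d *\<^sub>R (LINT \<xi>|lebesgue. ?w \<xi>)"
    using integral_linear[OF Bj w] unfolding dB .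
  finally show "scaled_energy j f = (LINT \<xi>|lebesgue. ?w \<xi>)" using M(3) by simp
qed

text \<open>The cube moves with the centre \<open>m\<close>, so one radius serves all centres, as
  local testing requires. Taking r = 1/(2K) keeps every coordinate of the contracted point within
  1/2 of that of the contracted centre.\<close>

lemma ball_contract_cube:
  "\<exists>r>0. \<forall>m \<xi>. \<xi> \<in> ball m r \<longrightarrow> contract j \<xi> \<in> cbox (contract j m - (1/2) *\<^sub>R 1) (contract j m - (1/2) *\<^sub>R 1 + 1)"
proof -
  obtain K where K: "K > 0" "\<And>x. norm (contract j x) \<le> norm x * K"
    using bounded_linear.pos_bounded[OF linear_conv_bounded_linear[THEN iffD1, OF contract_bij(1)]] by blast
  have "contract j \<xi> \<in> cbox (contract j m - (1/2) *\<^sub>R 1) (contract j m - (1/2) *\<^sub>R 1 + 1)" if "\<xi> \<in> ball m (1 / (2 * K))" for m \<xi>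
  proof -
    have "norm (contract j \<xi> - contract j m) \<le> norm (\<xi> - m) * K"
      using K(2)[of "\<xi> - m"] by (simp add: linear_diff[OF contract_bij(1)])
    also have "\<dots> \<le> 1/2" using that K(1) by (simp add: dist_norm norm_minus_commute field_simps)
    finally have n: "norm (contract j \<xi> - contract j m) \<le> 1/2" .
    have "\<bar>contract j \<xi> $ i - contract j m $ i\<bar> \<le> 1/2" for i
      using component_le_norm_cart[of "contract j \<xi> - contract j m" i] n by simp
    then have "contract j m $ i - 1/2 \<le> contract j \<xi> $ i \<and> contract j \<xi> $ i \<le> contract j m $ i + 1/2" for i
      by (simp only: abs_diff_le_iff)
    then show ?thesis unfolding mem_box_cart by (simp add: add.commute)
  qed
  then show ?thesis using K(1) by (intro exI[of _ "1 / (2 * K)"]) auto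
qed

lemma indicator_energy:
  assumes S: "S \<in> sets lebesgue" "bounded S" and c: "\<And>\<xi>. \<xi> \<in> S \<Longrightarrow> contract j \<xi> \<in> cbox a (a + 1)"
    and f: "f \<in> L2" "AE \<xi> in lebesgue. fourier f \<xi> = indicator S \<xi>"
  shows "integrable lebesgue (\<lambda>\<xi>. indicator S \<xi> * spectral j \<xi>)"
    and "scaled_energy j f = (LINT \<xi>|lebesgue. indicator S \<xi> * spectral j \<xi>)"
proof -
  have i: "(cmod (indicator S \<xi>))\<^sup>2 = indicator S \<xi>" for \<xi> by (simp add: indicator_def)
  have m: "(indicator S :: _ \<Rightarrow> complex) \<in> borel_measurable lebesgue" using S(1) by (rule borel_measurable_indicator)
  have b: "cmod (indicator S \<xi>) \<le> 1" for \<xi> by (simp add: indicator_def)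
  have s: "contract j \<xi> \<in> cbox a (a + 1)" if "(indicator S \<xi> :: complex) \<noteq> 0" for \<xi>
    using that c by (auto simp: indicator_def split: if_splits)
  show "integrable lebesgue (\<lambda>\<xi>. indicator S \<xi> * spectral j \<xi>)"
    "scaled_energy j f = (LINT \<xi>|lebesgue. indicator S \<xi> * spectral j \<xi>)"
    using scaled_energy_formula[OF f m b s] unfolding i by auto
qed

lemma bounded_indicator_L2:
  assumes "S \<in> sets lebesgue" "bounded S"
  shows "(\<lambda>x::real^'n. indicator S x :: complex) \<in> L2" "(L2_norm (\<lambda>x. indicator S x :: complex))\<^sup>2 = measure lebesgue S"
    "integrable lebesgue (indicator S :: _ \<Rightarrow> real)"
proof -
  obtain R where R: "\<And>x. x \<in> S \<Longrightarrow> norm x \<le> R" using assms(2) by (auto simp: bounded_iff)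
  show "(\<lambda>x. indicator S x :: complex) \<in> L2"
  proof (rule L2_bounded_measurable[where c=1])
    show "bounded_support (\<lambda>x. indicator S x :: complex)"
      unfolding bounded_support_def using R by (intro exI[of _ R]) (auto simp: indicator_def not_le[symmetric])
  qed (use borel_measurable_indicator[OF assms(1)] in \<open>simp, simp add: indicator_def\<close>)
  have i: "(cmod (indicator S \<xi>))\<^sup>2 = indicator S \<xi>" for \<xi> :: "real^'n" by (simp add: indicator_def)
  show "(L2_norm (\<lambda>x. indicator S x :: complex))\<^sup>2 = measure lebesgue S"
    unfolding L2_norm_sq i using assms by simp
  have "S \<in> lmeasurable" using assms by (simp add: bounded_set_imp_lmeasurable)
  then show "integrable lebesgue (indicator S :: _ \<Rightarrow> real)" by (simp only: lmeasurable_iff_integrable)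
qed

lemma \<sigma>_nonneg: "AE \<xi> in lebesgue. 0 \<le> \<sigma> \<xi>"
  using \<sigma> by eventually_elim (auto intro: has_sum_nonneg)

lemma \<sigma>_le_1: "AE \<xi> in lebesgue. \<sigma> \<xi> \<le> 1"
proof -
  obtain r where r: "r > 0" "\<And>m \<xi>. \<xi> \<in> ball m r \<Longrightarrow> contract 0 \<xi> \<in> cbox (contract 0 m - (1/2) *\<^sub>R 1) (contract 0 m - (1/2) *\<^sub>R 1 + 1)"
    using ball_contract_cube[of 0] by blast
  show ?thesis
  proof (rule AE_le_of_local_integrals[OF \<sigma>m _ r(1)])
    fix m and S :: "(real^'n) set" assume S: "S \<in> sets lebesgue" "S \<subseteq> ball m r"
    have b: "bounded S" using S(2) bounded_ball bounded_subset by blast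
    note ind = bounded_indicator_L2[OF S(1) b]
    obtain f where f: "f \<in> L2" "AE \<xi> in lebesgue. fourier f \<xi> = indicator S \<xi>" using fourier_surj[OF ind(1)] by blast
    have nf: "(L2_norm f)\<^sup>2 = measure lebesgue S"
      using L2_norm_cong_AE[OF fourier_measurable[OF f(1)] L2_measurable[OF ind(1)] f(2)] fourier_isometry[OF f(1)] ind(2) by simp
    note e = indicator_energy[OF S(1) b _ f, of 0, OF r(2)[OF subsetD[OF S(2)]]]
    interpret s: parseval_frame "I \<times> int_lattice" "\<lambda>i. dilation_op (A ^^ 0) (frame_elt i)" "dilation_op (A ^^ 0) ` V" by (rule scaled_frame)
    show "integrable lebesgue (\<lambda>x. indicator S x * \<sigma> x) \<and> integrable lebesgue (\<lambda>x. indicator S x * 1 :: real) \<and>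
      (LINT x|lebesgue. indicator S x * \<sigma> x) \<le> (LINT x|lebesgue. indicator S x * 1)"
      using e ind(3) s.energy_le[OF f(1)] nf S(1) by simp
  qed simp
qed

lemma \<sigma>_mono: "AE \<xi> in lebesgue. \<sigma> \<xi> \<le> spectral 1 \<xi>"
proof -
  obtain r0 where r0: "r0 > 0" "\<And>m \<xi>. \<xi> \<in> ball m r0 \<Longrightarrow> contract 0 \<xi> \<in> cbox (contract 0 m - (1/2) *\<^sub>R 1) (contract 0 m - (1/2) *\<^sub>R 1 + 1)"
    using ball_contract_cube[of 0] by blast
  obtain r1 where r1: "r1 > 0" "\<And>m \<xi>. \<xi> \<in> ball m r1 \<Longrightarrow> contract 1 \<xi> \<in> cbox (contract 1 m - (1/2) *\<^sub>R 1) (contract 1 m - (1/2) *\<^sub>R 1 + 1)"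
    using ball_contract_cube[of 1] by blast
  show ?thesis
  proof (rule AE_le_of_local_integrals[OF \<sigma>m spectral_measurable])
    \<comment> \<open>The smaller radius lets the same test set be used in the formulas at scales 0
      and 1.\<close>
    show "min r0 r1 > 0" using r0(1) r1(1) by simp
    fix m and S :: "(real^'n) set" assume S: "S \<in> sets lebesgue" "S \<subseteq> ball m (min r0 r1)"
    have b: "bounded S" using S(2) bounded_ball bounded_subset by blast
    have S01: "S \<subseteq> ball m r0" "S \<subseteq> ball m r1" using S(2) by auto
    note ind = bounded_indicator_L2[OF S(1) b]
    obtain f where f: "f \<in> L2" "AE \<xi> in lebesgue. fourier f \<xi> = indicator S \<xi>" using fourier_surj[OF ind(1)] by blast
    note e0 = indicator_energy[OF S(1) b _ f, of 0, OF r0(2)[OF subsetD[OF S01(1)]]]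
    note e1 = indicator_energy[OF S(1) b _ f, of 1, OF r1(2)[OF subsetD[OF S01(2)]]]
    show "integrable lebesgue (\<lambda>x. indicator S x * \<sigma> x) \<and> integrable lebesgue (\<lambda>x. indicator S x * spectral 1 x) \<and>
      (LINT x|lebesgue. indicator S x * \<sigma> x) \<le> (LINT x|lebesgue. indicator S x * spectral 1 x)"
      using e0 e1 scaled_energy_mono[OF f(1), of 0 1] by simp
  qed
qed

text \<open>The bounds at scale 0 are pulled back along each contraction; countably many null sets
  then allow one exceptional set for all \<open>j\<close>.\<close>

lemma spectral_AE: "AE \<xi> in lebesgue. \<forall>j. 0 \<le> spectral j \<xi> \<and> spectral j \<xi> \<le> 1 \<and> spectral j \<xi> \<le> spectral (Suc j) \<xi>"
proof -
  have "AE \<xi> in lebesgue. 0 \<le> \<sigma> \<xi> \<and> \<sigma> \<xi> \<le> 1 \<and> \<sigma> \<xi> \<le> spectral 1 \<xi>"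
    using \<sigma>_nonneg \<sigma>_le_1 \<sigma>_mono by eventually_elim simp
  from AE_linear[OF contract_bij this]
  have "AE \<xi> in lebesgue. 0 \<le> spectral j \<xi> \<and> spectral j \<xi> \<le> 1 \<and> spectral j \<xi> \<le> spectral (Suc j) \<xi>" for j
    by (simp add: spectral_contract flip: spectral_def)
  then show ?thesis by (simp add: AE_all_countable)
qed

text \<open>Total and measurable because of \<open>lim\<close>; it is the actual limit only off a
  null set.\<close>

definition spectral_limit :: "real ^ 'n \<Rightarrow> real" where
  "spectral_limit \<xi> = lim (\<lambda>j. spectral j \<xi>)"

lemma spectral_limit_measurable [measurable]: "spectral_limit \<in> borel_measurable lebesgue"
  unfolding spectral_limit_def[abs_def] by measurable

lemma spectral_limit_AE:
  "AE \<xi> in lebesgue. (\<lambda>j. spectral j \<xi>) \<longlonglongrightarrow> spectral_limit \<xi> \<and> (\<forall>j. 0 \<le> spectral j \<xi> \<and> spectral j \<xi> \<le> spectral_limit \<xi>) \<and> 0 \<le> spectral_limit \<xi> \<and> spectral_limit \<xi> \<le> 1"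
  using spectral_AE
proof eventually_elim
  case (elim \<xi>)
  have inc: "incseq (\<lambda>j. spectral j \<xi>)" using elim by (simp add: incseq_Suc_iff)
  have "convergent (\<lambda>j. spectral j \<xi>)"
    by (rule incseq_convergent[OF inc, of 1]) (use elim in \<open>auto simp: convergent_def\<close>)
  then have l: "(\<lambda>j. spectral j \<xi>) \<longlonglongrightarrow> spectral_limit \<xi>" by (simp add: spectral_limit_def convergent_LIMSEQ_iff)
  show ?case using l elim incseq_le[OF inc l] LIMSEQ_le_const2[OF l, of 1] LIMSEQ_le_const[OF l, of 0] by auto
qed

lemma cball_contract_cube:
  "\<exists>N. \<forall>j\<ge>N. \<forall>\<xi>. norm \<xi> \<le> R \<longrightarrow> contract j \<xi> \<in> cbox (- (1/2) *\<^sub>R 1) (- (1/2) *\<^sub>R 1 + 1)"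
proof -
  obtain N where N: "\<And>j x. j \<ge> N \<Longrightarrow> norm x \<le> R \<Longrightarrow> norm (contract j x) < 1/2"
    using contract_small[of "1/2" R] by auto
  have "contract j x \<in> cbox (- (1/2) *\<^sub>R 1) (- (1/2) *\<^sub>R 1 + 1)" if "j \<ge> N" "norm x \<le> R" for j x
  proof -
    have "\<bar>contract j x $ i\<bar> \<le> 1/2" for i
      using component_le_norm_cart[of "contract j x" i] N[OF that] by simp
    then have "- (1/2) \<le> contract j x $ i \<and> contract j x $ i \<le> 1/2" for i
      by (metis abs_le_D1 abs_le_D2 minus_le_iff)
    then show ?thesis unfolding mem_box_cart by simp
  qed
  then show ?thesis by blast
qed

text \<open>A truncation is supported in a fixed ball, which the contraction eventually moves into
  the cube centred at the origin.\<close>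

lemma truncated_energy:
  assumes f: "f \<in> L2" "AE \<xi> in lebesgue. fourier f \<xi> = truncate R h \<xi>" and h: "h \<in> L2"
  shows "\<forall>\<^sub>F j in sequentially. integrable lebesgue (\<lambda>\<xi>. (cmod (truncate R h \<xi>))\<^sup>2 * spectral j \<xi>) \<and>
    scaled_energy j f = (LINT \<xi>|lebesgue. (cmod (truncate R h \<xi>))\<^sup>2 * spectral j \<xi>)"
proof -
  obtain N where N: "\<And>j \<xi>. j \<ge> N \<Longrightarrow> norm \<xi> \<le> real R \<Longrightarrow> contract j \<xi> \<in> cbox (- (1/2) *\<^sub>R 1) (- (1/2) *\<^sub>R 1 + 1)"
    using cball_contract_cube[of "real R"] by blast
  show ?thesis using eventually_ge_at_top[of N]
  proof eventually_elim
    case (elim j)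
    have s: "contract j \<xi> \<in> cbox (- (1/2) *\<^sub>R 1) (- (1/2) *\<^sub>R 1 + 1)" if "truncate R h \<xi> \<noteq> 0" for \<xi>
      using that N[OF elim] truncate_bounds(3)[of R \<xi> h] by (meson not_le)
    show ?case
      using scaled_energy_formula[OF f L2_measurable[OF truncate_L2[OF h]] truncate_bounds(1) s] by simp
  qed
qed

text \<open>Let \<open>X\<close> be the integral of the squared transform against
  \<open>spectral_limit\<close>. Since \<open>f\<close> lies in every dilated space, its inner
  product with a truncated copy of itself is at most sqrt X times its norm. Removing the truncation
  shows that the squared norm of \<open>f\<close> is at most \<open>X\<close>, and as the limit
  never exceeds 1 it must be 1 wherever the transform is nonzero.\<close>

lemma fourier_support_V:
  assumes f: "f \<in> V"
  shows "AE \<xi> in lebesgue. fourier f \<xi> \<noteq> 0 \<longrightarrow> (\<lambda>j. spectral j \<xi>) \<longlonglongrightarrow> 1"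
proof -
  have fL: "f \<in> L2" using f V_L2 by blast
  let ?h = "fourier f" let ?w = "\<lambda>\<xi>. (cmod (?h \<xi>))\<^sup>2 * spectral_limit \<xi>"
  have h: "?h \<in> L2" by (rule fourier_L2[OF fL])
  have hm [measurable]: "?h \<in> borel_measurable lebesgue" by (rule L2_measurable[OF h])
  note hi = L2_integrable[OF h]
  have wi: "integrable lebesgue ?w"
  proof (rule Bochner_Integration.integrable_bound[OF hi])
    show "AE \<xi> in lebesgue. norm (?w \<xi>) \<le> norm ((cmod (?h \<xi>))\<^sup>2)"
      using spectral_limit_AE
    proof eventually_elim
      case (elim \<xi>)
      then have "\<bar>spectral_limit \<xi>\<bar> \<le> 1" by simp
      then show ?case by (simp add: abs_mult mult_left_le)
    qed
  qed measurable
  let ?X = "LINT \<xi>|lebesgue. ?w \<xi>"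
  have bound: "cmod (L2_inner (truncate R ?h) ?h) \<le> sqrt ?X * L2_norm f" for R
  proof -
    obtain g where g: "g \<in> L2" "AE \<xi> in lebesgue. fourier g \<xi> = truncate R ?h \<xi>"
      using fourier_surj[OF truncate_L2[OF h]] by blast
    \<comment> \<open>The scale depends on \<open>R\<close>, but the bound by \<open>?X\<close>
      obtained from it does not.\<close>
    obtain j where j: "integrable lebesgue (\<lambda>\<xi>. (cmod (truncate R ?h \<xi>))\<^sup>2 * spectral j \<xi>)"
      "scaled_energy j g = (LINT \<xi>|lebesgue. (cmod (truncate R ?h \<xi>))\<^sup>2 * spectral j \<xi>)"
      using truncated_energy[OF g h] by (auto simp: eventually_sequentially)
    interpret s: parseval_frame "I \<times> int_lattice" "\<lambda>i. dilation_op (A ^^ j) (frame_elt i)" "dilation_op (A ^^ j) ` V" by (rule scaled_frame)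
    have "scaled_energy j g \<le> ?X"
      unfolding j(2)
    proof (rule integral_mono_AE[OF j(1) wi])
      show "AE \<xi> in lebesgue. (cmod (truncate R ?h \<xi>))\<^sup>2 * spectral j \<xi> \<le> ?w \<xi>"
        using spectral_limit_AE by eventually_elim (auto intro!: mult_mono power_mono truncate_bounds)
    qed
    then have "sqrt (scaled_energy j g) * L2_norm f \<le> sqrt ?X * L2_norm f"
      by (intro mult_right_mono real_sqrt_le_mono) auto
    moreover have "cmod (L2_inner g f) \<le> sqrt (scaled_energy j g) * L2_norm f"
      using s.inner_le_energy[OF g(1)] V_scaled f by blast
    moreover have "L2_inner g f = L2_inner (truncate R ?h) ?h"
    proof -
      have "L2_inner g f = L2_inner (fourier g) ?h" by (rule fourier_inner[OF g(1) fL, symmetric])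
      also have "\<dots> = L2_inner (truncate R ?h) ?h"
        unfolding L2_inner_def using g(2)
        by (intro integral_cong_AE borel_measurable_times cnj_measurable hm fourier_measurable[OF g(1)] truncate_measurable) auto
      finally show ?thesis .
    qed
    ultimately show ?thesis by simp
  qed
  have "(\<lambda>R. cmod (L2_inner (truncate R ?h) ?h)) \<longlonglongrightarrow> cmod (L2_inner ?h ?h)"
    by (intro tendsto_norm L2_tendsto_inner truncate_L2_tendsto h)
  then have "cmod (L2_inner ?h ?h) \<le> sqrt ?X * L2_norm f"
    by (rule LIMSEQ_le_const2) (use bound in blast)
  moreover have "cmod (L2_inner ?h ?h) = L2_norm f * L2_norm f"
    unfolding L2_inner_self norm_of_real fourier_isometry[OF fL] by (simp add: power2_eq_square)
  ultimately have X0: "L2_norm f * L2_norm f \<le> sqrt ?X * L2_norm f" by simp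
  have "0 \<le> ?X" using spectral_limit_AE
    by (intro integral_nonneg_AE) (elim eventually_mono, simp)
  then have "L2_norm f \<le> sqrt ?X" using le_of_mult_self_le[OF X0] by simp
  then have "(L2_norm f)\<^sup>2 \<le> (sqrt ?X)\<^sup>2" by (intro power_mono) auto
  then have le: "(LINT \<xi>|lebesgue. (cmod (?h \<xi>))\<^sup>2) \<le> ?X"
    using \<open>0 \<le> ?X\<close> fourier_isometry[OF fL] L2_norm_sq[of ?h] by simp
  let ?v = "\<lambda>\<xi>. (cmod (?h \<xi>))\<^sup>2 - ?w \<xi>"
  have v0: "AE \<xi> in lebesgue. 0 \<le> ?v \<xi>"
    using spectral_limit_AE by eventually_elim (simp add: mult_left_le)
  have vi: "integrable lebesgue ?v" using hi wi by simp
  have "(LINT \<xi>|lebesgue. ?v \<xi>) = 0"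
    using le hi wi integral_nonneg_AE[OF v0] by simp
  then have "AE \<xi> in lebesgue. ?v \<xi> = 0" using integral_nonneg_eq_0_iff_AE[OF vi v0] by simp
  then show ?thesis using spectral_limit_AE
  proof eventually_elim
    case (elim \<xi>)
    show ?case
    proof
      assume "fourier f \<xi> \<noteq> 0"
      then have "spectral_limit \<xi> = 1" using elim(1) by simp
      then show "(\<lambda>j. spectral j \<xi>) \<longlonglongrightarrow> 1" using elim(2) by simp
    qed
  qed
qed

text \<open>Where \<sigma> is nonzero, some generator has nonzero transform, and there are countably
  many generators. A nonzero value at a later scale is the same situation at the contracted point,
  whose sequence is a tail of the original one.\<close>

lemma spectral_dichotomy:
  "AE \<xi> in lebesgue. \<forall>i. spectral i \<xi> \<noteq> 0 \<longrightarrow> (\<lambda>j. spectral j \<xi>) \<longlonglongrightarrow> 1"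
proof -
  have "AE \<xi> in lebesgue. \<forall>\<alpha>\<in>I. fourier (\<phi> \<alpha>) \<xi> \<noteq> 0 \<longrightarrow> (\<lambda>j. spectral j \<xi>) \<longlonglongrightarrow> 1"
    using frame fourier_support_V by (subst AE_ball_countable) (auto simp: tight_frame_generator_def)
  then have 1: "AE \<xi> in lebesgue. \<sigma> \<xi> \<noteq> 0 \<longrightarrow> (\<lambda>j. spectral j \<xi>) \<longlonglongrightarrow> 1"
    using \<sigma>
  proof eventually_elim
    case (elim \<xi>)
    show ?case
    proof
      assume n: "\<sigma> \<xi> \<noteq> 0"
      have "\<exists>\<alpha>\<in>I. fourier (\<phi> \<alpha>) \<xi> \<noteq> 0"
      proof (rule ccontr)
        assume "\<not> (\<exists>\<alpha>\<in>I. fourier (\<phi> \<alpha>) \<xi> \<noteq> 0)"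
        then have "((\<lambda>\<alpha>. (cmod (fourier (\<phi> \<alpha>) \<xi>))\<^sup>2) has_sum 0) I" by (intro has_sum_0) auto
        then show False using elim(2) n has_sum_unique by blast
      qed
      then show "(\<lambda>j. spectral j \<xi>) \<longlonglongrightarrow> 1" using elim(1) by blast
    qed
  qed
  have "AE \<xi> in lebesgue. spectral i \<xi> \<noteq> 0 \<longrightarrow> (\<lambda>j. spectral j \<xi>) \<longlonglongrightarrow> 1" for i
    using AE_linear[OF contract_bij 1, of i]
    by eventually_elim (auto simp: spectral_contract dest: LIMSEQ_offset simp flip: spectral_def)
  then show ?thesis by (subst AE_all_countable) blast
qed

end

section \<open>Integer iterates\<close>

lemma int_iter_of_nat: "int_iter f (int n) = f ^^ n" "int_iter f (- int n) = inv f ^^ n"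
  by (auto simp: int_iter_def)

lemma int_iter_linear:
  fixes L :: "real ^ 'n \<Rightarrow> real ^ 'n"
  assumes L: "linear L" "bij L"
  shows "linear (int_iter L j)" "bij (int_iter L j)" "inv (int_iter L j) = int_iter L (- j)"
    "adjoint (int_iter L j) = int_iter (adjoint L) j" "int_iter (dilation_op L) j = dilation_op (int_iter L j)"
proof -
  note Li = linear_bij_inv(1,2)[OF L]
  have pow: "dilation_op M ^^ n = dilation_op (M ^^ n)" if M: "linear M" "bij M" for M :: "real ^ 'n \<Rightarrow> real ^ 'n" and n
  proof (induction n)
    case 0 show ?case by (auto simp: dilation_op_id[unfolded id_def] fun_eq_iff)
  next
    case (Suc n)
    show ?case
    proof
      fix f
      have "(dilation_op M ^^ Suc n) f = dilation_op M (dilation_op (M ^^ n) f)" by (simp add: Suc)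
      also have "\<dots> = dilation_op (M ^^ n \<circ> M) f" by (rule dilation_op_comp[OF funpow_linear_bij(1)[OF M] M(1)])
      finally show "(dilation_op M ^^ Suc n) f = dilation_op (M ^^ Suc n) f" by (simp only: funpow_Suc_right)
    qed
  qed
  consider n where "j = int n" | n where "j = - int n" by (metis int_cases2)
  then have "linear (int_iter L j) \<and> bij (int_iter L j) \<and> inv (int_iter L j) = int_iter L (- j) \<and>
    adjoint (int_iter L j) = int_iter (adjoint L) j \<and> int_iter (dilation_op L) j = dilation_op (int_iter L j)"
  proof cases
    case 1
    then show ?thesis unfolding 1 int_iter_of_nat
      using funpow_linear_bij[OF L, of n] pow[OF L, of n] by blast
  next
    case 2
    have "inv (inv L ^^ n) = L ^^ n" using funpow_linear_bij(3)[OF Li, of n] inv_inv_eq[OF L(2)] by simp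
    then show ?thesis unfolding 2 int_iter_of_nat minus_minus
      using funpow_linear_bij[OF Li, of n] pow[OF Li, of n] adjoint_bij(3)[OF L] dilation_op_inv(3)[OF L] by simp
  qed
  then show "linear (int_iter L j)" "bij (int_iter L j)" "inv (int_iter L j) = int_iter L (- j)"
    "adjoint (int_iter L j) = int_iter (adjoint L) j" "int_iter (dilation_op L) j = dilation_op (int_iter L j)" by auto
qed

lemma int_iter_cancel:
  fixes L :: "real ^ 'n \<Rightarrow> real ^ 'n"
  assumes L: "linear L" "bij L"
  shows "int_iter L j (int_iter L (- j) x) = x" "int_iter L (- j) (int_iter L j x) = x"
  using int_iter_linear(2,3)[OF L, of j]
  by (simp_all flip: int_iter_linear(3)[OF L, of j] add: surj_f_inv_f bij_is_surj bij_is_inj)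

text \<open>Completeness of Lebesgue measure makes measurability of \<open>S\<close> part of the
  conclusion; images of supports are treated in this way.\<close>

lemma null_sets_lebesgue_of_AE: "AE x in lebesgue. x \<notin> S \<Longrightarrow> S \<in> null_sets (lebesgue :: (real^'n) measure)"
proof -
  assume "AE x in lebesgue. x \<notin> S"
  then obtain N where "\<And>x. x \<in> space lebesgue - N \<Longrightarrow> x \<notin> S" and N: "N \<in> null_sets lebesgue" by (rule AE_E3) blast
  then have "S \<subseteq> N" by auto
  then show ?thesis using N by (rule null_sets_completion_subset)
qed

lemma AE_of_null_sets_lebesgue: "S \<in> null_sets (lebesgue :: (real^'n) measure) \<Longrightarrow> AE x in lebesgue. x \<notin> S"
  by (rule AE_not_in)

section \<open>Spaces of functions with prescribed frequency support\<close>

text \<open>A Paley-Wiener type space. It turns an inclusion between frequency supports into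
  membership in a closed shift-invariant space.\<close>

definition spectral_space :: "(real ^ 'n) set \<Rightarrow> (real ^ 'n \<Rightarrow> complex) set" where
  "spectral_space W = {f \<in> L2. AE \<xi> in lebesgue. \<xi> \<notin> W \<longrightarrow> fourier f \<xi> = 0}"

lemma spectral_space_subspace: "L2_subspace (spectral_space W :: (real ^ 'n \<Rightarrow> complex) set)"
  unfolding L2_subspace_def
proof (intro conjI ballI allI)
  show "spectral_space W \<subseteq> L2" by (auto simp: spectral_space_def)
  have "AE \<xi>::real^'n in lebesgue. fourier (\<lambda>x. 0 * 0) \<xi> = 0 * fourier (\<lambda>x. 0) \<xi>" by (rule fourier_scale) simp
  then show "(\<lambda>x. 0) \<in> (spectral_space W :: (real ^ 'n \<Rightarrow> complex) set)" by (auto simp: spectral_space_def)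
  show "(\<lambda>x. f x + g x) \<in> spectral_space W" if "f \<in> spectral_space W" "g \<in> spectral_space W" for f g :: "real^'n \<Rightarrow> complex"
  proof -
    have fg: "f \<in> L2" "g \<in> L2" "AE \<xi> in lebesgue. \<xi> \<notin> W \<longrightarrow> fourier f \<xi> = 0" "AE \<xi> in lebesgue. \<xi> \<notin> W \<longrightarrow> fourier g \<xi> = 0"
      using that by (auto simp: spectral_space_def)
    have "AE \<xi> in lebesgue. \<xi> \<notin> W \<longrightarrow> fourier (\<lambda>x. f x + g x) \<xi> = 0"
      using fg(3,4) fourier_add[OF fg(1,2)] by eventually_elim simp
    then show ?thesis using L2_add[OF fg(1,2)] by (simp add: spectral_space_def)
  qed
  show "(\<lambda>x. c * f x) \<in> spectral_space W" if "f \<in> spectral_space W" for c and f :: "real^'n \<Rightarrow> complex"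
  proof -
    have f: "f \<in> L2" "AE \<xi> in lebesgue. \<xi> \<notin> W \<longrightarrow> fourier f \<xi> = 0"
      using that by (auto simp: spectral_space_def)
    have "AE \<xi> in lebesgue. \<xi> \<notin> W \<longrightarrow> fourier (\<lambda>x. c * f x) \<xi> = 0"
      using f(2) fourier_scale[OF f(1), of c] by eventually_elim simp
    then show ?thesis using L2_scale[OF f(1)] by (simp add: spectral_space_def)
  qed
qed

lemma spectral_space_translate:
  assumes "f \<in> spectral_space W" shows "translate k f \<in> spectral_space W"
proof -
  have f: "f \<in> L2" "AE \<xi> in lebesgue. \<xi> \<notin> W \<longrightarrow> fourier f \<xi> = 0"
    using assms by (auto simp: spectral_space_def)
  have "AE \<xi> in lebesgue. \<xi> \<notin> W \<longrightarrow> fourier (translate k f) \<xi> = 0"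
    using f(2) fourier_translate[OF f(1), of k] by eventually_elim simp
  then show ?thesis using translate_L2(1)[OF f(1)] by (simp add: spectral_space_def)
qed

text \<open>The part of the transform of \<open>f\<close> outside \<open>W\<close> is, for each
  \<open>g\<close> in the space, also a part of the transform of f - g, so its norm is at most the
  distance from \<open>f\<close> to \<open>g\<close>.\<close>

lemma spectral_space_closed:
  fixes W :: "(real ^ 'n) set"
  assumes W: "W \<in> sets lebesgue" shows "L2_closure (spectral_space W) \<subseteq> spectral_space W"
proof
  fix f assume "f \<in> L2_closure (spectral_space W)"
  then have f: "f \<in> L2" and ap: "\<And>\<epsilon>. \<epsilon> > 0 \<Longrightarrow> \<exists>g\<in>spectral_space W. g \<in> L2 \<and> L2_norm (\<lambda>x. f x - g x) < \<epsilon>"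
    by (auto simp: L2_closure_def)
  let ?u = "\<lambda>\<xi>. indicator (- W) \<xi> * fourier f \<xi>"
  have u: "?u \<in> L2" using W by (intro L2_indicator fourier_L2 f) (simp add: Compl_in_sets_lebesgue)
  have "L2_norm ?u \<le> \<epsilon>" if \<epsilon>: "\<epsilon> > 0" for \<epsilon>
  proof -
    obtain g where g: "g \<in> L2" "AE \<xi> in lebesgue. \<xi> \<notin> W \<longrightarrow> fourier g \<xi> = 0" "L2_norm (\<lambda>x. f x - g x) < \<epsilon>"
      using ap[OF \<epsilon>] by (auto simp: spectral_space_def)
    have fg: "(\<lambda>x. f x - g x) \<in> L2" by (rule L2_diff[OF f g(1)])
    have "L2_norm ?u \<le> L2_norm (fourier (\<lambda>x. f x - g x))"
    proof (rule L2_norm_mono_AE[OF fourier_L2[OF fg] L2_measurable[OF u]])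
      show "AE \<xi> in lebesgue. cmod (?u \<xi>) \<le> cmod (fourier (\<lambda>x. f x - g x) \<xi>)"
        using g(2) fourier_diff[OF f g(1)] by eventually_elim (simp add: indicator_def)
    qed
    then show ?thesis using g(3) by (simp add: fourier_isometry[OF fg])
  qed
  then have "L2_norm ?u \<le> 0" by (rule field_le_epsilon) simp
  then have "AE \<xi> in lebesgue. ?u \<xi> = 0" using L2_norm_eq_0_iff[OF u] L2_norm_nonneg[of ?u] by simp
  then have "AE \<xi> in lebesgue. \<xi> \<notin> W \<longrightarrow> fourier f \<xi> = 0" by eventually_elim auto
  with f show "f \<in> spectral_space W" by (simp add: spectral_space_def)
qed

lemma L2_closure_mono: "S \<subseteq> T \<Longrightarrow> L2_closure S \<subseteq> L2_closure T"
  unfolding L2_closure_def by blast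

text \<open>Shifts, finite combinations and L2 limits of the generators all stay inside the
  space.\<close>

lemma generates_spectral_space:
  fixes W :: "(real ^ 'n) set"
  assumes "generates G V" "G \<subseteq> spectral_space W" "W \<in> sets lebesgue" shows "V \<subseteq> spectral_space W"
proof -
  have "lin_span {translate k \<phi> | \<phi> k. \<phi> \<in> G \<and> k \<in> int_lattice} \<subseteq> spectral_space W"
    unfolding lin_span_def using assms(2)
    by (auto intro!: L2_subspace_sum[OF spectral_space_subspace] intro: spectral_space_translate)
  then have "V \<subseteq> L2_closure (spectral_space W)"
    using assms(1) L2_closure_mono unfolding generates_def by blast
  then show ?thesis using spectral_space_closed[OF assms(3)] by blast
qed

text \<open>The condition on generating sets quantifies over them; this supplies an instance from
  which information can be extracted.\<close>

lemma generates_self: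
  fixes V :: "(real ^ 'n \<Rightarrow> complex) set"
  assumes "V \<subseteq> L2" shows "generates V V"
proof -
  have "f \<in> L2_closure (lin_span {translate k \<phi> | \<phi> k. \<phi> \<in> V \<and> k \<in> int_lattice})" if f: "f \<in> V" for f
  proof -
    have "f = translate 0 f" by (simp add: translate_def)
    then have m: "f \<in> {translate k \<phi> | \<phi> k. \<phi> \<in> V \<and> k \<in> int_lattice}"
      using f int_lattice_closed(1) by blast
    have "f = (\<lambda>x. \<Sum>g\<in>{f}. 1 * g x)" by simp
    then have "f \<in> lin_span {translate k \<phi> | \<phi> k. \<phi> \<in> V \<and> k \<in> int_lattice}"
      unfolding lin_span_def mem_Collect_eq using m
      by (intro exI[of _ "{f}"] exI[of _ "\<lambda>_. 1"]) auto
    then show ?thesis using f assms unfolding L2_closure_def by (intro CollectI conjI allI impI bexI[of _ f]) auto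
  qed
  then show ?thesis unfolding generates_def by blast
qed

lemma measure_tendsto_0:
  fixes T :: "(real ^ 'n) set"
  assumes T: "T \<in> lmeasurable" and m: "\<And>j. {x. P j x} \<in> sets lebesgue"
    and ev: "AE x in lebesgue. \<forall>\<^sub>F j in sequentially. \<not> P j x"
  shows "(\<lambda>j::nat. measure lebesgue {x \<in> T. P j x}) \<longlonglongrightarrow> 0"
proof -
  have s: "T \<inter> {x. P j x} \<in> sets lebesgue" for j using T m[of j] by auto
  have eq: "{x \<in> T. P j x} = T \<inter> {x. P j x}" for j by auto
  have "(\<lambda>j. LINT x|lebesgue. (indicator (T \<inter> {x. P j x}) x :: real)) \<longlonglongrightarrow> (LINT x|(lebesgue :: (real^'n) measure). (0::real))"
  proof (rule integral_dominated_convergence)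
    show "integrable lebesgue (indicator T :: _ \<Rightarrow> real)" using T lmeasurable_iff_integrable by blast
    show "AE x in lebesgue. (\<lambda>j. indicator (T \<inter> {x. P j x}) x :: real) \<longlonglongrightarrow> 0"
      using ev
    proof eventually_elim
      case (elim x)
      then have "\<forall>\<^sub>F j in sequentially. (indicator (T \<inter> {x. P j x}) x :: real) = 0"
        by eventually_elim (simp add: indicator_def)
      then show ?case by (rule tendsto_eventually)
    qed
    show "(indicator (T \<inter> {x. P j x}) :: _ \<Rightarrow> real) \<in> borel_measurable lebesgue" for j
      by (rule borel_measurable_indicator[OF s])
  qed (auto simp: indicator_def)
  then show ?thesis unfolding eq using s by simp
qed

section \<open>The conditions as forms of the almost everywhere limit\<close>

context refinable_space
begin

lemma int_iter_contract: "int_iter (adjoint A) (- int j) = contract j"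
  by (simp add: int_iter_of_nat contract_def)

abbreviation full_limit :: bool where
  "full_limit \<equiv> AE \<xi> in lebesgue. (\<lambda>j. spectral j \<xi>) \<longlonglongrightarrow> 1"

text \<open>Moving a point along its orbit only shifts the index of the sequence.\<close>

lemma spectral_int_iter:
  "(\<lambda>i. spectral i (int_iter (adjoint A) j \<xi>)) \<longlonglongrightarrow> l \<longleftrightarrow> (\<lambda>i. spectral i \<xi>) \<longlonglongrightarrow> l"
proof -
  have c: "(\<lambda>i. spectral i (contract n \<eta>)) \<longlonglongrightarrow> l \<longleftrightarrow> (\<lambda>i. spectral i \<eta>) \<longlonglongrightarrow> l" for n \<eta>
    unfolding spectral_contract
    by (rule iffI) (erule LIMSEQ_offset, erule LIMSEQ_ignore_initial_segment)
  consider n where "j = int n" | n where "j = - int n" by (metis int_cases2)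
  then show ?thesis
  proof cases
    case 1
    show ?thesis using c[of n "int_iter (adjoint A) j \<xi>"] unfolding 1 int_iter_of_nat contract_inverse by blast
  next
    case 2
    show ?thesis using c[of n \<xi>] unfolding 2 int_iter_contract .
  qed
qed

text \<open>A condition therefore has to produce just one scale with nonzero value at almost every
  point.\<close>

lemma spectral_tendsto_if_AE_nonzero:
  assumes "AE \<xi> in lebesgue. \<exists>j. spectral j \<xi> \<noteq> 0" shows full_limit
  using assms spectral_dichotomy by eventually_elim auto

lemma full_limit_spectral_limit: "full_limit \<longleftrightarrow> (AE \<xi> in lebesgue. spectral_limit \<xi> = 1)"
proof
  assume full_limit
  then show "AE \<xi> in lebesgue. spectral_limit \<xi> = 1"
    using spectral_limit_AE by eventually_elim (auto intro: LIMSEQ_unique)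
next
  assume "AE \<xi> in lebesgue. spectral_limit \<xi> = 1"
  then show full_limit using spectral_limit_AE by eventually_elim auto
qed

text \<open>A function \<open>u\<close> with truncated transform is close to \<open>f\<close>.
  Dominated convergence makes its energies tend to its squared norm, so some dilated space comes
  within half of \<epsilon> of \<open>u\<close>.\<close>

lemma dense_of_full_limit:
  assumes full_limit
  shows "L2_closure (\<Union>j. int_iter (dilation_op A) j ` V) = L2"
proof
  show "L2_closure (\<Union>j. int_iter (dilation_op A) j ` V) \<subseteq> L2" by (auto simp: L2_closure_def)
  show "L2 \<subseteq> L2_closure (\<Union>j. int_iter (dilation_op A) j ` V)"
  proof
    fix f :: "real^'n \<Rightarrow> complex" assume f: "f \<in> L2"
    have "\<exists>g\<in>(\<Union>j. int_iter (dilation_op A) j ` V) \<inter> L2. L2_norm (\<lambda>x. f x - g x) < \<epsilon>" if \<epsilon>: "\<epsilon> > 0" for \<epsilon>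
    proof -
      let ?h = "fourier f"
      have h: "?h \<in> L2" by (rule fourier_L2[OF f])
      obtain R where R: "L2_norm (\<lambda>x. truncate R ?h x - ?h x) < \<epsilon> / 2"
        using order_tendstoD(2)[OF L2_tendstoD(3)[OF truncate_L2_tendsto[OF h]], of "\<epsilon>/2"] \<epsilon>
        by (auto simp: eventually_sequentially)
      let ?t = "truncate R ?h"
      have t: "?t \<in> L2" by (rule truncate_L2[OF h])
      obtain u where u: "u \<in> L2" "AE \<xi> in lebesgue. fourier u \<xi> = ?t \<xi>" using fourier_surj[OF t] by blast
      have nu: "L2_norm u = L2_norm ?t"
        using L2_norm_cong_AE[OF fourier_measurable[OF u(1)] L2_measurable[OF t] u(2)] fourier_isometry[OF u(1)] by simp
      have "L2_norm (\<lambda>x. u x - f x) = L2_norm (fourier (\<lambda>x. u x - f x))"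
        by (rule fourier_isometry[OF L2_diff[OF u(1) f], symmetric])
      also have "\<dots> = L2_norm (\<lambda>x. ?t x - ?h x)"
      proof (rule L2_norm_cong_AE)
        show "AE x in lebesgue. fourier (\<lambda>x. u x - f x) x = ?t x - ?h x"
          using fourier_diff[OF u(1) f] u(2) by eventually_elim simp
      qed (intro L2_measurable fourier_L2 L2_diff u(1) f t h)+
      finally have uf: "L2_norm (\<lambda>x. u x - f x) < \<epsilon> / 2" using R by simp
      have "(\<lambda>j. LINT \<xi>|lebesgue. (cmod (?t \<xi>))\<^sup>2 * spectral j \<xi>) \<longlonglongrightarrow> (LINT \<xi>|lebesgue. (cmod (?t \<xi>))\<^sup>2)"
      proof (rule integral_dominated_convergence[OF _ _ L2_integrable[OF t]])
        show "(\<lambda>\<xi>. (cmod (?t \<xi>))\<^sup>2) \<in> borel_measurable lebesgue"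
          using L2_integrable[OF t] by simp
        show "(\<lambda>\<xi>. (cmod (?t \<xi>))\<^sup>2 * spectral j \<xi>) \<in> borel_measurable lebesgue" for j
          using L2_integrable[OF t] by measurable
        show "AE \<xi> in lebesgue. (\<lambda>j. (cmod (?t \<xi>))\<^sup>2 * spectral j \<xi>) \<longlonglongrightarrow> (cmod (?t \<xi>))\<^sup>2"
          using assms
        proof eventually_elim
          case (elim \<xi>)
          from tendsto_mult_left[OF this, of "(cmod (?t \<xi>))\<^sup>2"] show ?case by simp
        qed
        show "AE \<xi> in lebesgue. norm ((cmod (?t \<xi>))\<^sup>2 * spectral j \<xi>) \<le> (cmod (?t \<xi>))\<^sup>2" for j
          using spectral_AE by eventually_elim (simp add: abs_mult mult_left_le)
      qed
      then have "(\<lambda>j. LINT \<xi>|lebesgue. (cmod (?t \<xi>))\<^sup>2 * spectral j \<xi>) \<longlonglongrightarrow> (L2_norm u)\<^sup>2"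
        by (simp add: nu L2_norm_sq)
      then have "\<forall>\<^sub>F j in sequentially. (L2_norm u)\<^sup>2 - (\<epsilon>/2)\<^sup>2 < (LINT \<xi>|lebesgue. (cmod (?t \<xi>))\<^sup>2 * spectral j \<xi>)"
        using \<epsilon> by (intro order_tendstoD(1)) auto
      then have "\<forall>\<^sub>F j in sequentially. (L2_norm u)\<^sup>2 - (\<epsilon>/2)\<^sup>2 < scaled_energy j u"
        using truncated_energy[OF u h] by eventually_elim simp
      then obtain j where j: "(L2_norm u)\<^sup>2 - (\<epsilon>/2)\<^sup>2 < scaled_energy j u"
        by (auto simp: eventually_sequentially)
      interpret s: parseval_frame "I \<times> int_lattice" "\<lambda>i. dilation_op (A ^^ j) (frame_elt i)" "dilation_op (A ^^ j) ` V" by (rule scaled_frame)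
      obtain g where g: "g \<in> dilation_op (A ^^ j) ` V" "(L2_norm (\<lambda>x. u x - g x))\<^sup>2 < (\<epsilon>/2)\<^sup>2"
        using s.dist_le_energy[OF u(1) j] by blast
      have gL: "g \<in> L2" by (rule s.V_L2[OF g(1)])
      have ug: "L2_norm (\<lambda>x. u x - g x) < \<epsilon> / 2" by (rule power2_less_imp_less[OF g(2)]) (use \<epsilon> in simp)
      have "g \<in> int_iter (dilation_op A) (int j) ` V"
        using g(1) int_iter_linear(5)[OF A_bij, of "int j"] by (simp only: int_iter_of_nat)
      moreover have "L2_norm (\<lambda>x. f x - g x) < \<epsilon>"
        using L2_norm_triangle_diff[OF f u(1) gL] uf ug L2_norm_minus_commute[of f u] by linarith
      ultimately show ?thesis using gL by blast
    qed
    then show "f \<in> L2_closure (\<Union>j. int_iter (dilation_op A) j ` V)" using f by (simp add: L2_closure_def)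
  qed
qed

text \<open>If \<open>W\<close> contains all the dilated supports, each generator has its spectrum
  in every preimage of \<open>W\<close>, so all dilates of \<open>V\<close> lie in the closed space
  \<open>spectral_space W\<close>. Density makes this space all of L2, which is possible only if
  \<open>W\<close> has null complement.\<close>

lemma essential_union_of_dense:
  assumes dense: "L2_closure (\<Union>j. int_iter (dilation_op A) j ` V) = L2" and G: "G \<subseteq> V" "generates G V"
  shows "is_essential_union {int_iter (adjoint A) j ` supp (fourier \<phi>) | \<phi> j. \<phi> \<in> G} UNIV"
  unfolding is_essential_union_def
proof (intro conjI ballI impI)
  fix W :: "(real^'n) set" assume W: "W \<in> sets lebesgue"
    and cover: "\<forall>S\<in>{int_iter (adjoint A) j ` supp (fourier \<phi>) | \<phi> j. \<phi> \<in> G}. S - W \<in> null_sets lebesgue"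
  let ?B = "int_iter (adjoint A)"
  note B = int_iter_linear[OF B_bij(1,2)] note cancel = int_iter_cancel[OF B_bij(1,2)]
  have Wj: "?B j -` W \<in> sets lebesgue" for j
    using measurable_sets[OF linear_measurable_lebesgue[OF B(1,2)] W, of j] by simp
  have "int_iter (dilation_op A) j ` V \<subseteq> spectral_space W" for j
  proof -
    have "G \<subseteq> spectral_space (?B j -` W)"
    proof
      fix g assume g: "g \<in> G"
      have "?B j ` supp (fourier g) - W \<in> null_sets lebesgue" using cover g by blast
      from AE_linear[OF B(1,2) AE_of_null_sets_lebesgue[OF this], of j]
      have "AE \<xi> in lebesgue. \<xi> \<notin> ?B j -` W \<longrightarrow> fourier g \<xi> = 0"
        by eventually_elim (auto simp: supp_def)
      then show "g \<in> spectral_space (?B j -` W)" using g G(1) V_L2 by (auto simp: spectral_space_def)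
    qed
    then have Vs: "V \<subseteq> spectral_space (?B j -` W)" by (rule generates_spectral_space[OF G(2) _ Wj])
    show ?thesis
    proof
      fix f assume "f \<in> int_iter (dilation_op A) j ` V"
      then obtain g where g: "g \<in> V" "f = dilation_op (int_iter A j) g"
        unfolding int_iter_linear(5)[OF A_bij] by blast
      have gL: "g \<in> L2" and gs: "AE \<xi> in lebesgue. \<xi> \<notin> ?B j -` W \<longrightarrow> fourier g \<xi> = 0"
        using Vs g(1) by (auto simp: spectral_space_def)
      note Aj = int_iter_linear(1,2)[OF A_bij, of j]
      have inv: "inv (adjoint (int_iter A j)) = ?B (- j)"
        by (simp add: int_iter_linear(4)[OF A_bij] B(3))
      have "AE \<xi> in lebesgue. \<xi> \<notin> W \<longrightarrow> fourier f \<xi> = 0"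
        using fourier_dilation[OF Aj gL] AE_linear[OF B(1,2) gs, of "- j"] unfolding g(2) inv
        by eventually_elim (simp add: cancel)
      then show "f \<in> spectral_space W"
        using dilation_op_L2(1)[OF Aj gL] unfolding g(2) by (simp add: spectral_space_def)
    qed
  qed
  then have "L2_closure (\<Union>j. int_iter (dilation_op A) j ` V) \<subseteq> L2_closure (spectral_space W)"
    by (intro L2_closure_mono) blast
  then have all: "L2 \<subseteq> spectral_space W" using dense spectral_space_closed[OF W] by blast
  have "AE \<xi> in lebesgue. \<xi> \<in> cball 0 (real n) \<longrightarrow> \<xi> \<in> W" for n
  proof -
    \<comment> \<open>The function whose transform is the indicator of \<open>?S\<close> belongs to
      L2, hence to \<open>spectral_space W\<close>; so \<open>?S\<close> is null.\<close>
    let ?S = "cball 0 (real n) - W"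
    have "?S \<in> sets lebesgue" "bounded ?S" using W by (auto intro: bounded_subset[OF bounded_cball])
    note ind = bounded_indicator_L2[OF this]
    obtain f where f: "f \<in> L2" "AE \<xi> in lebesgue. fourier f \<xi> = indicator ?S \<xi>" using fourier_surj[OF ind(1)] by blast
    have "AE \<xi> in lebesgue. \<xi> \<notin> W \<longrightarrow> fourier f \<xi> = 0" using all f(1) by (auto simp: spectral_space_def)
    then show ?thesis using f(2) by eventually_elim (auto simp: indicator_def split: if_splits)
  qed
  then have "AE \<xi> in lebesgue. \<forall>n. \<xi> \<in> cball 0 (real n) \<longrightarrow> \<xi> \<in> W" by (subst AE_all_countable) blast
  then have "AE \<xi> in lebesgue. \<xi> \<notin> UNIV - W"
  proof eventually_elim
    case (elim \<xi>)
    obtain n where "norm \<xi> \<le> real n" using real_arch_simple by blast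
    with elim show ?case by auto
  qed
  then show "UNIV - W \<in> null_sets lebesgue" by (rule null_sets_lebesgue_of_AE)
qed auto

text \<open>The set where the limit is 1 is tested as an upper bound: it contains the support of the
  transform of each element of \<open>V\<close> up to a null set, and by invariance along orbits all
  dilates of these supports.\<close>

lemma full_limit_of_essential_union:
  assumes "\<forall>G. G \<subseteq> V \<and> generates G V \<longrightarrow>
        is_essential_union {int_iter (adjoint A) j ` supp (fourier \<phi>) | \<phi> j. \<phi> \<in> G} UNIV"
  shows full_limit
proof -
  let ?W = "{\<xi>. spectral_limit \<xi> = 1}" let ?B = "int_iter (adjoint A)"
  note B = int_iter_linear[OF B_bij(1,2)] note cancel = int_iter_cancel[OF B_bij(1,2)]
  have W: "?W \<in> sets lebesgue"
    using measurable_sets[OF spectral_limit_measurable, of "{1}"] by (simp add: vimage_def)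
  have "is_essential_union {?B j ` supp (fourier \<phi>) | \<phi> j. \<phi> \<in> V} UNIV"
    using assms generates_self[OF V_L2] by blast
  moreover have "?B j ` supp (fourier f) - ?W \<in> null_sets lebesgue" if f: "f \<in> V" for f j
  proof (rule null_sets_lebesgue_of_AE)
    show "AE y in lebesgue. y \<notin> ?B j ` supp (fourier f) - ?W"
      using AE_linear[OF B(1,2) fourier_support_V[OF f], of "- j"] spectral_limit_AE
    proof eventually_elim
      case (elim y)
      show ?case
      proof
        assume y: "y \<in> ?B j ` supp (fourier f) - ?W"
        then obtain x where "fourier f x \<noteq> 0" "y = ?B j x" by (auto simp: supp_def)
        then have "fourier f (?B (- j) y) \<noteq> 0" by (simp add: cancel)
        then have "(\<lambda>i. spectral i y) \<longlonglongrightarrow> 1" using elim(1) spectral_int_iter by blast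
        then have "spectral_limit y = 1" using elim(2) LIMSEQ_unique by blast
        with y show False by simp
      qed
    qed
  qed
  ultimately have "UNIV - ?W \<in> null_sets lebesgue" using W unfolding is_essential_union_def by blast
  from AE_of_null_sets_lebesgue[OF this] show ?thesis
    unfolding full_limit_spectral_limit by eventually_elim simp
qed

lemma measure_contract: "T \<in> lmeasurable \<Longrightarrow> measure lebesgue (contract j ` T) = \<bar>det (matrix (contract j))\<bar> * measure lebesgue T"
  using lmeasurable_linear_image[OF contract_bij(1)] by blast

lemma det_contract_pos: "\<bar>det (matrix (contract j))\<bar> > 0"
  using linear_bij_inv(3)[OF contract_bij] by simp

lemma contract_vimage: "E \<in> sets lebesgue \<Longrightarrow> {x. contract j x \<in> E} \<in> sets lebesgue"
  using measurable_sets[OF contract_measurable, of E j] by (simp add: vimage_def)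

text \<open>The determinant cancels: a density on shrinking sets becomes the measure of a varying
  subset of the fixed set \<open>T\<close>, where convergence theorems apply.\<close>

lemma measure_contract_ratio:
  assumes T: "T \<in> lmeasurable" and E: "E \<in> sets lebesgue"
  shows "measure lebesgue (E \<inter> contract j ` T) / measure lebesgue (contract j ` T) =
    measure lebesgue {x \<in> T. contract j x \<in> E} / measure lebesgue T"
proof -
  have "{x \<in> T. contract j x \<in> E} = T \<inter> {x. contract j x \<in> E}" by auto
  then have "{x \<in> T. contract j x \<in> E} \<in> lmeasurable"
    using T contract_vimage[OF E, of j] by (simp add: fmeasurable.Int fmeasurable_Int_fmeasurable)
  moreover have "E \<inter> contract j ` T = contract j ` {x \<in> T. contract j x \<in> E}" by auto
  ultimately show ?thesis using measure_contract T det_contract_pos[of j] by simp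
qed

lemma average_contract:
  assumes E: "E \<in> sets lebesgue" "bounded E"
  shows "1 / measure lebesgue (contract j ` E) * (LINT \<xi>:contract j ` E|lebesgue. \<sigma> \<xi>)
    = (LINT \<xi>|lebesgue. indicator E \<xi> * spectral j \<xi>) / measure lebesgue E"
proof -
  let ?f = "\<lambda>\<xi>. indicator (contract j ` E) \<xi> * \<sigma> \<xi>"
  have "contract j ` E \<in> sets lebesgue" by (rule linear_image_sets_lebesgue[OF contract_bij(1) E(1)])
  then have f: "?f \<in> borel_measurable lebesgue" by measurable
  have i: "indicator (contract j ` E) (contract j \<xi>) = (indicator E \<xi> :: real)" for \<xi>
    using bij_is_inj[OF contract_bij(2)] by (auto simp: indicator_def inj_image_mem_iff)
  have "(LINT \<xi>|lebesgue. indicator E \<xi> * spectral j \<xi>) = (LINT \<xi>|lebesgue. ?f (contract j \<xi>))"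
    by (simp add: i spectral_def)
  also have "\<dots> = inverse \<bar>det (matrix (contract j))\<bar> * (LINT \<xi>:contract j ` E|lebesgue. \<sigma> \<xi>)"
    using integral_linear[OF contract_bij f] by (simp add: set_lebesgue_integral_def)
  finally show ?thesis
    using measure_contract[OF bounded_set_imp_lmeasurable[OF E(2,1)]] det_contract_pos[of j] by (simp add: divide_inverse)
qed

lemma integral_spectral_tendsto:
  assumes E: "E \<in> sets lebesgue" "bounded E"
  shows "(\<lambda>j. LINT \<xi>|lebesgue. indicator E \<xi> * spectral j \<xi>) \<longlonglongrightarrow> (LINT \<xi>|lebesgue. indicator E \<xi> * spectral_limit \<xi>)"
    "integrable lebesgue (\<lambda>\<xi>. indicator E \<xi> * spectral_limit \<xi>)"
proof -
  note [measurable] = E(1)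
  note Ei = bounded_indicator_L2(3)[OF E]
  show "(\<lambda>j. LINT \<xi>|lebesgue. indicator E \<xi> * spectral j \<xi>) \<longlonglongrightarrow> (LINT \<xi>|lebesgue. indicator E \<xi> * spectral_limit \<xi>)"
  proof (rule integral_dominated_convergence[OF _ _ Ei])
    show "AE \<xi> in lebesgue. (\<lambda>j. indicator E \<xi> * spectral j \<xi>) \<longlonglongrightarrow> indicator E \<xi> * spectral_limit \<xi>"
      using spectral_limit_AE by eventually_elim (auto intro: tendsto_mult_left)
    show "AE \<xi> in lebesgue. norm (indicator E \<xi> * spectral j \<xi>) \<le> indicator E \<xi>" for j
      using spectral_AE by eventually_elim (simp add: indicator_def)
  qed measurable
  show "integrable lebesgue (\<lambda>\<xi>. indicator E \<xi> * spectral_limit \<xi>)"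
    by (rule Bochner_Integration.integrable_bound[OF Ei])
       (measurable, use spectral_limit_AE in eventually_elim, simp add: indicator_def)
qed

text \<open>The averages converge to the average of \<open>spectral_limit\<close> over
  \<open>E\<close>. A function bounded by 1 with average 1 over a ball is 1 almost everywhere there,
  so balls suffice for the converse.\<close>

lemma average_iff:
  "full_limit \<longleftrightarrow> (\<forall>E. E \<in> sets lebesgue \<and> bounded E \<and> emeasure lebesgue E > 0 \<longrightarrow>
        (\<lambda>j. 1 / measure lebesgue (contract j ` E) * (LINT \<xi>:contract j ` E|lebesgue. \<sigma> \<xi>)) \<longlonglongrightarrow> 1)"
    (is "_ \<longleftrightarrow> ?R")
proof
  assume fl: full_limit
  show ?R
  proof (intro allI impI)
    fix E :: "(real^'n) set" assume E: "E \<in> sets lebesgue \<and> bounded E \<and> emeasure lebesgue E > 0"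
    then have E': "E \<in> sets lebesgue" "bounded E" by auto
    have "E \<in> lmeasurable" using E' by (simp add: bounded_set_imp_lmeasurable)
    then have pos: "measure lebesgue E > 0" using E by (simp add: emeasure_eq_measure2)
    have "(LINT \<xi>|lebesgue. indicator E \<xi> * spectral_limit \<xi>) = (LINT \<xi>|lebesgue. indicator E \<xi>)"
      using fl E' unfolding full_limit_spectral_limit by (intro integral_cong_AE) auto
    then have "(LINT \<xi>|lebesgue. indicator E \<xi> * spectral_limit \<xi>) = measure lebesgue E"
      using E' by simp
    then have "(\<lambda>j. (LINT \<xi>|lebesgue. indicator E \<xi> * spectral j \<xi>) / measure lebesgue E) \<longlonglongrightarrow> measure lebesgue E / measure lebesgue E"
      using integral_spectral_tendsto(1)[OF E'] pos by (intro tendsto_divide) auto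
    then show "(\<lambda>j. 1 / measure lebesgue (contract j ` E) * (LINT \<xi>:contract j ` E|lebesgue. \<sigma> \<xi>)) \<longlonglongrightarrow> 1"
      unfolding average_contract[OF E'] using pos by simp
  qed
next
  assume R: ?R
  have "AE \<xi> in lebesgue. \<xi> \<in> cball 0 (real (Suc n)) \<longrightarrow> spectral_limit \<xi> = 1" for n
  proof -
    \<comment> \<open>The successor avoids the ball of radius 0, which has measure 0.\<close>
    let ?E = "cball 0 (real (Suc n)) :: (real^'n) set"
    have E: "?E \<in> sets lebesgue" "bounded ?E" by auto
    have pos: "measure lebesgue ?E > 0" using content_cball_pos[of "real (Suc n)" "0::real^'n"] by simp
    have ep: "emeasure lebesgue ?E > 0"
      using pos lmeasurable_cball[of "0::real^'n" "real (Suc n)"] by (simp add: emeasure_eq_measure2)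
    have "(\<lambda>j. (LINT \<xi>|lebesgue. indicator ?E \<xi> * spectral j \<xi>) / measure lebesgue ?E) \<longlonglongrightarrow> 1"
      using R[rule_format, of ?E] E ep unfolding average_contract[OF E] by blast
    moreover have "(\<lambda>j. (LINT \<xi>|lebesgue. indicator ?E \<xi> * spectral j \<xi>) / measure lebesgue ?E)
        \<longlonglongrightarrow> (LINT \<xi>|lebesgue. indicator ?E \<xi> * spectral_limit \<xi>) / measure lebesgue ?E"
      using integral_spectral_tendsto(1)[OF E] pos by (intro tendsto_divide) auto
    ultimately have "1 = (LINT \<xi>|lebesgue. indicator ?E \<xi> * spectral_limit \<xi>) / measure lebesgue ?E"
      by (rule LIMSEQ_unique)
    then have eq: "(LINT \<xi>|lebesgue. indicator ?E \<xi> * spectral_limit \<xi>) = measure lebesgue ?E"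
      using pos by (simp add: field_simps)
    let ?v = "\<lambda>\<xi>. indicator ?E \<xi> - indicator ?E \<xi> * spectral_limit \<xi> :: real"
    have v0: "AE \<xi> in lebesgue. 0 \<le> ?v \<xi>" using spectral_limit_AE by eventually_elim (simp add: indicator_def)
    have vi: "integrable lebesgue ?v"
      by (intro Bochner_Integration.integrable_diff bounded_indicator_L2(3)[OF E] integral_spectral_tendsto(2)[OF E])
    have "(LINT \<xi>|lebesgue. ?v \<xi>) = (LINT \<xi>|lebesgue. indicator ?E \<xi>) - (LINT \<xi>|lebesgue. indicator ?E \<xi> * spectral_limit \<xi>)"
      by (intro Bochner_Integration.integral_diff bounded_indicator_L2(3)[OF E] integral_spectral_tendsto(2)[OF E])
    also have "\<dots> = 0" using eq E by simp
    finally have "AE \<xi> in lebesgue. ?v \<xi> = 0" using integral_nonneg_eq_0_iff_AE[OF vi v0] by simp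
    then show ?thesis by eventually_elim (simp add: indicator_def)
  qed
  then have "AE \<xi> in lebesgue. \<forall>n. \<xi> \<in> cball 0 (real (Suc n)) \<longrightarrow> spectral_limit \<xi> = 1" by (subst AE_all_countable) blast
  then show full_limit unfolding full_limit_spectral_limit
  proof eventually_elim
    case (elim \<xi>)
    obtain n where "norm \<xi> \<le> real n" using real_arch_simple by blast
    then have "\<xi> \<in> cball 0 (real (Suc n))" by simp
    with elim show ?case by blast
  qed
qed

lemma absorbing_iff: "full_limit \<longleftrightarrow> inv_absorbing (adjoint A) (supp \<sigma>)"
proof
  have S: "supp \<sigma> \<in> sets lebesgue"
    using measurable_sets[OF \<sigma>m, of "- {0}"] by (simp add: supp_def vimage_def)
  assume full_limit
  then have "AE \<xi> in lebesgue. \<exists>j0>0. \<forall>j\<ge>j0. contract j \<xi> \<in> supp \<sigma>"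
  proof eventually_elim
    case (elim \<xi>)
    from order_tendstoD(1)[OF elim, of 0] obtain N where "\<And>j. j \<ge> N \<Longrightarrow> 0 < spectral j \<xi>"
      by (auto simp: eventually_sequentially)
    then have "\<sigma> (contract j \<xi>) \<noteq> 0" if "j \<ge> N" for j using that by (fastforce simp: spectral_def)
    \<comment> \<open>\<open>Suc N\<close> serves as \<open>j0\<close>, which is required to be
      positive.\<close>
    then have "\<forall>j\<ge>Suc N. contract j \<xi> \<in> supp \<sigma>" by (simp add: supp_def)
    then show ?case by blast
  qed
  with S show "inv_absorbing (adjoint A) (supp \<sigma>)" by (simp add: inv_absorbing_def int_iter_contract)
next
  assume "inv_absorbing (adjoint A) (supp \<sigma>)"
  then have "AE \<xi> in lebesgue. \<exists>j0>0. \<forall>j\<ge>j0. contract j \<xi> \<in> supp \<sigma>" by (simp add: inv_absorbing_def int_iter_contract)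
  then have "AE \<xi> in lebesgue. \<exists>j. spectral j \<xi> \<noteq> 0"
    by eventually_elim (auto simp: supp_def spectral_def)
  then show full_limit by (rule spectral_tendsto_if_AE_nonzero)
qed

lemma positive_limit_iff: "full_limit \<longleftrightarrow> (AE \<xi> in lebesgue. \<exists>l>0. (\<lambda>j. spectral j \<xi>) \<longlonglongrightarrow> l)"
proof
  assume full_limit
  then show "AE \<xi> in lebesgue. \<exists>l>0. (\<lambda>j. spectral j \<xi>) \<longlonglongrightarrow> l" by eventually_elim (auto intro: exI[of _ 1])
next
  assume "AE \<xi> in lebesgue. \<exists>l>0. (\<lambda>j. spectral j \<xi>) \<longlonglongrightarrow> l"
  then have "AE \<xi> in lebesgue. \<exists>j. spectral j \<xi> \<noteq> 0"
  proof eventually_elim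
    case (elim \<xi>)
    then obtain l where l: "l > 0" "(\<lambda>j. spectral j \<xi>) \<longlonglongrightarrow> l" by blast
    from order_tendstoD(1)[OF l(2,1)] obtain N where "0 < spectral N \<xi>" by (auto simp: eventually_sequentially)
    then show ?case by (intro exI[of _ N]) simp
  qed
  then show full_limit by (rule spectral_tendsto_if_AE_nonzero)
qed

lemma zero_set_ratio:
  "measure lebesgue {x \<in> contract j ` ball 0 1. \<sigma> x = 0} / measure lebesgue (contract j ` ball 0 1)
    = measure lebesgue {x \<in> ball 0 1. spectral j x = 0} / measure lebesgue (ball 0 (1::real) :: (real^'n) set)"
proof -
  have E: "{x. \<sigma> x = 0} \<in> sets lebesgue" using measurable_sets[OF \<sigma>m, of "{0}"] by (simp add: vimage_def)
  have "{x \<in> contract j ` ball 0 1. \<sigma> x = 0} = {x. \<sigma> x = 0} \<inter> contract j ` ball 0 1" by auto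
  then show ?thesis using measure_contract_ratio[OF lmeasurable_ball E, of j 0 1] by (simp add: spectral_def)
qed

text \<open>For the converse, the points of the unit ball at which all scales vanish lie in each of
  the zero sets, whose measures tend to 0. At almost all other points of the ball the dichotomy
  gives limit 1.\<close>

lemma locally_nonzero_iff: "full_limit \<longleftrightarrow> locally_nonzero_at_origin (adjoint A) \<sigma>"
proof
  let ?b = "measure lebesgue (ball 0 (1::real) :: (real^'n) set)"
  have b: "?b > 0" using content_ball_pos[of 1 "0::real^'n"] by simp
  have Z: "{x. spectral j x = 0} \<in> sets lebesgue" for j
    using measurable_sets[OF spectral_measurable, of "{0}" j] by (simp add: vimage_def)
  {
    assume full_limit
    then have "AE x in lebesgue. \<forall>\<^sub>F j in sequentially. \<not> spectral j x = 0"
    proof eventually_elim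
      case (elim x)
      from order_tendstoD(1)[OF elim, of 0] show ?case by (auto elim: eventually_mono)
    qed
    from measure_tendsto_0[OF lmeasurable_ball[of 0 1] Z this]
    have "(\<lambda>j. measure lebesgue {x \<in> ball 0 1. spectral j x = 0} / ?b) \<longlonglongrightarrow> 0 / ?b"
      using b by (intro tendsto_divide tendsto_const) auto
    then show "locally_nonzero_at_origin (adjoint A) \<sigma>"
      by (simp add: locally_nonzero_at_origin_def int_iter_contract zero_set_ratio)
  }
  assume "locally_nonzero_at_origin (adjoint A) \<sigma>"
  then have "(\<lambda>j. measure lebesgue {x \<in> ball 0 1. spectral j x = 0} / ?b) \<longlonglongrightarrow> 0"
    by (simp add: locally_nonzero_at_origin_def int_iter_contract zero_set_ratio)
  from tendsto_mult_right[OF this, of ?b]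
  have lim: "(\<lambda>j. measure lebesgue {x \<in> ball 0 1. spectral j x = 0}) \<longlonglongrightarrow> 0" using b by simp
  let ?Z = "\<lambda>j. ball 0 1 \<inter> {x. spectral j x = 0}"
  have eq: "{x \<in> ball 0 1. spectral j x = 0} = ?Z j" for j by auto
  let ?N = "\<Inter>j. ?Z j"
  have Zm: "?Z j \<in> lmeasurable" for j using Z[of j] by (intro fmeasurable_Int_fmeasurable lmeasurable_ball)
  have Ns: "?N \<in> sets lebesgue" using Zm by (intro sets.countable_INT) auto
  have "measure lebesgue ?N \<le> measure lebesgue (?Z j)" for j
    using Ns Zm[of j] by (intro measure_mono_fmeasurable) auto
  then have "measure lebesgue ?N \<le> 0"
    using lim unfolding eq by (intro LIMSEQ_le_const[OF lim[unfolded eq]]) auto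
  then have "measure lebesgue ?N = 0" by (simp add: antisym)
  moreover have "?N \<in> lmeasurable" by (rule fmeasurableI2[OF Zm[of 0] _ Ns]) blast
  ultimately have "?N \<in> null_sets lebesgue" by (simp add: null_sets_def emeasure_eq_measure2 Ns)
  from AE_of_null_sets_lebesgue[OF this] spectral_dichotomy
  have ball: "AE x in lebesgue. x \<in> ball 0 1 \<longrightarrow> (\<lambda>j. spectral j x) \<longlonglongrightarrow> 1"
    by eventually_elim auto
  \<comment> \<open>The limit at \<open>x\<close> is the limit at each contracted point, and every
    point is eventually contracted into the unit ball, so the unit ball decides everywhere.\<close>
  have "AE x in lebesgue. \<forall>k. contract k x \<in> ball 0 1 \<longrightarrow> (\<lambda>j. spectral j x) \<longlonglongrightarrow> 1"
    using AE_linear[OF contract_bij ball] spectral_int_iter[of "- int _"]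
    unfolding AE_all_countable int_iter_contract by auto
  then show full_limit
  proof eventually_elim
    case (elim x)
    obtain k where "norm (contract k x) < 1" using contract_small[of 1 "norm x"] by auto
    with elim show ?case by auto
  qed
qed

end

section \<open>Approximate continuity at the origin\<close>

context refinable_space
begin

text \<open>Near the origin \<sigma> is positive on \<open>E\<close>, so the zeros of \<sigma> in a
  strongly contracted ball avoid \<open>E\<close> up to one point, and their proportion is at most 1
  minus that of \<open>E\<close>.\<close>

lemma locally_nonzero_of_approx_continuous:
  assumes "approx_continuous_at_origin (adjoint A) (\<sigma>(0 := 1))"
  shows "locally_nonzero_at_origin (adjoint A) \<sigma>"
proof -
  let ?m = "measure (lebesgue :: (real^'n) measure)"
  let ?b = "ball 0 1 :: (real^'n) set"
  obtain E where E: "E \<in> sets lebesgue" "\<And>r. r > 0 \<Longrightarrow> (\<lambda>j. ?m (E \<inter> contract j ` ball 0 r) / ?m (contract j ` ball 0 r)) \<longlonglongrightarrow> 1"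
    and lim: "(\<sigma>(0 := 1) \<longlongrightarrow> (\<sigma>(0 := 1)) 0) (at 0 within E)"
    using assms unfolding approx_continuous_at_origin_def density_at_origin_def int_iter_contract by blast
  have "\<forall>\<^sub>F x in at 0 within E. 0 < (\<sigma>(0 := 1)) x" using order_tendstoD(1)[OF lim, of 0] by simp
  then obtain \<delta> where \<delta>: "\<delta> > 0" "\<And>x. x \<in> E \<Longrightarrow> x \<noteq> 0 \<Longrightarrow> norm x < \<delta> \<Longrightarrow> 0 < (\<sigma>(0 := 1)) x"
    by (auto simp: eventually_at)
  obtain N where N: "\<And>j x. j \<ge> N \<Longrightarrow> norm x \<le> 1 \<Longrightarrow> norm (contract j x) < \<delta>" using contract_small[OF \<delta>(1)] by blast
  have "(\<lambda>j. ?m {x \<in> contract j ` ?b. \<sigma> x = 0} / ?m (contract j ` ?b)) \<longlonglongrightarrow> 0"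
  proof (rule tendsto_sandwich[of "\<lambda>_. 0"])
    show "(\<lambda>j. 1 - ?m (E \<inter> contract j ` ?b) / ?m (contract j ` ?b)) \<longlonglongrightarrow> 0"
      using tendsto_diff[OF tendsto_const[of 1] E(2)[of 1]] by simp
    show "\<forall>\<^sub>F j in sequentially. ?m {x \<in> contract j ` ?b. \<sigma> x = 0} / ?m (contract j ` ?b) \<le> 1 - ?m (E \<inter> contract j ` ?b) / ?m (contract j ` ?b)"
      using eventually_ge_at_top[of N]
    proof eventually_elim
      case (elim j)
      let ?C = "contract j ` ?b"
      have C: "?C \<in> lmeasurable" using lmeasurable_linear_image[OF contract_bij(1) lmeasurable_ball] by blast
      have pos: "?m ?C > 0" using measure_contract[OF lmeasurable_ball] det_contract_pos[of j] content_ball_pos[of 1 "0::real^'n"] by simp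
      have Z: "{x. \<sigma> x = 0} \<in> sets lebesgue" using measurable_sets[OF \<sigma>m, of "{0}"] by (simp add: vimage_def)
      have eq: "{x \<in> ?C. \<sigma> x = 0} = ?C \<inter> {x. \<sigma> x = 0}" by auto
      have EC: "E \<inter> ?C \<in> lmeasurable" using fmeasurable_Int_fmeasurable[OF C E(1)] by (simp add: Int_commute)
      have Zc: "{x \<in> ?C. \<sigma> x = 0} \<in> lmeasurable" unfolding eq by (rule fmeasurable_Int_fmeasurable[OF C Z])
      \<comment> \<open>The origin may lie in both sets, since positivity is known only away from it
        and for the modified function at it.\<close>
      have "{x \<in> ?C. \<sigma> x = 0} \<inter> (E \<inter> ?C) \<subseteq> {0}"
      proof
        fix x assume x: "x \<in> {x \<in> ?C. \<sigma> x = 0} \<inter> (E \<inter> ?C)"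
        then have "norm x < \<delta>" using N[OF elim] by auto
        then show "x \<in> {0}" using \<delta>(2)[of x] x by (cases "x = 0") auto
      qed
      then have null: "{x \<in> ?C. \<sigma> x = 0} \<inter> (E \<inter> ?C) \<in> null_sets lebesgue"
        by (metis (no_types, lifting) finite.emptyI finite.insertI negligible_finite negligible_iff_null_sets negligible_subset)
      have "AE x in lebesgue. x \<notin> {x \<in> ?C. \<sigma> x = 0} \<or> x \<notin> E \<inter> ?C"
        using AE_of_null_sets_lebesgue[OF null] by eventually_elim blast
      then have "?m ({x \<in> ?C. \<sigma> x = 0} \<union> (E \<inter> ?C)) = ?m {x \<in> ?C. \<sigma> x = 0} + ?m (E \<inter> ?C)"
        by (rule measure_Un_AE[OF _ Zc EC])
      moreover have "?m ({x \<in> ?C. \<sigma> x = 0} \<union> (E \<inter> ?C)) \<le> ?m ?C"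
        using Zc EC by (intro measure_mono_fmeasurable C) auto
      ultimately have "?m {x \<in> ?C. \<sigma> x = 0} \<le> ?m ?C - ?m (E \<inter> ?C)" by simp
      then have "?m {x \<in> ?C. \<sigma> x = 0} / ?m ?C \<le> (?m ?C - ?m (E \<inter> ?C)) / ?m ?C"
        using pos by (intro divide_right_mono) auto
      then show ?case using pos by (simp add: diff_divide_distrib)
    qed
  qed auto
  then show ?thesis by (simp add: locally_nonzero_at_origin_def int_iter_contract)
qed

text \<open>The set \<open>E\<close> asks for \<open>\<sigma> > 1 - 1/(n+1)\<close> on a ball of radius \<open>\<delta> n\<close>.  The radii are so small
  that rescaled violations of the \<open>n\<close>-th condition have measure at most \<open>2^-n\<close> on every scale, so
  the total measure of the violations tends to \<open>0\<close> by Tannery's theorem.\<close>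

lemma approx_continuous_of_full_limit:
  assumes full_limit
  shows "approx_continuous_at_origin (adjoint A) (\<sigma>(0 := 1))"
proof -
  let ?m = "measure (lebesgue :: (real^'n) measure)"
  define bad where "bad n j = {x. spectral j x \<le> 1 - 1 / real (Suc n)}" for n j
  have bad_sets: "bad n j \<in> sets lebesgue" for n j
    using measurable_sets[OF spectral_measurable, of "{..1 - 1 / real (Suc n)}" j] by (simp add: bad_def vimage_def)
  have bad_lim: "(\<lambda>j. ?m {x \<in> ball 0 r. x \<in> bad n j}) \<longlonglongrightarrow> 0" for n r
  proof (rule measure_tendsto_0[OF lmeasurable_ball])
    show "{x. x \<in> bad n j} \<in> sets lebesgue" for j using bad_sets by simp
    show "AE x in lebesgue. \<forall>\<^sub>F j in sequentially. x \<notin> bad n j"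
      using assms
    proof eventually_elim
      case (elim x)
      have "\<forall>\<^sub>F j in sequentially. 1 - 1 / real (Suc n) < spectral j x" by (rule order_tendstoD(1)[OF elim]) simp
      then show ?case by eventually_elim (simp add: bad_def)
    qed
  qed
  have "\<exists>J. \<forall>j\<ge>J. ?m {x \<in> ball 0 (real n). x \<in> bad n j} \<le> (1/2)^n" for n
  proof -
    have "\<forall>\<^sub>F j in sequentially. ?m {x \<in> ball 0 (real n). x \<in> bad n j} < (1/2)^n"
      by (rule order_tendstoD(2)[OF bad_lim]) simp
    then show ?thesis by (auto simp: eventually_sequentially intro: less_imp_le)
  qed
  then obtain J where J: "\<And>n j. j \<ge> J n \<Longrightarrow> ?m {x \<in> ball 0 (real n). x \<in> bad n j} \<le> (1/2)^n" by metis
  have vol: "?m {x. contract j x \<in> ball 0 \<delta>} = ?m (ball 0 \<delta>) / \<bar>det (matrix (contract j))\<bar>"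
    "{x. contract j x \<in> ball 0 \<delta>} \<in> lmeasurable" for j \<delta>
  proof -
    note c = linear_bij_inv[OF contract_bij, of j]
    have eq: "{x. contract j x \<in> ball 0 \<delta>} = inv (contract j) ` ball 0 \<delta>"
      using bij_vimage_eq_inv_image[OF contract_bij(2), of j "ball 0 \<delta>"] by (simp add: vimage_def)
    show "?m {x. contract j x \<in> ball 0 \<delta>} = ?m (ball 0 \<delta>) / \<bar>det (matrix (contract j))\<bar>"
      "{x. contract j x \<in> ball 0 \<delta>} \<in> lmeasurable"
      unfolding eq using lmeasurable_linear_image[OF c(1) lmeasurable_ball, of 0 \<delta>] c(4)
      by (auto simp: abs_inverse divide_inverse mult.commute)
  qed
  \<comment> \<open>Only the finitely many scales before \<open>J n\<close> remain. At each of them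
    the preimage of a ball has volume proportional to a positive power of the radius, so one small
    radius serves all.\<close>
  have "\<exists>\<delta>>0. \<forall>j<J n. ?m {x. contract j x \<in> ball 0 \<delta>} \<le> (1/2)^n" for n
  proof -
    have "\<forall>\<^sub>F \<delta> in at_right 0. ?m {x. contract j x \<in> ball 0 \<delta>} < (1/2)^n" for j
    proof -
      have "((\<lambda>\<delta>. unit_ball_vol (real CARD('n)) * \<delta> ^ CARD('n) / \<bar>det (matrix (contract j))\<bar>) \<longlongrightarrow>
          unit_ball_vol (real CARD('n)) * 0 ^ CARD('n) / \<bar>det (matrix (contract j))\<bar>) (at_right 0)"
        using det_contract_pos[of j] by (intro tendsto_intros) auto
      then have "\<forall>\<^sub>F \<delta> in at_right 0. unit_ball_vol (real CARD('n)) * \<delta> ^ CARD('n) / \<bar>det (matrix (contract j))\<bar> < (1/2)^n"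
        by (rule order_tendstoD(2)) (simp add: zero_power)
      then show ?thesis using eventually_at_right_less[of 0]
        unfolding vol by eventually_elim (simp add: content_ball)
    qed
    then have "\<forall>\<^sub>F \<delta> in at_right 0. \<forall>j\<in>{..<J n}. ?m {x. contract j x \<in> ball 0 \<delta>} < (1/2)^n"
      by (intro eventually_ball_finite) auto
    then have "\<forall>\<^sub>F \<delta> in at_right 0. \<delta> > 0 \<and> (\<forall>j\<in>{..<J n}. ?m {x. contract j x \<in> ball 0 \<delta>} < (1/2)^n)"
      using eventually_at_right_less[of "0::real"] by eventually_elim simp
    then obtain \<delta> where "\<delta> > 0 \<and> (\<forall>j\<in>{..<J n}. ?m {x. contract j x \<in> ball 0 \<delta>} < (1/2)^n)"
      by (rule eventually_happens'[OF trivial_limit_at_right_real, elim_format]) blast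
    then show ?thesis by (intro exI[of _ \<delta>]) (auto intro: less_imp_le)
  qed
  then obtain \<delta> where \<delta>: "\<And>n. \<delta> n > 0" "\<And>n j. j < J n \<Longrightarrow> ?m {x. contract j x \<in> ball 0 (\<delta> n)} \<le> (1/2)^n" by metis
  define viol where "viol n j = {x. contract j x \<in> ball 0 (\<delta> n)} \<inter> bad n j" for n j
  have viol_sets: "viol n j \<in> sets lebesgue" for n j
    unfolding viol_def using vol(2)[of j "\<delta> n"] bad_sets by (intro sets.Int) auto
  \<comment> \<open>The bound \<sigma> <= 1 is known only almost everywhere; building it into
    \<open>E\<close> makes the estimate near the origin two-sided at every point of
    \<open>E\<close>.\<close>
  define E where "E = {x. \<sigma> x \<le> 1} \<inter> (\<Inter>n. - viol n 0)"
  have E: "E \<in> sets lebesgue"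
  proof -
    have "{x. \<sigma> x \<le> 1} \<in> sets lebesgue" using measurable_sets[OF \<sigma>m, of "{..1}"] by (simp add: vimage_def)
    then show ?thesis unfolding E_def using viol_sets[of _ 0]
      by (intro sets.Int sets.countable_INT) (auto simp: Compl_in_sets_lebesgue)
  qed
  have viol_c: "contract j x \<in> viol n 0 \<longleftrightarrow> x \<in> viol n j" for j x n
    by (simp add: viol_def bad_def spectral_def)
  have sum0: "(\<lambda>j. ?m {x \<in> ball 0 r. contract j x \<notin> E}) \<longlonglongrightarrow> 0" if r: "r > 0" for r
  proof -
    let ?a = "\<lambda>n j. ?m (ball 0 r \<inter> viol n j)"
    have am: "ball 0 r \<inter> viol n j \<in> lmeasurable" for n j
      by (rule fmeasurable_Int_fmeasurable[OF lmeasurable_ball viol_sets])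
    have alim: "(\<lambda>j. ?a n j) \<longlonglongrightarrow> 0" for n
    proof (rule tendsto_sandwich[OF _ _ tendsto_const bad_lim[of r n]])
      show "\<forall>\<^sub>F j in sequentially. ?a n j \<le> ?m {x \<in> ball 0 r. x \<in> bad n j}"
      proof (intro always_eventually allI measure_mono_fmeasurable)
        show "{x \<in> ball 0 r. x \<in> bad n j} \<in> lmeasurable" for j
          using fmeasurable_Int_fmeasurable[OF lmeasurable_ball bad_sets, of 0 r n j] by (simp add: Int_def)
      qed (use am in \<open>auto simp: viol_def\<close>)
    qed simp
    obtain K where K: "r \<le> real K" using real_arch_simple by blast
    \<comment> \<open>Before \<open>J n\<close> the small radius gives the bound, afterwards the
      choice of \<open>J\<close>. That choice used the ball of radius \<open>n\<close>, which
      contains the ball of radius \<open>r\<close> once \<open>n\<close> is at least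
      \<open>K\<close>.\<close>
    have abound: "?a n j \<le> (1/2)^n" if n: "n \<ge> K" for n j
    proof (cases "j < J n")
      case True
      have "?a n j \<le> ?m {x. contract j x \<in> ball 0 (\<delta> n)}"
        using am vol(2) by (intro measure_mono_fmeasurable) (auto simp: viol_def)
      then show ?thesis using \<delta>(2)[OF True] by linarith
    next
      case False
      have "?a n j \<le> ?m {x \<in> ball 0 (real n). x \<in> bad n j}"
      proof (rule measure_mono_fmeasurable)
        show "{x \<in> ball 0 (real n). x \<in> bad n j} \<in> lmeasurable"
          using fmeasurable_Int_fmeasurable[OF lmeasurable_ball bad_sets, of 0 "real n" n j] by (simp add: Int_def)
        have "r \<le> real n" using K n by (meson of_nat_le_iff order_trans)
        then show "ball 0 r \<inter> viol n j \<subseteq> {x \<in> ball 0 (real n). x \<in> bad n j}" by (auto simp: viol_def)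
      qed (use am in auto)
      then show ?thesis using J[of n j] False by simp
    qed
    have ab: "\<forall>\<^sub>F (n, j) in at_top \<times>\<^sub>F sequentially. norm (?a n j) \<le> (1/2)^n"
      unfolding eventually_prod_filter case_prod_conv
      by (intro exI[of _ "\<lambda>n. n \<ge> K"] exI[of _ "\<lambda>_. True"]) (auto simp: eventually_ge_at_top abound)
    have lim: "(\<lambda>j. \<Sum>n. ?a n j) \<longlonglongrightarrow> (\<Sum>n. 0)"
      using tannerys_theorem[OF alim ab] by simp
    have as: "summable (\<lambda>n. ?a n j)" for j
      by (rule summable_comparison_test'[of "\<lambda>n. (1/2)^n" K]) (auto simp: abound)
    have le: "?m {x \<in> ball 0 r. contract j x \<notin> E} \<le> (\<Sum>n. ?a n j)" for j
    proof -
      have Ec: "{x \<in> ball 0 r. contract j x \<notin> E} = ball 0 r \<inter> {x. contract j x \<in> - E}" by auto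
      have S: "{x \<in> ball 0 r. contract j x \<notin> E} \<in> lmeasurable"
        unfolding Ec by (rule fmeasurable_Int_fmeasurable[OF lmeasurable_ball contract_vimage]) (use E in \<open>simp add: Compl_in_sets_lebesgue\<close>)
      have "AE x in lebesgue. contract j x \<notin> E \<longrightarrow> (\<exists>n. x \<in> viol n j)"
        using spectral_AE by eventually_elim (auto simp: E_def viol_c simp flip: spectral_def)
      then have "emeasure lebesgue {x \<in> ball 0 r. contract j x \<notin> E} \<le> emeasure lebesgue (\<Union>n. ball 0 r \<inter> viol n j)"
      proof (rule emeasure_mono_AE[OF eventually_mono])
        show "(\<Union>n. ball 0 r \<inter> viol n j) \<in> sets lebesgue" using am by (intro sets.countable_UN) auto
      qed auto
      also have "\<dots> \<le> (\<Sum>n. emeasure lebesgue (ball 0 r \<inter> viol n j))"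
        using am by (intro emeasure_subadditive_countably) auto
      also have "\<dots> = (\<Sum>n. ennreal (?a n j))"
        by (intro suminf_cong emeasure_eq_measure2 am)
      also have "\<dots> = ennreal (\<Sum>n. ?a n j)" by (rule suminf_ennreal2[OF _ as]) simp
      finally show ?thesis
        using S as by (simp add: emeasure_eq_measure2 suminf_nonneg)
    qed
    show ?thesis
      by (rule tendsto_sandwich[of "\<lambda>_. 0", OF _ _ tendsto_const]) (use le lim in auto)
  qed
  have dens: "(\<lambda>j. ?m (E \<inter> contract j ` ball 0 r) / ?m (contract j ` ball 0 r)) \<longlonglongrightarrow> 1" if r: "r > 0" for r
  proof -
    have pos: "?m (ball 0 r) > 0" using content_ball_pos[OF r, of "0::real^'n"] by simp
    have "?m {x \<in> ball 0 r. contract j x \<in> E} = ?m (ball 0 r) - ?m {x \<in> ball 0 r. contract j x \<notin> E}" for j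
    proof -
      let ?X = "ball 0 r \<inter> {x. contract j x \<in> E}"
      have X: "?X \<in> lmeasurable" by (rule fmeasurable_Int_fmeasurable[OF lmeasurable_ball contract_vimage[OF E]])
      have "?m (ball 0 r - ?X) = ?m (ball 0 r) - ?m ?X"
        by (rule measurable_measure_Diff[OF lmeasurable_ball fmeasurableD[OF X]]) auto
      moreover have "ball 0 r - ?X = {x \<in> ball 0 r. contract j x \<notin> E}" "?X = {x \<in> ball 0 r. contract j x \<in> E}" by auto
      ultimately show ?thesis by simp
    qed
    then have "?m (E \<inter> contract j ` ball 0 r) / ?m (contract j ` ball 0 r)
        = 1 - ?m {x \<in> ball 0 r. contract j x \<notin> E} / ?m (ball 0 r)" for j
      unfolding measure_contract_ratio[OF lmeasurable_ball E] using pos by (simp add: diff_divide_distrib)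
    moreover have "(\<lambda>j. 1 - ?m {x \<in> ball 0 r. contract j x \<notin> E} / ?m (ball 0 r)) \<longlonglongrightarrow> 1 - 0 / ?m (ball 0 r)"
      using pos by (intro tendsto_intros sum0[OF r]) auto
    ultimately show ?thesis by simp
  qed
  \<comment> \<open>A null set would have density 0 at every scale.\<close>
  have pos: "emeasure lebesgue E > 0"
  proof (rule ccontr)
    assume "\<not> emeasure lebesgue E > 0"
    then have "E \<in> null_sets lebesgue" using E by (simp add: null_sets_def)
    then have "?m (E \<inter> contract j ` ball 0 1) = 0" for j
      by (metis Int_lower1 measure_eq_0_null_sets null_sets_completion_subset)
    then have "(\<lambda>j::nat. 0::real) \<longlonglongrightarrow> 1" using dens[of 1] by simp
    then show False using LIMSEQ_unique[OF tendsto_const[of "0::real"]] by fastforce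
  qed
  have lim: "(\<sigma>(0 := 1) \<longlongrightarrow> (\<sigma>(0 := 1)) 0) (at 0 within E)"
  proof (rule tendstoI)
    fix \<epsilon> :: real assume "\<epsilon> > 0"
    then obtain n where n: "1 / real (Suc n) < \<epsilon>" using nat_approx_posE by blast
    have "dist ((\<sigma>(0 := 1)) x) ((\<sigma>(0 := 1)) 0) < \<epsilon>" if "x \<in> E" "x \<noteq> 0" "dist x 0 < \<delta> n" for x
    proof -
      have "\<sigma> x \<le> 1" "x \<notin> viol n 0" using that(1) by (auto simp: E_def)
      then have "1 - 1 / real (Suc n) < \<sigma> x" using that(3) by (auto simp: viol_def bad_def)
      with \<open>\<sigma> x \<le> 1\<close> n that(2) show ?thesis by (simp add: dist_real_def)
    qed
    then show "\<forall>\<^sub>F x in at 0 within E. dist ((\<sigma>(0 := 1)) x) ((\<sigma>(0 := 1)) 0) < \<epsilon>"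
      unfolding eventually_at using \<delta>(1) by blast
  qed
  have "\<sigma>(0 := 1) \<in> borel_measurable lebesgue"
  proof -
    have "(\<lambda>x. if x \<in> {0} then 1 else \<sigma> x) \<in> borel_measurable lebesgue"
      by (intro measurable_If_set) auto
    then show ?thesis by (simp add: fun_upd_def)
  qed
  then show ?thesis
    unfolding approx_continuous_at_origin_def density_at_origin_def int_iter_contract
    using E pos dens lim by blast
qed

lemma approx_continuous_iff: "full_limit \<longleftrightarrow> approx_continuous_at_origin (adjoint A) (\<sigma>(0 := 1))"
  using approx_continuous_of_full_limit locally_nonzero_of_approx_continuous locally_nonzero_iff by blast

text \<open>Part of a cycle: the full limit gives density, density gives the essential unions, and
  these give back the full limit.\<close>

lemma dense_iff: "full_limit \<longleftrightarrow> L2_closure (\<Union>j. int_iter (dilation_op A) j ` V) = L2"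
  using dense_of_full_limit essential_union_of_dense full_limit_of_essential_union by blast

lemma essential_union_iff: "full_limit \<longleftrightarrow> (\<forall>G. G \<subseteq> V \<and> generates G V \<longrightarrow>
    is_essential_union {int_iter (adjoint A) j ` supp (fourier \<phi>) | \<phi> j. \<phi> \<in> G} UNIV)"
  using dense_of_full_limit essential_union_of_dense full_limit_of_essential_union by blast

end

theorem theorem1p6:
  fixes A :: "real ^ 'n \<Rightarrow> real ^ 'n"
    and V :: "(real ^ 'n \<Rightarrow> complex) set"
    and \<sigma> :: "real ^ 'n \<Rightarrow> real"
  assumes "expansive_dilation A"
    and "shift_invariant V"
    and "refinable A V"
    and "is_spectral_function V \<sigma>"
  shows "all_equivalent
    [ L2_closure (\<Union>j. int_iter (dilation_op A) j ` V) = L2,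
      \<forall>G. G \<subseteq> V \<and> generates G V \<longrightarrow>
        is_essential_union {int_iter (adjoint A) j ` supp (fourier \<phi>) | \<phi> j. \<phi> \<in> G} UNIV,
      \<forall>E. E \<in> sets lebesgue \<and> bounded E \<and> emeasure lebesgue E > 0 \<longrightarrow>
        (\<lambda>j. 1 / measure lebesgue (int_iter (adjoint A) (- int j) ` E) *
              (LINT \<xi>:int_iter (adjoint A) (- int j) ` E|lebesgue. \<sigma> \<xi>)) \<longlonglongrightarrow> 1,
      inv_absorbing (adjoint A) (supp \<sigma>),
      AE \<xi> in lebesgue. \<exists>l>0. (\<lambda>j. \<sigma> (int_iter (adjoint A) (- int j) \<xi>)) \<longlonglongrightarrow> l,
      AE \<xi> in lebesgue. (\<lambda>j. \<sigma> (int_iter (adjoint A) (- int j) \<xi>)) \<longlonglongrightarrow> 1,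
      locally_nonzero_at_origin (adjoint A) \<sigma>,
      approx_continuous_at_origin (adjoint A) (\<sigma>(0 := 1)) ]"
proof -
  obtain I \<phi> where "tight_frame_generator I \<phi> V" "\<sigma> \<in> borel_measurable lebesgue"
    "AE \<xi> in lebesgue. ((\<lambda>\<alpha>. (cmod (fourier (\<phi> \<alpha>) \<xi>))\<^sup>2) has_sum \<sigma> \<xi>) I"
    using assms(4) unfolding is_spectral_function_def by blast
  then interpret refinable_space A V \<sigma> I \<phi>
    using assms(1-3) by unfold_locales
  \<comment> \<open>Reverses the equivalences for rewriting, so that every entry of the list turns
    into the same proposition \<open>full_limit\<close>.\<close>
  have eqs: "full_limit = P \<Longrightarrow> P = full_limit" for P by simp
  show ?thesis
    unfolding int_iter_contract all_equivalent_def spectral_def[symmetric]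
      eqs[OF dense_iff] eqs[OF essential_union_iff] eqs[OF average_iff] eqs[OF absorbing_iff]
      eqs[OF positive_limit_iff] eqs[OF locally_nonzero_iff] eqs[OF approx_continuous_iff]
    by simp
qed

end
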